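(* Let $\mathcal G$ be a Hilbert space, let $Q\in\mathcal N(\mathcal G)$ have the minimal realisation $(\Pi,A,\gamma)$ (with base point $\lambda_0$), and let $\omega\in\mathbb R$. For $f_0,g_0\in\mathcal G$ the following statements are equivalent. (A) The function $Q$ has a directional function $f$ at $\omega$ such that $f(\lambda)\to f_0$ and $Q(\lambda)f(\lambda)\to g_0$ as $\lambda\hat\to\omega$. (A') $(f_0;g_0)$ is a directional pair of $Q$ at $\omega$. (B) $(f_0;g_0)\in Q(\omega)$. (C) There exists an element $v\in\Pi$ such that $$\gamma f_0=\big(I+(\lambda_0-\omega)(A-\lambda_0)^{-1}\big)v,\qquad g_0=Q(\lambda_0)^*f_0+(\omega-\overline{\lambda_0})\gamma^+v.$$ The element $v$ is uniquely determined by $(f_0;g_0)$. If $Q$ is strict then, conversely, $(f_0;g_0)$ is uniquely determined by $v$.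
   Context: Generalised Nevanlinna functions: let $\mathcal G$ be a Hilbert space and $\mathcal B(\mathcal G)$ the bounded linear operators on it. A $\mathcal B(\mathcal G)$-valued function $Q$, meromorphic on $\mathbb C\setminus\mathbb R$ with $Q(\lambda)^*=Q(\overline\lambda)$ at all points of holomorphy, belongs to $\mathcal N_\kappa(\mathcal G)$ if the kernel $K_Q(\lambda,\mu)=\frac{Q(\lambda)-Q(\mu)^*}{\lambda-\overline\mu}$ has $\kappa$ negative squares, i.e. for any $m\in\mathbb N$, points of holomorphy $\lambda_1,\dots,\lambda_m\in\mathbb C^+$ and $\xi_1,\dots,\xi_m\in\mathcal G$ the matrix $\big((K_Q(\lambda_i,\lambda_j)\xi_i,\xi_j)\big)_{i,j=1}^m$ has at most $\kappa$ negative eigenvalues and $\kappa$ is minimal with this property. $\mathcal N(\mathcal G)=\bigcup_{\kappa\ge0}\mathcal N_\kappa(\mathcal G)$. The extended domain of holomorphy $\mathfrak h(Q)$ consists of all points of $\mathbb C\setminus\mathbb R$ where $Q$ is holomorphic and all $\mu\in\mathbb R$ such that $Q$ has a holomorphic continuation to a neighbourhood of $\mu$. Linear relations are linear subspaces of products of spaces, with elements written $(x;y)$; operators are identified with their graphs, and inverses, sums and products are taken in the sense of relations. Minimal realisation: $(\Pi,A,\gamma)$, where $\Pi$ is a Pontryagin space (finite index of negativity), $A$ is a self-adjoint linear relation in $\Pi$, $\gamma:\mathcal G\to\Pi$ is a bounded linear map with adjoint $\gamma^+$ (with respect to the inner product of $\Pi$), and with a fixed point $\lambda_0\in\mathfrak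 h(Q)\cap\rho(A)\cap\mathbb C^+$ it holds, for $\lambda\in\mathfrak h(Q)\cap\rho(A)$, that $Q(\lambda)=Q(\lambda_0)^*+(\lambda-\overline{\lambda_0})\gamma^+\big(I+(\lambda-\lambda_0)(A-\lambda)^{-1}\big)\gamma$, and moreover $\Pi=\overline{\mathrm{span}}\{(I+(\lambda-\lambda_0)(A-\lambda)^{-1})\gamma x : \lambda\in\rho(A),\ x\in\mathcal G\}$. Minimality implies $\mathfrak h(Q)=\rho(A)$. Nontangential limits: $\lambda\hat\to\omega$ means $\lambda\to\omega$ within $W_{\omega,\theta}=\{\omega+re^{i\phi}: r>0,\ |\phi-\frac\pi2|\le\frac\pi2-\theta\}$, for every $\theta\in(0,\frac\pi2)$. Directional functions: for $\omega\in\mathbb R$ and a neighbourhood $\mathcal U_\omega$ of $\omega$, an analytic function $f:\mathcal U_\omega\cap\mathfrak h(Q)\cap\mathbb C^+\to\mathcal G$ is a directional function of $Q$ at $\omega$ if the limits $f_0=\lim_{\lambda\hat\to\omega}f(\lambda)$ and $g_0=\lim_{\lambda\hat\to\omega}Q(\lambda)f(\lambda)$ exist and $\big(\frac{Q(\lambda)-Q(\lambda)^*}{\lambda-\overline\lambda}f(\lambda),f(\lambda)\big)_{\mathcal G}$ is bounded as $\lambda\hat\to\omega$. In this case $(f_0;g_0)$ is called a directional pair of $Q$ at $\omega$. Generalised value: for $\omega\in\mathbb R$, $Q(\omega)$ is the linear relation in $\mathcal G\times\mathcal G$ defined by $Q(\omega)=Q(\lambda_0)^*+(\omega-\overline{\lambda_0})\gamma^+\big(I+(\omega-\lambda_0)(A-\omega)^{-1}\big)\gamma$,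 with $(A-\omega)^{-1}$ understood as a relation (it does not depend on the choice of minimal realisation). Strictness: $Q$ is strict if for any $\mu\in\rho(A)$ one has $\bigcap_{\lambda\in\rho(A)}\ker\frac{Q(\lambda)-Q(\mu)^*}{\lambda-\overline\mu}=\{0\}$ (the quotient being understood as the derivative when $\lambda=\overline\mu$). *)

theory Defs
  imports "HOL-Analysis.Analysis" "Jordan_Normal_Form.Char_Poly"
begin

section \<open>Complex Banach and Hilbert spaces\<close>

class scaleC =
  fixes scaleC :: "complex \<Rightarrow> 'a \<Rightarrow> 'a"  (infixr "*\<^sub>C" 75)

class complex_vector = real_vector + scaleC +
  assumes scaleC_add_right: "c *\<^sub>C (x + y) = c *\<^sub>C x + c *\<^sub>C y"
    and scaleC_add_left: "(c + d) *\<^sub>C x = c *\<^sub>C x + d *\<^sub>C x"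
    and scaleC_scaleC: "c *\<^sub>C d *\<^sub>C x = (c * d) *\<^sub>C x"
    and scaleC_of_real: "complex_of_real r *\<^sub>C x = r *\<^sub>R x"

lemma scaleC_one [simp]: "1 *\<^sub>C x = (x :: 'a::complex_vector)"
  using scaleC_of_real[of 1 x] by simp

global_interpretation complex_vector: vector_space "scaleC :: complex \<Rightarrow> 'a \<Rightarrow> 'a::complex_vector"
  defines csubspace = complex_vector.subspace and cspan = complex_vector.span
  by standard (simp_all add: scaleC_add_right scaleC_add_left scaleC_scaleC)

class complex_normed_vector = complex_vector + real_normed_vector +
  assumes norm_scaleC: "norm (c *\<^sub>C x) = cmod c * norm x"

class complex_banach = complex_normed_vector + complete_space

text \<open>The complex inner product is linear in the first argument; its real part is the
  real inner product, so that norm and topology are the ones of \<^class>\<open>real_inner\<close>.\<close>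

class complex_hilbert = complex_vector + real_inner + complete_space +
  fixes cinner :: "'a \<Rightarrow> 'a \<Rightarrow> complex"
  assumes cinner_add_left: "cinner (x + y) z = cinner x z + cinner y z"
    and cinner_scaleC_left: "cinner (c *\<^sub>C x) z = c * cinner x z"
    and cinner_commute: "cinner y x = cnj (cinner x y)"
    and Re_cinner: "Re (cinner x y) = inner x y"
begin

lemma cinner_self: "cinner x x = complex_of_real ((norm x)\<^sup>2)"
proof (rule complex_eqI)
  show "Re (cinner x x) = Re (complex_of_real ((norm x)\<^sup>2))"
    by (simp add: Re_cinner power2_norm_eq_inner)
  show "Im (cinner x x) = Im (complex_of_real ((norm x)\<^sup>2))"
    using arg_cong[OF cinner_commute[of x x], of Im] by simp
qed

subclass complex_normed_vector
proof
  fix c x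
  have "cinner (c *\<^sub>C x) (c *\<^sub>C x) = (c * cnj c) * cinner x x"
    by (subst cinner_scaleC_left, subst cinner_commute, subst cinner_scaleC_left)
      (simp add: cinner_self)
  then have "complex_of_real ((norm (c *\<^sub>C x))\<^sup>2) = complex_of_real ((cmod c * norm x)\<^sup>2)"
    by (simp add: cinner_self complex_norm_square[symmetric] power_mult_distrib)
  then have "(norm (c *\<^sub>C x))\<^sup>2 = (cmod c * norm x)\<^sup>2"
    using of_real_eq_iff by blast
  then show "norm (c *\<^sub>C x) = cmod c * norm x"
    by (rule power2_eq_imp_eq) simp_all
qed

subclass complex_banach ..

end

lemma bounded_linear_scaleC:
  "bounded_linear (\<lambda>x. c *\<^sub>C (x :: 'a::complex_normed_vector))"
proof (rule bounded_linear_intro)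
  fix x y :: 'a and r :: real
  show "c *\<^sub>C (x + y) = c *\<^sub>C x + c *\<^sub>C y"
    by (rule scaleC_add_right)
  show "c *\<^sub>C (r *\<^sub>R x) = r *\<^sub>R (c *\<^sub>C x)"
    by (simp add: scaleC_of_real[symmetric] scaleC_scaleC mult.commute)
  show "norm (c *\<^sub>C x) \<le> norm x * cmod c"
    by (simp add: norm_scaleC mult.commute)
qed

text \<open>Bounded complex linear operators are the elements \<open>T\<close> of the library type of bounded
  real linear operators with \<open>clinear_op T\<close>.\<close>

instantiation blinfun :: (real_normed_vector, complex_normed_vector) complex_normed_vector
begin

lift_definition scaleC_blinfun :: "complex \<Rightarrow> ('a \<Rightarrow>\<^sub>L 'b) \<Rightarrow> 'a \<Rightarrow>\<^sub>L 'b"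
  is "\<lambda>c f x. c *\<^sub>C f x"
  by (rule bounded_linear_compose[OF bounded_linear_scaleC])

instance
proof
  fix c d :: complex and r :: real and f g :: "'a \<Rightarrow>\<^sub>L 'b"
  show "c *\<^sub>C (f + g) = c *\<^sub>C f + c *\<^sub>C g"
    by transfer (simp add: scaleC_add_right)
  show "(c + d) *\<^sub>C f = c *\<^sub>C f + d *\<^sub>C f"
    by transfer (simp add: scaleC_add_left)
  show assoc: "c *\<^sub>C d *\<^sub>C f = (c * d) *\<^sub>C f" for c d and f :: "'a \<Rightarrow>\<^sub>L 'b"
    by transfer (simp add: scaleC_scaleC)
  show "complex_of_real r *\<^sub>C f = r *\<^sub>R f"
    by transfer (simp add: scaleC_of_real)
  have le: "norm (c *\<^sub>C f) \<le> cmod c * norm f" for c and f :: "'a \<Rightarrow>\<^sub>L 'b"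
  proof (rule norm_blinfun_bound)
    fix x
    show "norm (blinfun_apply (c *\<^sub>C f) x) \<le> cmod c * norm f * norm x"
      using mult_left_mono[OF norm_blinfun[of f x], of "cmod c"]
      by (simp add: scaleC_blinfun.rep_eq norm_scaleC mult.assoc)
  qed simp
  show "norm (c *\<^sub>C f) = cmod c * norm f"
  proof (cases "c = 0")
    case True
    then show ?thesis
      using le[of c f] by simp
  next
    case False
    have one: "1 *\<^sub>C f = f"
      by transfer simp
    have "norm f = norm (inverse c *\<^sub>C c *\<^sub>C f)"
      using False by (simp add: assoc one)
    also have "\<dots> \<le> cmod (inverse c) * norm (c *\<^sub>C f)"
      by (rule le)
    finally have "cmod c * norm f \<le> norm (c *\<^sub>C f)"
      using False by (simp add: norm_inverse norm_divide field_simps)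
    then show ?thesis
      using le[of c f] by simp
  qed
qed

end

definition clinear_op :: "('a::complex_normed_vector \<Rightarrow>\<^sub>L 'b::complex_normed_vector) \<Rightarrow> bool" where
  "clinear_op T \<longleftrightarrow> (\<forall>c x. T (c *\<^sub>C x) = c *\<^sub>C T x)"

text \<open>Adjoint of a bounded operator with respect to (possibly indefinite) inner products
  \<open>f\<close> on the domain and \<open>g\<close> on the codomain.\<close>

definition form_adjoint ::
  "('a \<Rightarrow> 'a \<Rightarrow> complex) \<Rightarrow> ('b \<Rightarrow> 'b \<Rightarrow> complex) \<Rightarrow>
   ('a::complex_normed_vector \<Rightarrow>\<^sub>L 'b::complex_normed_vector) \<Rightarrow> ('b \<Rightarrow>\<^sub>L 'a)" where
  "form_adjoint f g T = (THE S. \<forall>x y. g (blinfun_apply T x) y = f x (blinfun_apply S y))"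

definition cadjoint :: "('a::complex_hilbert \<Rightarrow>\<^sub>L 'b::complex_hilbert) \<Rightarrow> ('b \<Rightarrow>\<^sub>L 'a)" where
  "cadjoint = form_adjoint cinner cinner"

section \<open>Holomorphic vector-valued functions\<close>

definition has_cderivative ::
  "(complex \<Rightarrow> 'a::complex_normed_vector) \<Rightarrow> 'a \<Rightarrow> complex filter \<Rightarrow> bool" where
  "has_cderivative F D net \<longleftrightarrow> (F has_derivative (\<lambda>h. h *\<^sub>C D)) net"

definition cderiv :: "(complex \<Rightarrow> 'a::complex_normed_vector) \<Rightarrow> complex \<Rightarrow> 'a" where
  "cderiv F z = (THE D. has_cderivative F D (at z))"

definition vholomorphic_on :: "(complex \<Rightarrow> 'a::complex_normed_vector) \<Rightarrow> complex set \<Rightarrow> bool" where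
  "vholomorphic_on F S \<longleftrightarrow> (\<forall>z\<in>S. \<exists>D. has_cderivative F D (at z within S))"

definition vholomorphic_at :: "(complex \<Rightarrow> 'a::complex_normed_vector) \<Rightarrow> complex \<Rightarrow> bool" where
  "vholomorphic_at F z \<longleftrightarrow> (\<exists>U. open U \<and> z \<in> U \<and> vholomorphic_on F U)"

definition vpole :: "(complex \<Rightarrow> 'a::complex_normed_vector) \<Rightarrow> complex \<Rightarrow> bool" where
  "vpole F z \<longleftrightarrow> (\<exists>n>0. \<exists>H. vholomorphic_at H z \<and> H z \<noteq> 0 \<and>
     (\<forall>\<^sub>F w in at z. F w = inverse ((w - z) ^ n) *\<^sub>C H w))"

text \<open>Values at poles are arbitrary. Removable singularities are assumed to be removed: every
  point is either a point of holomorphy or a proper pole.\<close>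

definition vmeromorphic_on :: "(complex \<Rightarrow> 'a::complex_normed_vector) \<Rightarrow> complex set \<Rightarrow> bool" where
  "vmeromorphic_on F S \<longleftrightarrow> (\<forall>z\<in>S. vholomorphic_at F z \<or> vpole F z)"

section \<open>Generalised Nevanlinna functions\<close>

text \<open>Functions \<open>Q\<close> below are total, but only their values off the real axis matter. On the real
  axis \<open>hext Q\<close> gives the value of the holomorphic continuation, where there is one.\<close>

definition hdom :: "(complex \<Rightarrow> 'a::complex_normed_vector) \<Rightarrow> complex set" where
  "hdom Q = {z. z \<notin> \<real> \<and> vholomorphic_at Q z} \<union>
     {z. z \<in> \<real> \<and> (\<exists>r>0. \<exists>F. vholomorphic_on F (ball z r) \<and> (\<forall>w\<in>ball z r - \<real>. F w = Q w))}"

definition hext :: "(complex \<Rightarrow> 'a::complex_normed_vector) \<Rightarrow> complex \<Rightarrow> 'a" where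
  "hext Q z = (if z \<in> \<real> then Lim (at z within - \<real>) Q else Q z)"

definition upper_half_plane :: "complex set" where
  "upper_half_plane = {z. 0 < Im z}"

definition nev_kernel ::
  "(complex \<Rightarrow> ('g::complex_hilbert \<Rightarrow>\<^sub>L 'g)) \<Rightarrow> complex \<Rightarrow> complex \<Rightarrow> ('g \<Rightarrow>\<^sub>L 'g)" where
  "nev_kernel Q z w = (if z = cnj w then cderiv Q z
     else inverse (z - cnj w) *\<^sub>C (Q z - cadjoint (Q w)))"

text \<open>Number of negative eigenvalues, counted with multiplicity.\<close>

definition neg_eigenvalue_count :: "complex mat \<Rightarrow> nat" where
  "neg_eigenvalue_count M =
     (\<Sum>x\<in>{x. eigenvalue M x \<and> x \<in> \<real> \<and> Re x < 0}. Polynomial.order x (char_poly M))"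

definition at_most_negative_squares ::
  "(complex \<Rightarrow> ('g::complex_hilbert \<Rightarrow>\<^sub>L 'g)) \<Rightarrow> nat \<Rightarrow> bool" where
  "at_most_negative_squares Q k \<longleftrightarrow>
     (\<forall>m (l :: nat \<Rightarrow> complex) (\<xi> :: nat \<Rightarrow> 'g).
        (\<forall>i<m. l i \<in> upper_half_plane \<and> vholomorphic_at Q (l i)) \<longrightarrow>
        neg_eigenvalue_count
          (mat m m (\<lambda>(i, j). cinner (blinfun_apply (nev_kernel Q (l i) (l j)) (\<xi> i)) (\<xi> j))) \<le> k)"

definition nevanlinna_class :: "nat \<Rightarrow> (complex \<Rightarrow> ('g::complex_hilbert \<Rightarrow>\<^sub>L 'g)) set" where
  "nevanlinna_class k = {Q.
     vmeromorphic_on Q (- \<real>) \<and>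
     (\<forall>z. z \<notin> \<real> \<and> vholomorphic_at Q z \<longrightarrow> clinear_op (Q z) \<and> cadjoint (Q z) = Q (cnj z)) \<and>
     at_most_negative_squares Q k \<and>
     (\<forall>k'<k. \<not> at_most_negative_squares Q k')}"

definition generalised_nevanlinna :: "(complex \<Rightarrow> ('g::complex_hilbert \<Rightarrow>\<^sub>L 'g)) set" where
  "generalised_nevanlinna = (\<Union>k. nevanlinna_class k)"

section \<open>Linear relations\<close>

definition op_graph :: "('a::real_normed_vector \<Rightarrow>\<^sub>L 'b::real_normed_vector) \<Rightarrow> ('a \<times> 'b) set" where
  "op_graph T = {(x, blinfun_apply T x) | x. True}"

definition rel_add :: "('a \<times> 'b::plus) set \<Rightarrow> ('a \<times> 'b) set \<Rightarrow> ('a \<times> 'b) set" where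
  "rel_add S T = {(x, y + z) | x y z. (x, y) \<in> S \<and> (x, z) \<in> T}"

definition rel_scale :: "complex \<Rightarrow> ('a \<times> 'b::complex_vector) set \<Rightarrow> ('a \<times> 'b) set" where
  "rel_scale c S = {(x, c *\<^sub>C y) | x y. (x, y) \<in> S}"

definition rel_shift :: "('a \<times> 'a::complex_vector) set \<Rightarrow> complex \<Rightarrow> ('a \<times> 'a) set" where
  "rel_shift A z = {(x, y - z *\<^sub>C x) | x y. (x, y) \<in> A}"

definition resolvent_set :: "('p \<times> 'p::complex_banach) set \<Rightarrow> complex set" where
  "resolvent_set A = {z. \<exists>R. clinear_op R \<and> (rel_shift A z)\<inverse> = op_graph R}"

definition resolvent :: "('p \<times> 'p::complex_banach) set \<Rightarrow> complex \<Rightarrow> ('p \<Rightarrow>\<^sub>L 'p)" where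
  "resolvent A z = (THE R. (rel_shift A z)\<inverse> = op_graph R)"

definition rel_adjoint ::
  "('p \<Rightarrow> 'p \<Rightarrow> complex) \<Rightarrow> ('p \<times> 'p::complex_banach) set \<Rightarrow> ('p \<times> 'p) set" where
  "rel_adjoint ip A = {(u, u'). \<forall>(x, x')\<in>A. ip x' u = ip x u'}"

definition self_adjoint_rel ::
  "('p \<Rightarrow> 'p \<Rightarrow> complex) \<Rightarrow> ('p \<times> 'p::complex_banach) set \<Rightarrow> bool" where
  "self_adjoint_rel ip A \<longleftrightarrow> rel_adjoint ip A = A"

section \<open>Pontryagin spaces and minimal realisations\<close>

text \<open>A Pontryagin space is a complex vector space with an inner product \<open>ip\<close> admitting a
  fundamental decomposition into a Hilbert space \<open>P\<close> and a finite-dimensional anti-Hilbert space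
  \<open>N\<close>. All fundamental decompositions induce equivalent complete norms
  \<open>sqrt ([p, p] - [n, n])\<close>; the norm of the type is any norm equivalent to these. Completeness of
  \<open>P\<close> with respect to \<open>ip\<close> follows from completeness of the type and norm equivalence.\<close>

definition pontryagin_space :: "('p::complex_banach \<Rightarrow> 'p \<Rightarrow> complex) \<Rightarrow> bool" where
  "pontryagin_space ip \<longleftrightarrow>
     (\<forall>x y z. ip (x + y) z = ip x z + ip y z) \<and>
     (\<forall>c x z. ip (c *\<^sub>C x) z = c * ip x z) \<and>
     (\<forall>x y. ip y x = cnj (ip x y)) \<and>
     (\<exists>P N. csubspace P \<and> csubspace N \<and>
        (\<exists>B. finite B \<and> N = cspan B) \<and>
        (\<forall>x. \<exists>p\<in>P. \<exists>n\<in>N. x = p + n) \<and> P \<inter> N = {0} \<and>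
        (\<forall>p\<in>P. \<forall>n\<in>N. ip p n = 0) \<and>
        (\<forall>p\<in>P. p \<noteq> 0 \<longrightarrow> 0 < Re (ip p p)) \<and>
        (\<forall>n\<in>N. n \<noteq> 0 \<longrightarrow> Re (ip n n) < 0) \<and>
        (\<exists>a>0. \<exists>b>0. \<forall>p\<in>P. \<forall>n\<in>N.
           a * norm (p + n) \<le> sqrt (Re (ip p p) - Re (ip n n)) \<and>
           sqrt (Re (ip p p) - Re (ip n n)) \<le> b * norm (p + n)))"

definition minimal_realisation ::
  "(complex \<Rightarrow> ('g::complex_hilbert \<Rightarrow>\<^sub>L 'g)) \<Rightarrow> ('p::complex_banach \<Rightarrow> 'p \<Rightarrow> complex) \<Rightarrow>
   ('p \<times> 'p) set \<Rightarrow> ('g \<Rightarrow>\<^sub>L 'p) \<Rightarrow> complex \<Rightarrow> bool" where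
  "minimal_realisation Q ip A \<gamma> z0 \<longleftrightarrow>
     pontryagin_space ip \<and> self_adjoint_rel ip A \<and> clinear_op \<gamma> \<and>
     z0 \<in> hdom Q \<inter> resolvent_set A \<inter> upper_half_plane \<and>
     (\<forall>z\<in>hdom Q \<inter> resolvent_set A.
        hext Q z = cadjoint (Q z0) + (z - cnj z0) *\<^sub>C
          (form_adjoint cinner ip \<gamma> o\<^sub>L (id_blinfun + (z - z0) *\<^sub>C resolvent A z) o\<^sub>L \<gamma>)) \<and>
     closure (cspan {blinfun_apply (id_blinfun + (z - z0) *\<^sub>C resolvent A z) (blinfun_apply \<gamma> x) | z x.
        z \<in> resolvent_set A}) = UNIV"

text \<open>Relation products are written in library notation: the product \<open>S T\<close> is \<open>T O S\<close>.\<close>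

definition generalised_value ::
  "(complex \<Rightarrow> ('g::complex_hilbert \<Rightarrow>\<^sub>L 'g)) \<Rightarrow> ('p::complex_banach \<Rightarrow> 'p \<Rightarrow> complex) \<Rightarrow>
   ('p \<times> 'p) set \<Rightarrow> ('g \<Rightarrow>\<^sub>L 'p) \<Rightarrow> complex \<Rightarrow> real \<Rightarrow> ('g \<times> 'g) set" where
  "generalised_value Q ip A \<gamma> z0 \<omega> =
     rel_add (op_graph (cadjoint (Q z0)))
       (rel_scale (complex_of_real \<omega> - cnj z0)
          (op_graph \<gamma> O
           rel_add Id (rel_scale (complex_of_real \<omega> - z0) ((rel_shift A (complex_of_real \<omega>))\<inverse>)) O
           op_graph (form_adjoint cinner ip \<gamma>)))"

text \<open>\<open>A\<close> is the relation of a minimal realisation of \<open>Q\<close>; it enters only through its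
  resolvent set, which is \<open>hdom Q\<close>.\<close>

definition strict_nevanlinna ::
  "(complex \<Rightarrow> ('g::complex_hilbert \<Rightarrow>\<^sub>L 'g)) \<Rightarrow> ('p \<times> 'p::complex_banach) set \<Rightarrow> bool" where
  "strict_nevanlinna Q A \<longleftrightarrow>
     (\<forall>w\<in>resolvent_set A.
        (\<Inter>z\<in>resolvent_set A. {x. blinfun_apply (nev_kernel (hext Q) z w) x = 0}) = {0})"

section \<open>Directional functions\<close>

definition nt_sector :: "real \<Rightarrow> real \<Rightarrow> complex set" where
  "nt_sector \<omega> \<theta> =
     {complex_of_real \<omega> + rcis r \<phi> | r \<phi>. r > 0 \<and> \<bar>\<phi> - pi / 2\<bar> \<le> pi / 2 - \<theta>}"

text \<open>Nontangential limits and boundedness at \<open>\<omega>\<close> of functions defined on \<open>D\<close>.\<close>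

definition nt_tendsto ::
  "complex set \<Rightarrow> (complex \<Rightarrow> 'a::topological_space) \<Rightarrow> 'a \<Rightarrow> real \<Rightarrow> bool" where
  "nt_tendsto D F l \<omega> \<longleftrightarrow>
     (\<forall>\<theta>\<in>{0<..<pi / 2}. (F \<longlongrightarrow> l) (at (complex_of_real \<omega>) within nt_sector \<omega> \<theta> \<inter> D))"

definition nt_bounded :: "complex set \<Rightarrow> (complex \<Rightarrow> 'a::real_normed_vector) \<Rightarrow> real \<Rightarrow> bool" where
  "nt_bounded D F \<omega> \<longleftrightarrow>
     (\<forall>\<theta>\<in>{0<..<pi / 2}. Bfun F (at (complex_of_real \<omega>) within nt_sector \<omega> \<theta> \<inter> D))"

definition directional_dom ::
  "(complex \<Rightarrow> ('g::complex_hilbert \<Rightarrow>\<^sub>L 'g)) \<Rightarrow> complex set \<Rightarrow> complex set" where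
  "directional_dom Q U = U \<inter> hdom Q \<inter> upper_half_plane"

definition directional_function ::
  "(complex \<Rightarrow> ('g::complex_hilbert \<Rightarrow>\<^sub>L 'g)) \<Rightarrow> real \<Rightarrow> complex set \<Rightarrow> (complex \<Rightarrow> 'g) \<Rightarrow> bool" where
  "directional_function Q \<omega> U f \<longleftrightarrow>
     open U \<and> complex_of_real \<omega> \<in> U \<and>
     vholomorphic_on f (directional_dom Q U) \<and>
     (\<exists>f0. nt_tendsto (directional_dom Q U) f f0 \<omega>) \<and>
     (\<exists>g0. nt_tendsto (directional_dom Q U) (\<lambda>z. blinfun_apply (Q z) (f z)) g0 \<omega>) \<and>
     nt_bounded (directional_dom Q U)
       (\<lambda>z. cinner (blinfun_apply (nev_kernel Q z z) (f z)) (f z)) \<omega>"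

definition directional_pair ::
  "(complex \<Rightarrow> ('g::complex_hilbert \<Rightarrow>\<^sub>L 'g)) \<Rightarrow> real \<Rightarrow> 'g \<times> 'g \<Rightarrow> bool" where
  "directional_pair Q \<omega> p \<longleftrightarrow>
     (\<exists>U f. directional_function Q \<omega> U f \<and>
        nt_tendsto (directional_dom Q U) f (fst p) \<omega> \<and>
        nt_tendsto (directional_dom Q U) (\<lambda>z. blinfun_apply (Q z) (f z)) (snd p) \<omega>)"

text \<open>Realisation of the pair \<open>(f0; g0)\<close> by an element \<open>v\<close> of the Pontryagin space.\<close>

definition represents_pair ::
  "(complex \<Rightarrow> ('g::complex_hilbert \<Rightarrow>\<^sub>L 'g)) \<Rightarrow> ('p::complex_banach \<Rightarrow> 'p \<Rightarrow> complex) \<Rightarrow>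
   ('p \<times> 'p) set \<Rightarrow> ('g \<Rightarrow>\<^sub>L 'p) \<Rightarrow> complex \<Rightarrow> real \<Rightarrow> 'g \<Rightarrow> 'g \<Rightarrow> 'p \<Rightarrow> bool" where
  "represents_pair Q ip A \<gamma> z0 \<omega> f0 g0 v \<longleftrightarrow>
     blinfun_apply \<gamma> f0
       = blinfun_apply (id_blinfun + (z0 - complex_of_real \<omega>) *\<^sub>C resolvent A z0) v \<and>
     g0 = blinfun_apply (cadjoint (Q z0)) f0
       + (complex_of_real \<omega> - cnj z0) *\<^sub>C blinfun_apply (form_adjoint cinner ip \<gamma>) v"

end

theory Submission
  imports Defs
begin

text \<open>Put \<open>gam z = (I + (z - z0) (A - z)\<^sup>-\<^sup>1) \<gamma>\<close>, so that \<open>(z - cnj w) [gam z x, gam w y] = (Q z x, y) - (x, Q w y)\<close>.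
  Given a directional function \<open>f\<close>, this identity shows that \<open>gam z (f z)\<close> converges weakly against
  the dense span of the vectors \<open>gam w h\<close>, and the boundedness of \<open>[gam z (f z), gam z (f z)]\<close>
  bounds its norm because only finitely many directions are negative; the weak limit is \<open>v\<close>.

  Conversely let \<open>B\<close> be the extension of the symmetric relation \<open>{(a, b) \<in> A. \<gamma>\<^sup>+ (b - cnj z0 a) = 0}\<close>
  given by an abstract dissipative boundary condition. By minimality \<open>B\<close> and its adjoint have no
  real eigenvalues. Approximate eigenvectors of \<open>B\<close> at \<open>\<omega>\<close> therefore tend weakly to 0, lose their
  negative components and become uniformly positive, so dissipativity bounds \<open>Im z (B - z)\<^sup>-\<^sup>1\<close> on the
  part of the upper half-plane close to \<open>\<omega>\<close>. Hence \<open>(z - \<omega>) (B - z)\<^sup>-\<^sup>1 v\<close> tends to 0 nontangentially,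
  and \<open>v + (z - \<omega>) (B - z)\<^sup>-\<^sup>1 v\<close> is of the form \<open>gam z (f z)\<close> with \<open>f\<close> directional.\<close>

section \<open>Hermitian forms\<close>

text \<open>The vectors \<open>gam z x\<close> are defect elements:
  \<open>(gam z x, z *\<^sub>C gam z x)\<close> is an element of \<open>A\<close> plus
  \<open>(\<gamma> x, z0 *\<^sub>C \<gamma> x)\<close>. Statement (C) says the same of
  \<open>v\<close> at \<omega>, with \<open>f0\<close> in place of \<open>x\<close>, although
  \<omega> may lie outside the resolvent set. Any extension B inside the adjoint of the symmetric
  relation carries a defect element \<open>v\<close> at \<omega> to the defect element v + (z -
  \<omega>) (B - z)^-1 v at z, so B may be chosen for the growth of its resolvent. The choice B =
  \<open>A\<close> would make \<open>f\<close> the constant \<open>f0\<close>, and it fails in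
  general because \<open>A\<close> may have \<omega> as an eigenvalue. Minimality excludes only real
  eigenvectors with vanishing boundary values. A dissipative boundary condition forces exactly this
  vanishing, because at a real eigenvalue the flux through the boundary is zero; the price, a
  resolvent bound in one half-plane only, is harmless for nontangential limits.\<close>

lemma bounded_clinear_intro:
  fixes T :: "'a::complex_normed_vector \<Rightarrow> 'b::complex_normed_vector"
  assumes add: "\<And>x y. T (x + y) = T x + T y" and scale: "\<And>c x. T (c *\<^sub>C x) = c *\<^sub>C T x"
    and bound: "\<And>x. norm (T x) \<le> norm x * K"
  shows "bounded_linear T"
  by (rule bounded_linear_intro[OF add _ bound]) (simp add: scaleC_of_real[symmetric] scale)

locale hermitian_form =
  fixes q :: "'a::complex_normed_vector \<Rightarrow> 'a \<Rightarrow> complex"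
  assumes add_left: "q (x + y) z = q x z + q y z"
    and scale_left: "q (c *\<^sub>C x) z = c * q x z"
    and commute: "q y x = cnj (q x y)"
begin

lemma add_right: "q x (y + z) = q x y + q x z"
  by (metis add_left commute complex_cnj_add)

lemma scale_right: "q x (c *\<^sub>C y) = cnj c * q x y"
  by (metis scale_left commute complex_cnj_mult)

lemma zero_left [simp]: "q 0 x = 0"
  using scale_left[of 0 0 x] by simp

lemma zero_right [simp]: "q x 0 = 0"
  using commute[of 0 x] by simp

lemma minus_left: "q (- x) y = - q x y"
  using add_left[of x "- x" y] by (simp add: eq_neg_iff_add_eq_0 add.commute)

lemma minus_right: "q x (- y) = - q x y"
  by (metis minus_left commute complex_cnj_minus)

lemma diff_left: "q (x - y) z = q x z - q y z"
  using add_left[of x "- y" z] by (simp add: minus_left)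

lemma diff_right: "q x (y - z) = q x y - q x z"
  using add_right[of x y "- z"] by (simp add: minus_right)

lemma sum_left: "q (sum f S) y = (\<Sum>s\<in>S. q (f s) y)"
  by (induction S rule: infinite_finite_induct) (simp_all add: add_left)

lemma sum_right: "q y (sum f S) = (\<Sum>s\<in>S. q y (f s))"
  by (induction S rule: infinite_finite_induct) (simp_all add: add_right)

lemmas form_simps = add_left add_right scale_left scale_right diff_left diff_right
  minus_left minus_right

lemma Im_diag [simp]: "Im (q x x) = 0"
  using arg_cong[OF commute[of x x], of Im] by simp

lemma diag: "q x x = of_real (Re (q x x))"
  by (simp add: complex_eq_iff)

lemma polarisation: "4 * Re (q x y) = Re (q (x + y) (x + y)) - Re (q (x - y) (x - y))"
proof -
  have "Re (q y x) = Re (q x y)"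
    using commute[of x y] by simp
  then show ?thesis
    by (simp add: form_simps)
qed

text \<open>Polarisation bounds the real part on unit vectors, where \<open>x + y\<close> and
  \<open>x - y\<close> have norm at most 2. Homogeneity removes the normalisation, and replacing
  \<open>y\<close> by \<open>\<i> *\<^sub>C y\<close> turns the imaginary part into a real
  part.\<close>

lemma bounded_of_diag:
  assumes "\<And>x. \<bar>Re (q x x)\<bar> \<le> b * (norm x)\<^sup>2"
  shows "cmod (q x y) \<le> 4 * b * norm x * norm y"
proof -
  have Re1: "\<bar>Re (q x y)\<bar> \<le> 2 * b" if "norm x = 1" "norm y = 1" for x y
  proof -
    have b: "0 \<le> b"
      using assms[of x] that(1) by simp
    have "4 * \<bar>Re (q x y)\<bar> \<le> b * (norm (x + y))\<^sup>2 + b * (norm (x - y))\<^sup>2"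
      using polarisation[of x y] assms[of "x + y"] assms[of "x - y"] by linarith
    also have "\<dots> \<le> b * 2\<^sup>2 + b * 2\<^sup>2"
      using norm_triangle_ineq[of x y] norm_triangle_ineq4[of x y] that
      by (intro add_mono mult_left_mono power_mono b) auto
    finally show ?thesis
      by simp
  qed
  have Re2: "\<bar>Re (q x y)\<bar> \<le> 2 * b * norm x * norm y" for x y
  proof (cases "x = 0 \<or> y = 0")
    case False
    define c where "c = complex_of_real (inverse (norm x))"
    define d where "d = complex_of_real (inverse (norm y))"
    have "\<bar>Re (q (c *\<^sub>C x) (d *\<^sub>C y))\<bar> \<le> 2 * b"
      using False by (intro Re1) (simp_all add: c_def d_def norm_scaleC norm_inverse)
    moreover have "Re (q (c *\<^sub>C x) (d *\<^sub>C y)) = Re (q x y) / (norm x * norm y)"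
      by (simp add: form_simps c_def d_def field_simps)
    ultimately show ?thesis
      using False by (simp add: abs_mult divide_simps)
  qed auto
  have "cmod (q x y) \<le> \<bar>Re (q x y)\<bar> + \<bar>Im (q x y)\<bar>"
    by (rule cmod_le)
  moreover have "Im (q x y) = Re (q x (\<i> *\<^sub>C y))"
    by (simp add: form_simps)
  moreover have "norm (\<i> *\<^sub>C y) = norm y"
    by (simp add: norm_scaleC)
  ultimately show ?thesis
    using Re2[of x y] Re2[of x "\<i> *\<^sub>C y"] by simp
qed

end

text \<open>A Hilbert inner product on a type whose norm is only equivalent to the one of
  \<open>h\<close>; the constants record the equivalence, so that no second norm has to be
  introduced.\<close>

locale definite_form = hermitian_form h for h :: "'a::complex_banach \<Rightarrow> 'a \<Rightarrow> complex" +
  fixes a b :: real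
  assumes a: "0 < a"
    and lower: "a * (norm x)\<^sup>2 \<le> Re (h x x)" and upper: "Re (h x x) \<le> b * (norm x)\<^sup>2"
begin

lemma nonneg: "0 \<le> Re (h x x)"
  using lower[of x] a by (meson dual_order.trans mult_nonneg_nonneg order_less_imp_le zero_le_power2)

lemma bounded: "cmod (h x y) \<le> 4 * b * norm x * norm y"
  using nonneg upper by (intro bounded_of_diag) (simp add: abs_of_nonneg)

text \<open>The vector is the minimiser of \<open>h m m - 2 Re (\<phi> m)\<close> over \<open>M\<close>.\<close>

lemma Riesz_subspace:
  assumes M: "csubspace M" "closed M"
    and add: "\<And>x y. \<phi> (x + y) = \<phi> x + \<phi> y" and scale: "\<And>c x. \<phi> (c *\<^sub>C x) = c * \<phi> x"
    and bound: "\<And>x. cmod (\<phi> x) \<le> K * norm x"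
  obtains w where "w \<in> M" "\<And>m. m \<in> M \<Longrightarrow> \<phi> m = h m w"
proof -
  define F where "F m = Re (h m m) - 2 * Re (\<phi> m)" for m
  have add_M: "x + y \<in> M" if "x \<in> M" "y \<in> M" for x y
    using that M(1) by (rule complex_vector.subspace_add[rotated])
  have scale_M: "c *\<^sub>C x \<in> M" if "x \<in> M" for c x
    using that M(1) by (rule complex_vector.subspace_scale[rotated])
  have low: "- K\<^sup>2 / a \<le> F m" for m
  proof -
    have "0 \<le> (a * norm m - K)\<^sup>2 / a"
      using a by simp
    also have "\<dots> = a * (norm m)\<^sup>2 - 2 * (K * norm m) + K\<^sup>2 / a"
      using a by (simp add: power2_eq_square field_simps)
    also have "\<dots> \<le> Re (h m m) - 2 * Re (\<phi> m) + K\<^sup>2 / a"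
      using lower[of m] bound[of m] complex_Re_le_cmod[of "\<phi> m"] by linarith
    finally show ?thesis
      by (simp add: F_def)
  qed
  define d where "d = Inf (F ` M)"
  have bdd: "bdd_below (F ` M)"
    using low by (intro bdd_belowI2)
  have ne: "F ` M \<noteq> {}"
    using complex_vector.subspace_0[OF M(1)] by blast
  have d_le: "d \<le> F m" if "m \<in> M" for m
    unfolding d_def using bdd that by (intro cInf_lower) auto
  have "\<exists>m\<in>M. F m < d + inverse (real (Suc n))" for n
  proof -
    have "Inf (F ` M) < d + inverse (real (Suc n))"
      by (simp add: d_def)
    then show ?thesis
      using cInf_lessD[OF ne] by blast
  qed
  then obtain s where s: "s n \<in> M" "F (s n) < d + inverse (real (Suc n))" for n
    by metis
  have phi_diff: "\<phi> (x - y) = \<phi> x - \<phi> y" for x y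
    using add[of "x - y" y] by simp
  \<comment> \<open>Parallelogram identity with the midpoint \<open>m\<close> as competitor:
    near-minimisers are close to each other, so a minimising sequence is Cauchy.\<close>
  have mid: "a * (norm (x - y))\<^sup>2 \<le> 2 * F x + 2 * F y - 4 * d" if "x \<in> M" "y \<in> M" for x y
  proof -
    define m where "m = complex_of_real (1/2) *\<^sub>C (x + y)"
    have "h x y + h y x = of_real (2 * Re (h x y))"
      using commute[of x y] by (simp add: complex_eq_iff)
    then have sym: "Re (h y x) = Re (h x y)"
      using commute[of x y] by simp
    have "F m = Re (h (x + y) (x + y)) / 4 - Re (\<phi> (x + y))"
      by (simp add: F_def m_def scale scale_left scale_right)
    then have "4 * F m = 2 * F x + 2 * F y - Re (h (x - y) (x - y))"
      by (simp add: F_def add form_simps sym)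
    moreover have "d \<le> F m"
      unfolding m_def by (intro d_le scale_M add_M that)
    ultimately show ?thesis
      using lower[of "x - y"] by linarith
  qed
  have dist_s: "dist (s m) (s n) < e"
    if "0 < e" "4 * inverse (real (Suc N)) < a * e\<^sup>2" "N \<le> m" "N \<le> n" for e N m n
  proof -
    have "inverse (real (Suc m)) \<le> inverse (real (Suc N))" "inverse (real (Suc n)) \<le> inverse (real (Suc N))"
      using that by (simp_all add: le_imp_inverse_le)
    then have "a * (norm (s m - s n))\<^sup>2 < a * e\<^sup>2"
      using mid[of "s m" "s n"] s[of m] s[of n] that(2) by linarith
    then have "(norm (s m - s n))\<^sup>2 < e\<^sup>2"
      using a by simp
    then show ?thesis
      using that(1) by (simp add: dist_norm power2_less_imp_less)
  qed
  have "Cauchy s"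
  proof (rule metric_CauchyI)
    fix e :: real
    assume e: "0 < e"
    obtain N where "inverse (real (Suc N)) < a * e\<^sup>2 / 4"
      using reals_Archimedean[of "a * e\<^sup>2 / 4"] a e by auto
    then show "\<exists>N. \<forall>m\<ge>N. \<forall>n\<ge>N. dist (s m) (s n) < e"
      using dist_s[OF e, of N] by (intro exI[of _ N]) auto
  qed
  then obtain w where lim: "s \<longlonglongrightarrow> w"
    using Cauchy_convergent_iff convergent_def by blast
  have w: "w \<in> M"
    using closed_sequentially[OF M(2)] s(1) lim by blast
  have near: "F w \<le> d"
  proof (rule LIMSEQ_le_const)
    have "bounded_linear \<phi>"
      using add bound scale by (intro bounded_linear_intro[where K = K])
        (auto simp: scaleC_of_real[symmetric] mult.commute scaleR_conv_of_real)
    then have "(\<lambda>n. \<phi> (s n)) \<longlonglongrightarrow> \<phi> w"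
      using lim by (rule bounded_linear.tendsto)
    moreover have "(\<lambda>n. h (s n) (s n)) \<longlonglongrightarrow> h w w"
    proof -
      have "(\<lambda>n. 4 * b * norm (s n - w) * norm (s n) + 4 * b * norm w * norm (s n - w)) \<longlonglongrightarrow>
          4 * b * norm (w - w) * norm w + 4 * b * norm w * norm (w - w)"
        by (intro tendsto_intros lim)
      then have *: "(\<lambda>n. 4 * b * norm (s n - w) * norm (s n) + 4 * b * norm w * norm (s n - w)) \<longlonglongrightarrow> 0"
        by simp
      have "cmod (h (s n) (s n) - h w w) \<le> 4 * b * norm (s n - w) * norm (s n) + 4 * b * norm w * norm (s n - w)" for n
      proof -
        have "h (s n) (s n) - h w w = h (s n - w) (s n) + h w (s n - w)"
          by (simp add: form_simps)
        then show ?thesis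
          using bounded[of "s n - w" "s n"] bounded[of w "s n - w"] norm_triangle_ineq by smt
      qed
      then have "(\<lambda>n. h (s n) (s n) - h w w) \<longlonglongrightarrow> 0"
        by (intro Lim_null_comparison[OF _ *]) auto
      then show ?thesis
        by (simp add: LIM_zero_iff)
    qed
    ultimately have "(\<lambda>n. d + inverse (real (Suc n)) - F (s n)) \<longlonglongrightarrow> d + 0 - F w"
      unfolding F_def by (intro tendsto_intros LIMSEQ_inverse_real_of_nat)
    then show "(\<lambda>n. d + inverse (real (Suc n)) - F (s n) + F w) \<longlonglongrightarrow> d"
      using tendsto_add[OF _ tendsto_const[of "F w"]] by fastforce
    show "\<exists>N. \<forall>n\<ge>N. F w \<le> d + inverse (real (Suc n)) - F (s n) + F w"
      using s(2) by (intro exI[of _ 0] allI impI) (smt (verit))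
  qed
  have Re_eq: "Re (\<phi> m) = Re (h m w)" if m: "m \<in> M" for m
  proof -
    define g where "g = Re (h m w) - Re (\<phi> m)"
    \<comment> \<open>First variation at the minimiser. A quadratic in \<open>t\<close> without
      constant term stays nonnegative only if its linear coefficient vanishes;
      \<open>t = - g\<close> or \<open>t = - g / Re (h m m)\<close> shows this.\<close>
    have quad: "0 \<le> t\<^sup>2 * Re (h m m) + 2 * t * g" for t
    proof -
      have "F w \<le> F (w + complex_of_real t *\<^sub>C m)"
        using near d_le[OF add_M[OF w scale_M[OF m]]] by (rule order_trans)
      moreover have "Re (h w m) = Re (h m w)"
        using commute[of w m] by simp
      ultimately show ?thesis
        by (simp add: F_def form_simps add scale g_def power2_eq_square algebra_simps)
    qed
    have "g = 0"
    proof (cases "Re (h m m) = 0")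
      case True
      then show ?thesis
        using quad[of "- g"] by (simp add: not_less[symmetric] power2_eq_square[symmetric])
    next
      case False
      then have pos: "0 < Re (h m m)"
        using nonneg[of m] by simp
      have "0 \<le> - (g\<^sup>2 / Re (h m m))"
        using quad[of "- g / Re (h m m)"] pos by (simp add: power2_eq_square field_simps)
      moreover have "0 \<le> g\<^sup>2 / Re (h m m)"
        using pos by simp
      ultimately show ?thesis
        using pos by simp
    qed
    then show ?thesis
      by (simp add: g_def)
  qed
  have "\<phi> m = h m w" if "m \<in> M" for m
  proof (rule complex_eqI)
    show "Im (\<phi> m) = Im (h m w)"
      using Re_eq[OF scale_M[OF that, of \<i>]] by (simp add: scale scale_left)
  qed (rule Re_eq[OF that])
  then show ?thesis
    using that w by blast
qed

lemma norm_le_of_functional: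
  assumes "\<And>x. cmod (h x w) \<le> K * norm x" and K: "0 \<le> K"
  shows "norm w \<le> K / a"
proof (cases "w = 0")
  case True
  then show ?thesis
    using a K by simp
next
  case False
  have "a * (norm w)\<^sup>2 \<le> K * norm w"
    using lower[of w] assms(1)[of w] complex_Re_le_cmod[of "h w w"] by linarith
  then show ?thesis
    using a False by (simp add: power2_eq_square field_simps)
qed

end

section \<open>Pontryagin spaces\<close>

context hermitian_form
begin

text \<open>Gram-Schmidt on a negative definite space; the resulting vectors satisfy \<open>q e e = -1\<close>.\<close>

lemma negative_definite_basis:
  assumes "finite B" and "\<And>n. n \<in> cspan B \<Longrightarrow> n \<noteq> 0 \<Longrightarrow> Re (q n n) < 0"
  shows "\<exists>E. finite E \<and> E \<subseteq> cspan B \<and> (\<forall>n\<in>cspan B. (\<Sum>e\<in>E. q n e *\<^sub>C e) = - n)"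
  using assms
proof (induction B)
  case empty
  then show ?case
    by (intro exI[of _ "{}"]) (simp add: complex_vector.span_empty)
next
  case (insert x B)
  have sub: "cspan B \<subseteq> cspan (insert x B)"
    by (intro complex_vector.span_mono) auto
  then obtain E where E: "finite E" "E \<subseteq> cspan B" and sums: "\<And>n. n \<in> cspan B \<Longrightarrow> (\<Sum>e\<in>E. q n e *\<^sub>C e) = - n"
    using insert.IH insert.prems by blast
  have rep: "n = - (\<Sum>e\<in>E. q n e *\<^sub>C e)" if "n \<in> cspan B" for n
    using sums[OF that] by simp
  \<comment> \<open>The sign is plus because on \<open>cspan B\<close> the sum over \<open>E\<close>
    is minus the identity.\<close>
  define y where "y = x + (\<Sum>e\<in>E. q x e *\<^sub>C e)"
  have sum_mem: "(\<Sum>e\<in>E. c e *\<^sub>C e) \<in> cspan B" for c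
    using E(2) by (intro complex_vector.span_sum complex_vector.span_scale) auto
  have orth: "q y n = 0" if "n \<in> cspan B" for n
  proof -
    have "q x n = - (\<Sum>e\<in>E. cnj (q n e) * q x e)"
      by (subst rep[OF that]) (simp add: minus_right sum_right scale_right)
    also have "\<dots> = - (\<Sum>e\<in>E. q x e * q e n)"
      by (simp add: commute[of n] mult.commute)
    finally show ?thesis
      by (simp add: y_def add_left sum_left scale_left)
  qed
  have decomp: "\<exists>c m. m \<in> cspan B \<and> n = c *\<^sub>C y + m" if n: "n \<in> cspan (insert x B)" for n
  proof -
    obtain c where c: "n - c *\<^sub>C x \<in> cspan B"
      using n by (auto simp: complex_vector.span_breakdown_eq)
    have "n = c *\<^sub>C y + ((n - c *\<^sub>C x) - c *\<^sub>C (\<Sum>e\<in>E. q x e *\<^sub>C e))"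
      by (simp add: y_def scaleC_add_right)
    moreover have "(n - c *\<^sub>C x) - c *\<^sub>C (\<Sum>e\<in>E. q x e *\<^sub>C e) \<in> cspan B"
      by (intro complex_vector.span_diff c complex_vector.span_scale sum_mem)
    ultimately show ?thesis
      by blast
  qed
  show ?case
  proof (cases "y = 0")
    case True
    then have "cspan (insert x B) \<subseteq> cspan B"
      using decomp by fastforce
    then show ?thesis
      using E sums sub by blast
  next
    case False
    have "x \<in> cspan (insert x B)"
      by (intro complex_vector.span_base) simp
    then have y: "y \<in> cspan (insert x B)"
      unfolding y_def using sum_mem sub by (intro complex_vector.span_add) auto
    define r where "r = - Re (q y y)"
    have r: "0 < r" "q y y = - of_real r"
      using insert.prems[OF y False] diag[of y] by (simp_all add: r_def)
    \<comment> \<open>Normalised to \<open>q z z = -1\<close>, so that the new summand contributes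
      the missing \<open>- (c *\<^sub>C y)\<close>.\<close>
    define z where "z = complex_of_real (inverse (sqrt r)) *\<^sub>C y"
    have "z \<notin> E"
      using orth[of z] E(2) r by (auto simp: z_def scale_right)
    have sums': "(\<Sum>e\<in>insert z E. q n e *\<^sub>C e) = - n" if n: "n \<in> cspan (insert x B)" for n
    proof -
      obtain c m where m: "m \<in> cspan B" "n = c *\<^sub>C y + m"
        using decomp[OF n] by blast
      have "q m y = 0"
        using orth[OF m(1)] commute[of y m] by simp
      then have "q n z = - c * of_real (inverse (sqrt r)) * of_real r"
        by (simp add: m(2) z_def form_simps r)
      then have "q n z *\<^sub>C z = - (c * of_real (inverse (sqrt r) * inverse (sqrt r) * r)) *\<^sub>C y"
        by (simp add: z_def scaleC_scaleC mult_ac)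
      also have "inverse (sqrt r) * inverse (sqrt r) * r = 1"
        using r(1) by (simp add: field_simps)
      finally have "q n z *\<^sub>C z = - (c *\<^sub>C y)"
        using complex_vector.scale_minus_left by simp
      moreover have "(\<Sum>e\<in>E. q n e *\<^sub>C e) = (\<Sum>e\<in>E. q m e *\<^sub>C e)"
        using E(2) by (intro sum.cong) (auto simp: m(2) form_simps orth)
      ultimately show ?thesis
        using E(1) \<open>z \<notin> E\<close> sums[OF m(1)] m(2) by simp
    qed
    have "z \<in> cspan (insert x B)"
      unfolding z_def by (intro complex_vector.span_scale y)
    then have "finite (insert z E)" "insert z E \<subseteq> cspan (insert x B)"
      using E sub by auto
    then show ?thesis
      using sums' by blast
  qed
qed

end

locale pontryagin =
  fixes ip :: "'a::complex_banach \<Rightarrow> 'a \<Rightarrow> complex"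
  assumes pontryagin_space: "pontryagin_space ip"

sublocale pontryagin \<subseteq> hermitian_form ip
proof
  note conj = pontryagin_space[unfolded pontryagin_space_def]
  fix x y z c
  show "ip (x + y) z = ip x z + ip y z"
    using conjunct1[OF conj] by iprover
  show "ip (c *\<^sub>C x) z = c * ip x z"
    using conjunct1[OF conjunct2[OF conj]] by iprover
  show "ip y x = cnj (ip x y)"
    using conjunct1[OF conjunct2[OF conjunct2[OF conj]]] by iprover
qed

context pontryagin
begin

text \<open>With \<open>E\<close> a basis of the negative component normalised by \<open>ip e e = -1\<close>, adding
  \<open>2 * (\<Sum>e\<in>E. ip x e * ip e y)\<close> reverses the sign of \<open>ip\<close> on that component.\<close>

lemma fundamental_form:
  obtains E a b where "finite E" "definite_form (\<lambda>x y. ip x y + 2 * (\<Sum>e\<in>E. ip x e * ip e y)) a b"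
    "\<And>x. \<bar>Re (ip x x)\<bar> \<le> b * (norm x)\<^sup>2"
proof -
  obtain P N a b B where PN: "csubspace P" "csubspace N" "finite B" "N = cspan B"
    and "\<forall>x. \<exists>p\<in>P. \<exists>n\<in>N. x = p + n"
    and "\<forall>p\<in>P. \<forall>n\<in>N. ip p n = 0"
    and "\<forall>p\<in>P. p \<noteq> 0 \<longrightarrow> 0 < Re (ip p p)"
    and "\<forall>n\<in>N. n \<noteq> 0 \<longrightarrow> Re (ip n n) < 0"
    and ab: "0 < a" "0 < b"
    and "\<forall>p\<in>P. \<forall>n\<in>N. a * norm (p + n) \<le> sqrt (Re (ip p p) - Re (ip n n)) \<and>
      sqrt (Re (ip p p) - Re (ip n n)) \<le> b * norm (p + n)"
    using pontryagin_space unfolding pontryagin_space_def by (elim conjE exE) (rule that)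
  note decomp = this(5)[rule_format] and orth = this(6)[rule_format] and pos = this(7)[rule_format]
    and neg = this(8)[rule_format] and equiv = this(11)[rule_format]
  obtain E where E: "finite E" "E \<subseteq> N" and sums: "\<And>n. n \<in> N \<Longrightarrow> (\<Sum>e\<in>E. ip n e *\<^sub>C e) = - n"
    using negative_definite_basis[OF PN(3)] neg unfolding PN(4) by blast
  have rep: "n = - (\<Sum>e\<in>E. ip n e *\<^sub>C e)" if "n \<in> N" for n
    using sums[OF that] by simp
  define h where "h x y = ip x y + 2 * (\<Sum>e\<in>E. ip x e * ip e y)" for x y
  have "hermitian_form h"
    unfolding h_def
  proof
    fix x y
    have "ip y e * ip e x = cnj (ip x e * ip e y)" for e
      by (subst commute[of e y], subst commute[of x e]) simp
    then show "ip y x + 2 * (\<Sum>e\<in>E. ip y e * ip e x) = cnj (ip x y + 2 * (\<Sum>e\<in>E. ip x e * ip e y))"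
      by (simp add: commute[of x y])
  qed (simp_all add: form_simps sum.distrib algebra_simps sum_distrib_left)
  have key: "Re (h x x) = Re (ip p p) - Re (ip n n) \<and> Re (ip x x) = Re (ip p p) + Re (ip n n) \<and>
      0 \<le> Re (ip p p) \<and> Re (ip n n) \<le> 0"
    if x: "x = p + n" "p \<in> P" "n \<in> N" for x p n
  proof -
    have 0: "ip p n = 0" "ip n p = 0"
      using orth[OF x(2,3)] commute[of p n] by simp_all
    have "ip n n = - (\<Sum>e\<in>E. cnj (ip n e) * ip n e)"
      by (subst rep[OF x(3)]) (simp add: minus_right sum_right scale_right)
    also have "\<dots> = - (\<Sum>e\<in>E. ip x e * ip e x)"
    proof -
      have "cnj (ip n e) * ip n e = ip x e * ip e x" if "e \<in> E" for e
        using orth[OF x(2), of e] E(2) that commute[of x e] by (auto simp: x(1) add_left)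
      then show ?thesis
        by simp
    qed
    finally have "h x x = ip x x - 2 * ip n n"
      by (simp add: h_def)
    moreover have "ip x x = ip p p + ip n n"
      by (simp add: x(1) form_simps 0)
    moreover have "0 \<le> Re (ip p p)"
      using pos[OF x(2)] by (cases "p = 0") auto
    moreover have "Re (ip n n) \<le> 0"
      using neg[OF x(3)] by (cases "n = 0") auto
    ultimately show ?thesis
      by simp
  qed
  have est: "a\<^sup>2 * (norm x)\<^sup>2 \<le> Re (h x x) \<and> Re (h x x) \<le> b\<^sup>2 * (norm x)\<^sup>2 \<and>
      \<bar>Re (ip x x)\<bar> \<le> b\<^sup>2 * (norm x)\<^sup>2" for x
  proof -
    obtain p n where x: "x = p + n" "p \<in> P" "n \<in> N"
      using decomp by blast
    note k = key[OF x]
    have e: "Re (h x x) = Re (ip p p) - Re (ip n n)"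
      using k by blast
    have nn: "0 \<le> Re (h x x)"
      using k by linarith
    have "a * norm x \<le> sqrt (Re (h x x))" "sqrt (Re (h x x)) \<le> b * norm x"
      using equiv[OF x(2,3)] by (simp_all only: e x(1)[symmetric])
    then have "(a * norm x)\<^sup>2 \<le> (sqrt (Re (h x x)))\<^sup>2" "(sqrt (Re (h x x)))\<^sup>2 \<le> (b * norm x)\<^sup>2"
      using ab(1) nn by (simp_all only: power_mono mult_nonneg_nonneg norm_ge_zero less_imp_le real_sqrt_ge_zero)
    moreover have "\<bar>Re (ip x x)\<bar> \<le> Re (h x x)"
      using k by linarith
    ultimately show ?thesis
      using nn by (simp only: power_mult_distrib real_sqrt_pow2 simp_thms)
  qed
  have def: "definite_form h (a\<^sup>2) (b\<^sup>2)"
    by (intro definite_form.intro definite_form_axioms.intro \<open>hermitian_form h\<close>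
        conjunct1[OF est] conjunct1[OF conjunct2[OF est]] zero_less_power ab)
  show ?thesis
    by (rule that[OF E(1) def[unfolded h_def]]) (rule conjunct2[OF conjunct2[OF est]])
qed

lemma bounded:
  obtains C where "0 < C" "\<And>x y. cmod (ip x y) \<le> C * norm x * norm y"
proof -
  obtain E a b where E: "finite E" "definite_form (\<lambda>x y. ip x y + 2 * (\<Sum>e\<in>E. ip x e * ip e y)) a b"
    and diag_le: "\<And>x. \<bar>Re (ip x x)\<bar> \<le> b * (norm x)\<^sup>2"
    using that by (rule fundamental_form)
  note le = bounded_of_diag[OF diag_le]
  have "cmod (ip x y) \<le> (\<bar>4 * b\<bar> + 1) * norm x * norm y" for x y
    by (rule order_trans[OF le]) (intro mult_right_mono; simp)
  then show ?thesis
    by (intro that[of "\<bar>4 * b\<bar> + 1"]) auto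
qed

lemma bounded_linear_left: "bounded_linear (\<lambda>x. ip x u)"
proof -
  obtain C where C: "0 < C" "\<And>x y. cmod (ip x y) \<le> C * norm x * norm y"
    using bounded by blast
  show ?thesis
    using C(2)[of _ u]
    by (intro bounded_linear_intro[where K = "C * norm u"])
      (auto simp: add_left scaleC_of_real[symmetric] scale_left scaleR_conv_of_real mult_ac)
qed

text \<open>The norm is controlled by \<open>ip\<close> up to finitely many functionals. In this
  form the finite index of negativity enters the estimates for eigenvectors and weak limits: where
  the numbers \<open>ip x e\<close> are under control, \<open>ip\<close> behaves like a positive
  form.\<close>

lemma Garding:
  obtains E a where "finite E" "0 < a" "\<And>x. a * (norm x)\<^sup>2 \<le> Re (ip x x) + 2 * (\<Sum>e\<in>E. (cmod (ip x e))\<^sup>2)"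
proof -
  obtain E a b where E: "finite E" "definite_form (\<lambda>x y. ip x y + 2 * (\<Sum>e\<in>E. ip x e * ip e y)) a b"
    and diag_le: "\<And>x. \<bar>Re (ip x x)\<bar> \<le> b * (norm x)\<^sup>2"
    using that by (rule fundamental_form)
  interpret h: definite_form "\<lambda>x y. ip x y + 2 * (\<Sum>e\<in>E. ip x e * ip e y)" a b
    by (rule E(2))
  have *: "ip x e * ip e x = of_real ((cmod (ip x e))\<^sup>2)" for x e
    by (subst commute[of e x]) (simp only: complex_norm_square)
  show ?thesis
    using h.lower by (intro that[OF E(1) h.a]) (simp add: *)
qed

lemma nondegenerate:
  assumes "\<And>x. ip x u = 0"
  shows "u = 0"
proof -
  obtain E a b where E: "finite E" "definite_form (\<lambda>x y. ip x y + 2 * (\<Sum>e\<in>E. ip x e * ip e y)) a b"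
    and diag_le: "\<And>x. \<bar>Re (ip x x)\<bar> \<le> b * (norm x)\<^sup>2"
    using that by (rule fundamental_form)
  interpret h: definite_form "\<lambda>x y. ip x y + 2 * (\<Sum>e\<in>E. ip x e * ip e y)" a b
    by (rule E(2))
  show ?thesis
    using h.lower[of u] h.a by (simp add: assms mult_le_0_iff)
qed

lemma ext_right:
  assumes "\<And>x. ip x u = ip x v"
  shows "u = v"
  using nondegenerate[of "u - v"] assms by (simp add: diff_right)

lemma ext_left:
  assumes "\<And>x. ip u x = ip v x"
  shows "u = v"
  using assms by (intro ext_right) (metis commute)

text \<open>The functional is represented by \<open>w\<close> with respect to the definite form, and
  the finite correction in \<open>v\<close> rewrites this in terms of \<open>ip\<close>. The
  constant \<open>C\<close> is fixed before \<open>\<phi>\<close>, which makes the adjoints built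
  from such vectors bounded.\<close>

lemma Riesz:
  obtains C where "0 \<le> C"
    "\<And>\<phi> K. (\<And>x y. \<phi> (x + y) = \<phi> x + \<phi> y) \<Longrightarrow> (\<And>c x. \<phi> (c *\<^sub>C x) = c * \<phi> x) \<Longrightarrow> 0 \<le> K \<Longrightarrow>
      (\<And>x. cmod (\<phi> x) \<le> K * norm x) \<Longrightarrow> \<exists>v. (\<forall>x. \<phi> x = ip x v) \<and> norm v \<le> C * K"
proof -
  obtain E a b where E: "finite E" "definite_form (\<lambda>x y. ip x y + 2 * (\<Sum>e\<in>E. ip x e * ip e y)) a b"
    and diag_le: "\<And>x. \<bar>Re (ip x x)\<bar> \<le> b * (norm x)\<^sup>2"
    using that by (rule fundamental_form)
  interpret h: definite_form "\<lambda>x y. ip x y + 2 * (\<Sum>e\<in>E. ip x e * ip e y)" a b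
    by (rule E(2))
  obtain D where D: "0 < D" "\<And>x y. cmod (ip x y) \<le> D * norm x * norm y"
    using bounded by blast
  define C where "C = (1 + 2 * (\<Sum>e\<in>E. D * norm e * norm e)) / a"
  have "0 \<le> C"
    using h.a D(1) by (auto simp: C_def intro!: divide_nonneg_pos add_nonneg_nonneg sum_nonneg)
  moreover have "\<exists>v. (\<forall>x. \<phi> x = ip x v) \<and> norm v \<le> C * K"
    if phi: "\<And>x y. \<phi> (x + y) = \<phi> x + \<phi> y" "\<And>c x. \<phi> (c *\<^sub>C x) = c * \<phi> x"
      "0 \<le> K" "\<And>x. cmod (\<phi> x) \<le> K * norm x" for \<phi> K
  proof -
    obtain w where w: "\<And>x. \<phi> x = ip x w + 2 * (\<Sum>e\<in>E. ip x e * ip e w)"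
      using h.Riesz_subspace[OF complex_vector.subspace_UNIV closed_UNIV phi(1,2,4)] by auto
    define v where "v = w + (\<Sum>e\<in>E. (2 * ip w e) *\<^sub>C e)"
    have "\<phi> x = ip x v" for x
      by (simp add: w v_def form_simps sum_right sum_distrib_left commute[of w] mult_ac)
    moreover have "norm w \<le> K / a"
      using phi(4) by (intro h.norm_le_of_functional phi(3)) (simp add: w)
    moreover have "norm v \<le> norm w + (\<Sum>e\<in>E. 2 * (D * norm w * norm e) * norm e)"
      unfolding v_def
    proof (intro order_trans[OF norm_triangle_ineq] add_left_mono sum_norm_le)
      fix e
      have "cmod (ip w e) * norm e \<le> D * norm w * norm e * norm e"
        by (intro mult_right_mono D(2)) auto
      then show "norm ((2 * ip w e) *\<^sub>C e) \<le> 2 * (D * norm w * norm e) * norm e"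
        by (simp add: norm_scaleC norm_mult)
    qed
    then have "norm v \<le> (1 + 2 * (\<Sum>e\<in>E. D * norm e * norm e)) * norm w"
      by (simp add: sum_distrib_left algebra_simps)
    moreover have "\<dots> \<le> (1 + 2 * (\<Sum>e\<in>E. D * norm e * norm e)) * (K / a)"
      using \<open>norm w \<le> K / a\<close> D(1)
      by (intro mult_left_mono add_nonneg_nonneg mult_nonneg_nonneg sum_nonneg) auto
    ultimately show ?thesis
      by (intro exI[of _ v]) (auto simp: C_def)
  qed
  ultimately show ?thesis
    by (rule that) blast
qed

lemma annihilator:
  assumes M: "csubspace M" "closed M" "M \<noteq> UNIV"
  obtains u where "u \<noteq> 0" "\<And>m. m \<in> M \<Longrightarrow> ip m u = 0"
proof -
  obtain E a b where E: "finite E" "definite_form (\<lambda>x y. ip x y + 2 * (\<Sum>e\<in>E. ip x e * ip e y)) a b"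
    and diag_le: "\<And>x. \<bar>Re (ip x x)\<bar> \<le> b * (norm x)\<^sup>2"
    using that by (rule fundamental_form)
  define h where "h x y = ip x y + 2 * (\<Sum>e\<in>E. ip x e * ip e y)" for x y
  interpret h: definite_form h a b
    unfolding h_def by (rule E(2))
  obtain x where x: "x \<notin> M"
    using M(3) by blast
  obtain w where w: "w \<in> M" "\<And>m. m \<in> M \<Longrightarrow> h m x = h m w"
    by (rule h.Riesz_subspace[OF M(1,2), of "\<lambda>m. h m x" "4 * b * norm x"])
      (use h.bounded[of _ x] in \<open>auto simp: h.form_simps mult_ac\<close>)
  \<comment> \<open>\<open>x - w\<close> is orthogonal to \<open>M\<close> in the definite form; the
    finite correction transfers this to \<open>ip\<close>.\<close>
  define u where "u = (x - w) + (\<Sum>e\<in>E. (2 * ip (x - w) e) *\<^sub>C e)"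
  have u: "h y (x - w) = ip y u" for y
    by (simp add: h_def u_def form_simps sum_right sum_distrib_left sum_subtractf
        commute[of x] commute[of w] algebra_simps sum.distrib)
  have "h (x - w) (x - w) \<noteq> 0"
    using h.lower[of "x - w"] h.a w(1) x by (auto simp: mult_le_0_iff)
  then have "u \<noteq> 0"
    unfolding u by auto
  moreover have "ip m u = 0" if "m \<in> M" for m
    using w(2)[OF that] u[of m] by (simp add: h.diff_right)
  ultimately show ?thesis
    by (rule that)
qed

end

lemma csubspace_closure:
  fixes S :: "'a::complex_normed_vector set"
  assumes "csubspace S"
  shows "csubspace (closure S)"
proof (rule complex_vector.subspaceI)
  show "0 \<in> closure S"
    using complex_vector.subspace_0[OF assms] closure_subset by blast
  fix x y c
  assume x: "x \<in> closure S"
  then obtain s where s: "\<And>n. s n \<in> S" "s \<longlonglongrightarrow> x"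
    by (auto simp: closure_sequential)
  show "c *\<^sub>C x \<in> closure S"
    unfolding closure_sequential
    using bounded_linear.tendsto[OF bounded_linear_scaleC s(2)] complex_vector.subspace_scale[OF assms s(1)]
    by (intro exI[of _ "\<lambda>n. c *\<^sub>C s n"]) blast
  assume "y \<in> closure S"
  then obtain t where t: "\<And>n. t n \<in> S" "t \<longlonglongrightarrow> y"
    by (auto simp: closure_sequential)
  show "x + y \<in> closure S"
    unfolding closure_sequential
    using tendsto_add[OF s(2) t(2)] complex_vector.subspace_add[OF assms s(1) t(1)]
    by (intro exI[of _ "\<lambda>n. s n + t n"]) blast
qed

lemma (in pontryagin) dense_of_annihilator:
  assumes "csubspace S" "\<And>u. (\<And>s. s \<in> S \<Longrightarrow> ip s u = 0) \<Longrightarrow> u = 0"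
  shows "closure S = UNIV"
proof (rule ccontr)
  assume "closure S \<noteq> UNIV"
  then obtain u where "u \<noteq> 0" "\<And>m. m \<in> closure S \<Longrightarrow> ip m u = 0"
    using annihilator[OF csubspace_closure[OF assms(1)] closed_closure] by blast
  then show False
    using assms(2)[of u] closure_subset by blast
qed

text \<open>With trivial negative component a Hilbert space is a Pontryagin space, so one treatment
  of adjoints covers both \<open>cadjoint\<close> and the adjoint of \<open>\<gamma>\<close>, which
  relates a definite form to an indefinite one.\<close>

lemma pontryagin_cinner: "pontryagin (cinner :: 'a::complex_hilbert \<Rightarrow> 'a \<Rightarrow> complex)"
proof
  have "\<exists>P N. csubspace P \<and> csubspace N \<and>
        (\<exists>B. finite B \<and> N = cspan B) \<and>
        (\<forall>x::'a. \<exists>p\<in>P. \<exists>n\<in>N. x = p + n) \<and> P \<inter> N = {0} \<and>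
        (\<forall>p\<in>P. \<forall>n\<in>N. cinner p n = 0) \<and>
        (\<forall>p\<in>P. p \<noteq> 0 \<longrightarrow> 0 < Re (cinner p p)) \<and>
        (\<forall>n\<in>N. n \<noteq> 0 \<longrightarrow> Re (cinner n n) < 0) \<and>
        (\<exists>a>0. \<exists>b>0. \<forall>p\<in>P. \<forall>n\<in>N.
           a * norm (p + n) \<le> sqrt (Re (cinner p p) - Re (cinner n n)) \<and>
           sqrt (Re (cinner p p) - Re (cinner n n)) \<le> b * norm (p + n))"
  proof (rule exI[of _ UNIV], rule exI[of _ "{0}"], intro conjI)
    show "\<exists>B. finite B \<and> {0::'a} = cspan B"
      by (intro exI[of _ "{}"]) (simp add: complex_vector.span_empty)
    show "\<forall>p\<in>UNIV. \<forall>n\<in>{0}. cinner p (n::'a) = 0"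
      using cinner_scaleC_left[of 0] cinner_commute by (metis complex_cnj_zero complex_vector.scale_zero_left mult_zero_left singletonD)
    then have "cinner 0 (0::'a) = 0"
      by simp
    then show "\<exists>a>0. \<exists>b>0. \<forall>p\<in>UNIV. \<forall>n\<in>{0}.
           a * norm (p + n::'a) \<le> sqrt (Re (cinner p p) - Re (cinner n n)) \<and>
           sqrt (Re (cinner p p) - Re (cinner n n)) \<le> b * norm (p + n)"
      by (intro exI[of _ "1::real"] conjI) (simp_all add: cinner_self)
  qed (auto simp: complex_vector.subspace_UNIV complex_vector.subspace_0 complex_vector.subspace_single_0 cinner_self)
  then show "pontryagin_space (cinner :: 'a \<Rightarrow> 'a \<Rightarrow> complex)"
    unfolding pontryagin_space_def
    by (intro conjI allI cinner_add_left cinner_scaleC_left cinner_commute)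
qed

text \<open>Riesz representation of \<open>g (T x) y\<close> as a functional of \<open>x\<close>
  supplies a vector whose norm is bounded linearly in that of \<open>y\<close>. Nondegeneracy makes
  the assignment linear and unique, so the definite description denotes it.\<close>

lemma form_adjoint:
  fixes T :: "'a::complex_banach \<Rightarrow>\<^sub>L 'b::complex_banach"
  assumes "pontryagin f" "pontryagin g" and T: "clinear_op T"
  shows "g (blinfun_apply T x) y = f x (blinfun_apply (form_adjoint f g T) y)"
    and "clinear_op (form_adjoint f g T)"
proof -
  interpret f: pontryagin f by fact
  interpret g: pontryagin g by fact
  obtain C where C: "0 \<le> C"
    "\<And>\<phi> K. (\<And>x y. \<phi> (x + y) = \<phi> x + \<phi> y) \<Longrightarrow> (\<And>c x. \<phi> (c *\<^sub>C x) = c * \<phi> x) \<Longrightarrow> 0 \<le> K \<Longrightarrow>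
      (\<And>x. cmod (\<phi> x) \<le> K * norm x) \<Longrightarrow> \<exists>v. (\<forall>x. \<phi> x = f x v) \<and> norm v \<le> C * K"
    using f.Riesz by blast
  obtain D where D: "0 < D" "\<And>x y. cmod (g x y) \<le> D * norm x * norm y"
    using g.bounded by blast
  have "\<exists>v. (\<forall>x. g (T x) y = f x v) \<and> norm v \<le> C * (D * norm T * norm y)" for y
  proof (rule C(2))
    show "g (T (x + x')) y = g (T x) y + g (T x') y" for x x'
      by (simp add: blinfun.add_right g.add_left)
    show "g (T (c *\<^sub>C x)) y = c * g (T x) y" for c x
      using T by (simp add: clinear_op_def g.scale_left)
    show "0 \<le> D * norm T * norm y"
      using D(1) by simp
    have "cmod (g (T x) y) \<le> D * (norm T * norm x) * norm y" for x
      using D(1) norm_blinfun[of T x]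
      by (intro order_trans[OF D(2)] mult_right_mono mult_left_mono) auto
    then show "cmod (g (T x) y) \<le> D * norm T * norm y * norm x" for x
      by (simp add: mult_ac)
  qed
  then obtain S where S: "\<And>x y. g (T x) y = f x (S y)" "\<And>y. norm (S y) \<le> C * (D * norm T * norm y)"
    by metis
  have add: "S (y + z) = S y + S z" for y z
    by (rule f.ext_right) (simp add: S(1)[symmetric] f.add_right g.add_right)
  have scale: "S (c *\<^sub>C y) = c *\<^sub>C S y" for c y
    by (rule f.ext_right) (simp add: S(1)[symmetric] f.scale_right g.scale_right)
  have lin: "bounded_linear S"
    using S(2) by (intro bounded_clinear_intro[OF add scale, where K = "C * (D * norm T)"]) (simp add: mult_ac)
  define S' where "S' = Blinfun S"
  have S': "blinfun_apply S' = S"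
    using lin by (simp add: S'_def bounded_linear_Blinfun_apply)
  have eq: "form_adjoint f g T = S'"
    unfolding form_adjoint_def
  proof (rule the_equality)
    show "\<forall>x y. g (T x) y = f x (S' y)"
      by (simp add: S' S(1))
    fix R assume R: "\<forall>x y. g (T x) y = f x (blinfun_apply R y)"
    show "R = S'"
      by (intro blinfun_eqI f.ext_right) (use R S(1) S' in \<open>metis\<close>)
  qed
  show "g (T x) y = f x (form_adjoint f g T y)"
    by (simp add: eq S' S(1))
  show "clinear_op (form_adjoint f g T)"
    by (simp add: eq S' clinear_op_def scale)
qed

section \<open>Bounded complex linear operators\<close>

lemma clinear_opD: "clinear_op T \<Longrightarrow> blinfun_apply T (c *\<^sub>C x) = c *\<^sub>C blinfun_apply T x"
  by (simp add: clinear_op_def)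

lemmas blinfun_scaleC = scaleC_blinfun.rep_eq

lemma clinear_op_add: "clinear_op S \<Longrightarrow> clinear_op T \<Longrightarrow> clinear_op (S + T)"
  by (simp add: clinear_op_def blinfun.add_left scaleC_add_right)

lemma clinear_op_minus: "clinear_op S \<Longrightarrow> clinear_op (- S)"
  by (simp add: clinear_op_def blinfun.minus_left)

lemma clinear_op_compose: "clinear_op S \<Longrightarrow> clinear_op T \<Longrightarrow> clinear_op (S o\<^sub>L T)"
  by (simp add: clinear_op_def)

lemma clinear_op_scaleC: "clinear_op S \<Longrightarrow> clinear_op (c *\<^sub>C S)"
  by (simp add: clinear_op_def blinfun_scaleC scaleC_scaleC mult.commute)

lemma clinear_op_id: "clinear_op id_blinfun"
  by (simp add: clinear_op_def)

lemma inverse_of_bounded_below: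
  fixes D :: "'a::complex_normed_vector \<Rightarrow>\<^sub>L 'b::complex_normed_vector"
  assumes D: "clinear_op D" "surj (blinfun_apply D)" and k: "0 < k" "\<And>x. k * norm x \<le> norm (D x)"
  obtains T where "clinear_op T" "\<And>x. blinfun_apply T (D x) = x" "\<And>x. D (blinfun_apply T x) = x"
proof -
  have inj: "x = y" if "D x = D y" for x y
    using k(2)[of "x - y"] that k(1) by (simp add: blinfun.diff_right mult_le_0_iff)
  obtain S where S: "\<And>y. D (S y) = y"
    using surjD[OF D(2)] by metis
  have SD: "S (D x) = x" for x
    by (rule inj) (rule S)
  have add: "S (x + y) = S x + S y" for x y
    by (rule inj) (simp add: S blinfun.add_right)
  have scale: "S (c *\<^sub>C y) = c *\<^sub>C S y" for c y
    by (rule inj) (simp add: S clinear_opD[OF D(1)])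
  have "bounded_linear S"
    using k(2)[of "S _"] k(1)
    by (intro bounded_clinear_intro[OF add scale, where K = "inverse k"]) (simp add: S field_simps)
  then have S': "blinfun_apply (Blinfun S) = S"
    by (rule bounded_linear_Blinfun_apply)
  show ?thesis
    by (rule that[of "Blinfun S"]) (simp_all add: S' S SD scale clinear_op_def)
qed

text \<open>A solution of \<open>x + S x = y\<close> is a fixed point of the contraction that maps
  \<open>x\<close> to \<open>y - S x\<close>; the inverse is bounded because I + S is bounded below
  by \<open>1 - norm S\<close>.\<close>

lemma Neumann_inverse:
  fixes S :: "'a::complex_banach \<Rightarrow>\<^sub>L 'a"
  assumes S: "clinear_op S" "norm S < 1"
  obtains T where "clinear_op T" "\<And>x. blinfun_apply T (x + S x) = x"
    "\<And>x. blinfun_apply T x + S (blinfun_apply T x) = x"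
proof -
  define D where "D = id_blinfun + S"
  have D: "D x = x + S x" for x
    by (simp add: D_def blinfun.add_left)
  have low: "(1 - norm S) * norm x \<le> norm (D x)" for x
    using norm_diff_ineq[of x "S x"] norm_blinfun[of S x] by (simp add: D algebra_simps)
  have "\<exists>x. D x = y" for y
  proof -
    have "dist (y - S x) (y - S z) \<le> norm S * dist x z" for x z
      using norm_blinfun[of S "z - x"] by (simp add: dist_norm blinfun.diff_right norm_minus_commute)
    then have "\<exists>!x. y - S x = x"
      using S(2) by (intro banach_fix_type[of "norm S"]) auto
    then obtain x where "y - S x = x"
      by blast
    then have "D x = y"
      unfolding D by (metis diff_add_cancel)
    then show ?thesis
      by blast
  qed
  then have "surj (blinfun_apply D)"
    by (metis surjI)
  then show ?thesis
    using inverse_of_bounded_below[of D "1 - norm S"] that low S D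
    by (auto simp: D_def clinear_op_add clinear_op_id)
qed

text \<open>The lower bound makes the range closed, and a closed proper subspace has a nonzero
  annihilator.\<close>

lemma (in pontryagin) surj_of_annihilator:
  fixes D :: "'a \<Rightarrow>\<^sub>L 'a"
  assumes D: "clinear_op D" and k: "0 < k" "\<And>x. k * norm x \<le> norm (D x)"
    and ann: "\<And>u. (\<And>y. ip (D y) u = 0) \<Longrightarrow> u = 0"
  shows "surj (blinfun_apply D)"
proof -
  have "csubspace (range (blinfun_apply D))"
  proof (rule complex_vector.subspaceI)
    show "0 \<in> range (blinfun_apply D)"
      by (rule range_eqI[of _ _ 0]) simp
    show "\<And>x y. x \<in> range (blinfun_apply D) \<Longrightarrow> y \<in> range (blinfun_apply D) \<Longrightarrow> x + y \<in> range (blinfun_apply D)"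
      by (auto simp: blinfun.add_right[symmetric])
    show "\<And>c x. x \<in> range (blinfun_apply D) \<Longrightarrow> c *\<^sub>C x \<in> range (blinfun_apply D)"
      by (auto simp: clinear_opD[OF D, symmetric])
  qed
  moreover have "closed (range (blinfun_apply D))"
    using complete_isometric_image[OF k(1) subspace_UNIV blinfun.bounded_linear_right[of D] _ complete_UNIV] k(2)
    by (auto intro: complete_imp_closed)
  ultimately show ?thesis
    using annihilator[of "range (blinfun_apply D)"] ann by (metis rangeI)
qed

section \<open>Resolvents of dissipative operators in Pontryagin spaces\<close>

context pontryagin
begin

text \<open>Below, \<open>K\<close> is the resolvent at \<open>z\<close> of the relation \<open>{(K y, y + z *\<^sub>C K y)}\<close>, so that
  \<open>y + (z - l) *\<^sub>C K y\<close> is the image of \<open>K y\<close> under this relation minus \<open>l\<close>.\<close>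

lemma approximate_eigenvector_small:
  fixes K K' :: "'a \<Rightarrow>\<^sub>L 'a"
  assumes adj: "\<And>x y. ip (K x) y = ip x (K' y)"
    and dense: "closure (range (\<lambda>u. u + cnj (z - c) *\<^sub>C K' u)) = UNIV" and \<delta>: "0 < \<delta>"
  shows "\<exists>\<epsilon>>0. \<forall>l y. cmod (l - c) < \<epsilon> \<and> norm (y + (z - l) *\<^sub>C K y) \<le> \<epsilon> * norm (K y) \<longrightarrow>
    cmod (ip (K y) e) \<le> \<delta> * norm (K y)"
proof -
  obtain C where C: "0 < C" "\<And>x y. cmod (ip x y) \<le> C * norm x * norm y"
    using bounded by blast
  have "e \<in> closure (range (\<lambda>u. u + cnj (z - c) *\<^sub>C K' u))" "0 < \<delta> / (2 * C)"
    using dense \<delta> C(1) by auto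
  then obtain u where u: "dist (u + cnj (z - c) *\<^sub>C K' u) e < \<delta> / (2 * C)"
    unfolding closure_approachable by blast
  define w where "w = u + cnj (z - c) *\<^sub>C K' u"
  \<comment> \<open>Two errors of size \<open>\<epsilon> * norm (K y)\<close> arise, one from the
    residual at \<open>l\<close> and one from moving \<open>l\<close> to \<open>c\<close>. Paired
    with \<open>K' u\<close> they may cost half of \<delta>; the approximation of \<open>e\<close>
    by \<open>w\<close> costs the other half.\<close>
  define \<epsilon> where "\<epsilon> = \<delta> / (4 * C * (norm (K' u) + 1))"
  have \<epsilon>: "0 < \<epsilon>"
    using \<delta> C(1) by (simp add: \<epsilon>_def add_nonneg_pos)
  have small: "2 * C * \<epsilon> * norm (K' u) \<le> \<delta> / 2"
    using \<delta> C(1) by (simp add: \<epsilon>_def divide_simps add_nonneg_pos)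
  have "cmod (ip (K y) e) \<le> \<delta> * norm (K y)"
    if l: "cmod (l - c) < \<epsilon>" and y: "norm (y + (z - l) *\<^sub>C K y) \<le> \<epsilon> * norm (K y)" for l y
  proof -
    have eq: "y + (z - c) *\<^sub>C K y = (y + (z - l) *\<^sub>C K y) + (l - c) *\<^sub>C K y"
      by (simp add: scaleC_add_left[symmetric] add.assoc)
    have "norm ((l - c) *\<^sub>C K y) \<le> \<epsilon> * norm (K y)"
      using l by (simp add: norm_scaleC mult_right_mono)
    then have n: "norm (y + (z - c) *\<^sub>C K y) \<le> 2 * \<epsilon> * norm (K y)"
      unfolding eq using y norm_triangle_ineq[of "y + (z - l) *\<^sub>C K y" "(l - c) *\<^sub>C K y"] by linarith
    \<comment> \<open>\<open>w\<close> lies in the range of the adjoint relation minus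
      \<open>cnj c\<close>, so the pairing moves the relation minus \<open>c\<close> onto
      \<open>K y\<close>, where only the small residual remains.\<close>
    have "ip (K y) w = ip (y + (z - c) *\<^sub>C K y) (K' u)"
      by (simp add: w_def form_simps adj)
    then have e: "ip (K y) e = ip (y + (z - c) *\<^sub>C K y) (K' u) - ip (K y) (w - e)"
      by (simp add: diff_right)
    have "cmod (ip (y + (z - c) *\<^sub>C K y) (K' u)) \<le> C * (2 * \<epsilon> * norm (K y)) * norm (K' u)"
      using n C(1) by (intro order_trans[OF C(2)] mult_right_mono mult_left_mono) auto
    also have "\<dots> = (2 * C * \<epsilon> * norm (K' u)) * norm (K y)"
      by simp
    also have "\<dots> \<le> \<delta> / 2 * norm (K y)"
      using small by (rule mult_right_mono) simp
    finally have 1: "cmod (ip (y + (z - c) *\<^sub>C K y) (K' u)) \<le> \<delta> / 2 * norm (K y)" .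
    have "norm (w - e) \<le> \<delta> / (2 * C)"
      using u by (simp add: w_def dist_norm)
    then have "cmod (ip (K y) (w - e)) \<le> C * norm (K y) * (\<delta> / (2 * C))"
      using C(1) by (intro order_trans[OF C(2)] mult_left_mono) auto
    also have "\<dots> = \<delta> / 2 * norm (K y)"
      using C(1) by simp
    finally show ?thesis
      unfolding e using 1 norm_triangle_ineq4[of "ip (y + (z - c) *\<^sub>C K y) (K' u)" "ip (K y) (w - e)"]
      by (simp add: field_simps)
  qed
  then show ?thesis
    using \<epsilon> by blast
qed

text \<open>The functionals in \<open>Garding\<close> are finitely many, so one \<epsilon> makes all
  of them small on approximate eigenvectors; what is left of the inequality is uniform
  positivity.\<close>

lemma approximate_eigenvector_positive:
  fixes K K' :: "'a \<Rightarrow>\<^sub>L 'a"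
  assumes adj: "\<And>x y. ip (K x) y = ip x (K' y)"
    and dense: "closure (range (\<lambda>u. u + cnj (z - c) *\<^sub>C K' u)) = UNIV"
  obtains \<epsilon> a where "0 < \<epsilon>" "0 < a"
    "\<And>l y. cmod (l - c) < \<epsilon> \<Longrightarrow> norm (y + (z - l) *\<^sub>C K y) \<le> \<epsilon> * norm (K y) \<Longrightarrow>
      a * (norm (K y))\<^sup>2 \<le> Re (ip (K y) (K y))"
proof -
  obtain E a where E: "finite E" and a: "0 < a"
    and G: "\<And>x. a * (norm x)\<^sup>2 \<le> Re (ip x x) + 2 * (\<Sum>e\<in>E. (cmod (ip x e))\<^sup>2)"
    using Garding by blast
  \<comment> \<open>The sum over \<open>E\<close> becomes at most \<open>a / 4\<close> times the
    squared norm and enters \<open>Garding\<close> twice, which leaves \<open>a / 2\<close>. The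
    summand 1 keeps \<delta> positive when \<open>E\<close> is empty.\<close>
  define \<delta> where "\<delta> = sqrt (a / (4 * (real (card E) + 1)))"
  have \<delta>: "0 < \<delta>" "\<delta>\<^sup>2 = a / (4 * (real (card E) + 1))"
    using a by (simp_all add: \<delta>_def add_nonneg_pos)
  have "\<forall>e. \<exists>\<epsilon>>0. \<forall>l y. cmod (l - c) < \<epsilon> \<and> norm (y + (z - l) *\<^sub>C K y) \<le> \<epsilon> * norm (K y) \<longrightarrow>
      cmod (ip (K y) e) \<le> \<delta> * norm (K y)"
    using approximate_eigenvector_small[OF adj dense \<delta>(1)] by blast
  then obtain r where r: "\<And>e. 0 < r e"
    "\<And>e l y. cmod (l - c) < r e \<Longrightarrow> norm (y + (z - l) *\<^sub>C K y) \<le> r e * norm (K y) \<Longrightarrow>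
      cmod (ip (K y) e) \<le> \<delta> * norm (K y)"
    by metis
  define \<epsilon> where "\<epsilon> = Min (insert 1 (r ` E))"
  have \<epsilon>: "0 < \<epsilon>" "\<And>e. e \<in> E \<Longrightarrow> \<epsilon> \<le> r e"
    using E r(1) by (auto simp: \<epsilon>_def)
  have "a / 2 * (norm (K y))\<^sup>2 \<le> Re (ip (K y) (K y))"
    if l: "cmod (l - c) < \<epsilon>" and y: "norm (y + (z - l) *\<^sub>C K y) \<le> \<epsilon> * norm (K y)" for l y
  proof -
    have "(cmod (ip (K y) e))\<^sup>2 \<le> \<delta>\<^sup>2 * (norm (K y))\<^sup>2" if e: "e \<in> E" for e
    proof -
      have "norm (y + (z - l) *\<^sub>C K y) \<le> r e * norm (K y)"
        using y mult_right_mono[OF \<epsilon>(2)[OF e] norm_ge_zero[of "K y"]] by linarith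
      then have "cmod (ip (K y) e) \<le> \<delta> * norm (K y)"
        using l \<epsilon>(2)[OF e] by (intro r(2)[of l]) auto
      then show ?thesis
        using power_mono[of _ _ 2] by (fastforce simp: power_mult_distrib)
    qed
    then have "(\<Sum>e\<in>E. (cmod (ip (K y) e))\<^sup>2) \<le> real (card E) * (\<delta>\<^sup>2 * (norm (K y))\<^sup>2)"
      by (rule sum_bounded_above)
    also have "\<dots> = real (card E) * \<delta>\<^sup>2 * (norm (K y))\<^sup>2"
      by simp
    also have "\<dots> \<le> a / 4 * (norm (K y))\<^sup>2"
      unfolding \<delta>(2) using a by (intro mult_right_mono) (auto simp: divide_simps add_nonneg_pos)
    finally show ?thesis
      using G[of "K y"] by simp
  qed
  then show ?thesis
    using that[of \<epsilon> "a / 2"] \<epsilon>(1) a by simp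
qed

text \<open>The sign \<open>s\<close> is 1 for dissipative relations and -1 for accretive ones.\<close>

lemma dissipative_bound:
  fixes K K' :: "'a \<Rightarrow>\<^sub>L 'a"
  assumes adj: "\<And>x y. ip (K x) y = ip x (K' y)"
    and dense: "closure (range (\<lambda>u. u + cnj (z - c) *\<^sub>C K' u)) = UNIV"
    and diss: "\<And>y. s * Im (ip (y + z *\<^sub>C K y) (K y)) \<le> 0" and s: "\<bar>s\<bar> = 1"
  obtains \<epsilon> k where "0 < \<epsilon>" "0 < k"
    "\<And>l y. cmod (l - c) < \<epsilon> \<Longrightarrow> 0 < s * Im l \<Longrightarrow> k * min 1 (s * Im l) * norm (K y) \<le> norm (y + (z - l) *\<^sub>C K y)"
proof -
  obtain \<epsilon> a where \<epsilon>: "0 < \<epsilon>" and a: "0 < a"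
    and pos: "\<And>l y. cmod (l - c) < \<epsilon> \<Longrightarrow> norm (y + (z - l) *\<^sub>C K y) \<le> \<epsilon> * norm (K y) \<Longrightarrow>
      a * (norm (K y))\<^sup>2 \<le> Re (ip (K y) (K y))"
    using approximate_eigenvector_positive[OF adj dense] by blast
  obtain C where C: "0 < C" "\<And>x y. cmod (ip x y) \<le> C * norm x * norm y"
    using bounded by blast
  \<comment> \<open>If the estimate failed, the residual would be below
    \<open>\<epsilon> * norm (K y)\<close>, so \<open>K y\<close> would be uniformly positive, and
    dissipativity would bound the residual from below by \<open>a / C * (s * Im l)\<close> times the
    norm. The factor \<open>min 1 (s * Im l)\<close> lets one \<open>k\<close> serve both
    purposes.\<close>
  define k where "k = min \<epsilon> (a / C)"
  have k: "0 < k" "k \<le> \<epsilon>" "k * C \<le> a"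
    using \<epsilon> a C(1) by (auto simp: k_def min_def field_simps)
  have "k * min 1 (s * Im l) * norm (K y) \<le> norm (y + (z - l) *\<^sub>C K y)"
    if l: "cmod (l - c) < \<epsilon>" "0 < s * Im l" for l y
  proof (rule ccontr)
    define x where "x = K y"
    define w where "w = y + (z - l) *\<^sub>C x"
    assume "\<not> ?thesis"
    then have less: "norm w < k * min 1 (s * Im l) * norm x"
      by (simp add: x_def w_def)
    have x: "0 < norm x"
      using le_less_trans[OF norm_ge_zero less] k(1) l(2) by (auto simp: zero_less_mult_iff)
    have "k * min 1 (s * Im l) \<le> \<epsilon> * 1"
      using k l(2) by (intro mult_mono) auto
    then have "norm w \<le> \<epsilon> * norm x"
      using less mult_right_mono[of "k * min 1 (s * Im l)" \<epsilon> "norm x"] by simp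
    then have p: "a * (norm x)\<^sup>2 \<le> Re (ip x x)"
      using pos[OF l(1)] by (simp add: x_def w_def)
    have "y + z *\<^sub>C x = w + l *\<^sub>C x"
      by (simp add: w_def complex_vector.scale_left_diff_distrib)
    then have "Im (ip (y + z *\<^sub>C x) x) = Im (ip w x) + Im l * Re (ip x x)"
      by (simp add: form_simps)
    then have "s * Im l * Re (ip x x) \<le> - (s * Im (ip w x))"
      using diss[of y] by (simp add: x_def algebra_simps)
    also have "\<dots> \<le> \<bar>s * Im (ip w x)\<bar>"
      by simp
    also have "\<dots> \<le> cmod (ip w x)"
      using s abs_Im_le_cmod[of "ip w x"] by (simp add: abs_mult)
    also have "\<dots> \<le> C * norm w * norm x"
      by (rule C(2))
    finally have "s * Im l * (a * (norm x)\<^sup>2) \<le> C * norm w * norm x"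
      using mult_left_mono[OF p, of "s * Im l"] l(2) by linarith
    then have "s * Im l * a * norm x \<le> C * norm w"
      using x by (simp add: power2_eq_square)
    also have "\<dots> < C * (k * min 1 (s * Im l) * norm x)"
      using less C(1) by simp
    also have "\<dots> = (k * C) * min 1 (s * Im l) * norm x"
      by simp
    also have "\<dots> \<le> a * (s * Im l) * norm x"
      using k l(2) a by (intro mult_right_mono mult_mono) auto
    finally show False
      by (simp add: mult_ac)
  qed
  then show ?thesis
    by (rule that[OF \<epsilon> k(1)])
qed

text \<open>The annihilator of the range of I + cnj z K' is the kernel of the adjoint I + z
  K.\<close>

lemma range_resolvent_dense:
  fixes K K' :: "'a \<Rightarrow>\<^sub>L 'a"
  assumes adj: "\<And>x y. ip (K x) y = ip x (K' y)" and K: "clinear_op K'"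
    and inj: "\<And>y. y + z *\<^sub>C K y = 0 \<Longrightarrow> y = 0"
  shows "closure (range (\<lambda>u. u + cnj z *\<^sub>C K' u)) = UNIV"
proof (rule dense_of_annihilator)
  show "csubspace (range (\<lambda>u. u + cnj z *\<^sub>C K' u))"
  proof (rule complex_vector.subspaceI)
    show "0 \<in> range (\<lambda>u. u + cnj z *\<^sub>C K' u)"
      by (rule range_eqI[of _ _ 0]) simp
    fix x y c assume "x \<in> range (\<lambda>u. u + cnj z *\<^sub>C K' u)"
    then obtain u where x: "x = u + cnj z *\<^sub>C K' u"
      by blast
    show "c *\<^sub>C x \<in> range (\<lambda>u. u + cnj z *\<^sub>C K' u)"
      by (rule range_eqI[of _ _ "c *\<^sub>C u"]) (simp add: x clinear_opD[OF K] scaleC_add_right scaleC_scaleC mult.commute)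
    assume "y \<in> range (\<lambda>u. u + cnj z *\<^sub>C K' u)"
    then obtain v where y: "y = v + cnj z *\<^sub>C K' v"
      by blast
    show "x + y \<in> range (\<lambda>u. u + cnj z *\<^sub>C K' u)"
      by (rule range_eqI[of _ _ "u + v"]) (simp add: x y blinfun.add_right scaleC_add_right)
  qed
  fix u assume u: "\<And>s. s \<in> range (\<lambda>u. u + cnj z *\<^sub>C K' u) \<Longrightarrow> ip s u = 0"
  have "ip w (u + z *\<^sub>C K u) = 0" for w
  proof -
    have "ip w (K u) = ip (K' w) u"
      using adj[of u w] commute[of w "K u"] commute[of "K' w" u] by simp
    then show ?thesis
      using u[of "w + cnj z *\<^sub>C K' w"] by (simp add: form_simps)
  qed
  then show "u = 0"
    by (rule inj[OF nondegenerate])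
qed

text \<open>\<open>T\<close> inverts I + (z - l) K, so \<open>K (T y)\<close> is the value at
  \<open>y\<close> of the resolvent at \<open>l\<close>. The dissipative bound for \<open>K\<close>
  gives injectivity and closed range; the accretive bound for \<open>K'\<close>, taken at
  \<open>cnj l\<close>, excludes an annihilator of the range.\<close>

lemma dissipative_resolvent:
  fixes K K' :: "'a \<Rightarrow>\<^sub>L 'a"
  assumes adj: "\<And>x y. ip (K x) y = ip x (K' y)" and K: "clinear_op K" "clinear_op K'"
    and diss: "\<And>y. Im (ip (y + z *\<^sub>C K y) (K y)) \<le> 0"
    and accr: "\<And>y. 0 \<le> Im (ip (y + cnj z *\<^sub>C K' y) (K' y))"
    and inj: "\<And>y. y + (z - c) *\<^sub>C K y = 0 \<Longrightarrow> y = 0"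
    and inj': "\<And>y. y + cnj (z - c) *\<^sub>C K' y = 0 \<Longrightarrow> y = 0"
  obtains \<epsilon> k where "0 < \<epsilon>" "0 < k"
    "\<And>l. cmod (l - c) < \<epsilon> \<Longrightarrow> 0 < Im l \<Longrightarrow> \<exists>T. clinear_op T \<and>
      (\<forall>y. blinfun_apply T (y + (z - l) *\<^sub>C K y) = y) \<and>
      (\<forall>y. blinfun_apply T y + (z - l) *\<^sub>C K (blinfun_apply T y) = y) \<and>
      (\<forall>y. k * min 1 (Im l) * norm (K (blinfun_apply T y)) \<le> norm y)"
proof -
  have adj': "ip (K' x) y = ip x (K y)" for x y
    using adj[of y x] commute[of x "K y"] commute[of "K' x" y] by simp
  have dense: "closure (range (\<lambda>u. u + cnj (z - c) *\<^sub>C K' u)) = UNIV"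
    by (rule range_resolvent_dense[OF adj K(2) inj])
  obtain \<epsilon>1 k where \<epsilon>1: "0 < \<epsilon>1" and k: "0 < k"
    and b1: "\<And>l y. cmod (l - c) < \<epsilon>1 \<Longrightarrow> 0 < 1 * Im l \<Longrightarrow> k * min 1 (1 * Im l) * norm (K y) \<le> norm (y + (z - l) *\<^sub>C K y)"
    by (rule dissipative_bound[OF adj dense, of 1]) (use diss in auto)
  have dense': "closure (range (\<lambda>u. u + cnj (cnj z - cnj c) *\<^sub>C K u)) = UNIV"
    by (rule range_resolvent_dense[OF adj' K(1) inj'[unfolded complex_cnj_diff]])
  obtain \<epsilon>2 k2 where \<epsilon>2: "0 < \<epsilon>2" and k2: "0 < k2"
    and b2: "\<And>l y. cmod (l - cnj c) < \<epsilon>2 \<Longrightarrow> 0 < -1 * Im l \<Longrightarrow>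
      k2 * min 1 (-1 * Im l) * norm (K' y) \<le> norm (y + (cnj z - l) *\<^sub>C K' y)"
    by (rule dissipative_bound[OF adj' dense', of "-1"]) (use accr in auto)
  have "\<exists>T. clinear_op T \<and>
      (\<forall>y. blinfun_apply T (y + (z - l) *\<^sub>C K y) = y) \<and>
      (\<forall>y. blinfun_apply T y + (z - l) *\<^sub>C K (blinfun_apply T y) = y) \<and>
      (\<forall>y. k * min 1 (Im l) * norm (K (blinfun_apply T y)) \<le> norm y)"
    if l: "cmod (l - c) < min \<epsilon>1 \<epsilon>2" "0 < Im l" for l
  proof -
    define D where "D = id_blinfun + (z - l) *\<^sub>C K"
    have D: "D y = y + (z - l) *\<^sub>C K y" for y
      by (simp add: D_def blinfun.add_left blinfun_scaleC)
    have cD: "clinear_op D"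
      unfolding D_def by (intro clinear_op_add clinear_op_id clinear_op_scaleC K)
    define m where "m = k * min 1 (Im l)"
    have m: "0 < m"
      using k l(2) by (simp add: m_def)
    have mK: "m * norm (K y) \<le> norm (D y)" for y
      using b1[of l y] l by (simp add: m_def D)
    \<comment> \<open>Turns the bound on \<open>K y\<close> into one on \<open>y\<close> itself, by
      means of \<open>y = D y - (z - l) *\<^sub>C K y\<close>.\<close>
    define d where "d = m / (m + cmod (z - l))"
    have d: "0 < d"
      using m by (simp add: d_def add_pos_nonneg)
    have low: "d * norm y \<le> norm (D y)" for y
    proof -
      have "norm y \<le> norm (D y) + cmod (z - l) * norm (K y)"
        using norm_triangle_ineq4[of "D y" "(z - l) *\<^sub>C K y"] by (simp add: D norm_scaleC)
      then have "m * norm y \<le> m * norm (D y) + cmod (z - l) * (m * norm (K y))"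
        using mult_left_mono[of _ _ m] m by (fastforce simp: algebra_simps)
      also have "\<dots> \<le> m * norm (D y) + cmod (z - l) * norm (D y)"
        by (intro add_left_mono mult_left_mono mK) simp
      finally show ?thesis
        using m by (simp add: d_def add_pos_nonneg field_simps)
    qed
    have "surj (blinfun_apply D)"
    proof (rule surj_of_annihilator[OF cD d low])
      fix u assume u: "\<And>y. ip (D y) u = 0"
      have "ip y (u + (cnj z - cnj l) *\<^sub>C K' u) = 0" for y
        using u[of y] by (simp add: D form_simps adj)
      then have 0: "u + (cnj z - cnj l) *\<^sub>C K' u = 0"
        by (rule nondegenerate)
      have "cmod (cnj l - cnj c) < \<epsilon>2"
        using l(1) by (metis complex_cnj_diff complex_mod_cnj min_less_iff_conj)
      then have "k2 * min 1 (Im l) * norm (K' u) \<le> 0"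
        using b2[of "cnj l" u] l(2) 0 by simp
      moreover have "0 < k2 * min 1 (Im l)"
        using k2 l(2) by simp
      ultimately have "norm (K' u) \<le> 0"
        using mult_le_cancel_left_pos[of "k2 * min 1 (Im l)" "norm (K' u)" 0] by simp
      then have "K' u = 0"
        by simp
      then show "u = 0"
        using 0 by simp
    qed
    then obtain T where T: "clinear_op T" "\<And>x. blinfun_apply T (D x) = x" "\<And>x. D (blinfun_apply T x) = x"
      using inverse_of_bounded_below[OF cD _ d low] by blast
    moreover have "m * norm (K (T y)) \<le> norm y" for y
      using mK[of "T y"] by (simp add: T(3))
    ultimately show ?thesis
      by (intro exI[of _ T]) (simp add: D m_def)
  qed
  moreover have "0 < min \<epsilon>1 \<epsilon>2"
    using \<epsilon>1 \<epsilon>2 by simp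
  ultimately show ?thesis
    using that k by blast
qed

end

section \<open>Holomorphic vector-valued functions\<close>

lemma bounded_bilinear_scaleC:
  "bounded_bilinear (scaleC :: complex \<Rightarrow> 'a::complex_normed_vector \<Rightarrow> 'a)"
proof
  fix r :: real and c :: complex and x :: 'a
  show "(r *\<^sub>R c) *\<^sub>C x = r *\<^sub>R c *\<^sub>C x"
    by (simp add: scaleR_conv_of_real scaleC_of_real[symmetric])
  show "c *\<^sub>C r *\<^sub>R x = r *\<^sub>R c *\<^sub>C x"
    by (simp add: scaleC_of_real[symmetric] scaleC_scaleC mult.commute)
  show "\<exists>K. \<forall>a b. norm (a *\<^sub>C (b :: 'a)) \<le> norm a * norm b * K"
    by (intro exI[of _ 1]) (simp add: norm_scaleC)
qed (simp_all add: scaleC_add_left scaleC_add_right)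

lemmas tendsto_scaleC = bounded_bilinear.tendsto[OF bounded_bilinear_scaleC]

lemma has_cderivative_quadratic:
  assumes "\<forall>\<^sub>F z in at w. norm (F z - F w - (z - w) *\<^sub>C D) \<le> C * (cmod (z - w))\<^sup>2"
  shows "has_cderivative F D (at w)"
  unfolding has_cderivative_def has_derivative_at_within
proof
  show "bounded_linear (\<lambda>h. h *\<^sub>C D)"
    by (rule bounded_bilinear.bounded_linear_left[OF bounded_bilinear_scaleC])
  have ev: "\<forall>\<^sub>F z in at w. norm ((F z - F w - (z - w) *\<^sub>C D) /\<^sub>R norm (z - w)) \<le> C * cmod (z - w)"
    using assms
  proof eventually_elim
    case (elim z)
    show ?case
    proof (cases "z = w")
      case False
      then show ?thesis
        using elim(1) by (simp add: divide_simps power2_eq_square norm_divide)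
    qed simp
  qed
  have "((\<lambda>z. C * cmod (z - w)) \<longlongrightarrow> C * cmod (w - w)) (at w)"
    by (intro tendsto_intros)
  then have "((\<lambda>z. C * cmod (z - w)) \<longlongrightarrow> 0) (at w)"
    by simp
  with ev show "((\<lambda>z. (F z - F w - (z - w) *\<^sub>C D) /\<^sub>R norm (z - w)) \<longlongrightarrow> 0) (at w)"
    by (rule Lim_null_comparison)
qed

lemma cderiv_eqI:
  assumes "has_cderivative F D (at z)"
  shows "cderiv F z = D"
  unfolding cderiv_def
proof (rule the_equality[of _ D])
  fix D' assume "has_cderivative F D' (at z)"
  then have "(\<lambda>h. h *\<^sub>C D') = (\<lambda>h. h *\<^sub>C D)"
    using assms unfolding has_cderivative_def by (rule has_derivative_unique)
  then show "D' = D"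
    by (metis scaleC_one)
qed (rule assms)

lemma has_cderivative_const: "has_cderivative (\<lambda>z. c) 0 (at w)"
  by (simp add: has_cderivative_def)

lemma has_cderivative_add:
  "has_cderivative F D (at w) \<Longrightarrow> has_cderivative G D' (at w) \<Longrightarrow> has_cderivative (\<lambda>z. F z + G z) (D + D') (at w)"
  unfolding has_cderivative_def by (drule (1) has_derivative_add) (simp add: scaleC_add_right)

lemma has_cderivative_scaleC:
  assumes "(c has_field_derivative c') (at w)" "has_cderivative F D (at w)"
  shows "has_cderivative (\<lambda>z. c z *\<^sub>C F z) (c w *\<^sub>C D + c' *\<^sub>C F w) (at w)"
  using bounded_bilinear.FDERIV[OF bounded_bilinear_scaleC assms(1)[unfolded has_field_derivative_def]
      assms(2)[unfolded has_cderivative_def]]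
  by (simp add: has_cderivative_def scaleC_add_right scaleC_scaleC mult.commute)

lemma has_cderivative_linear:
  assumes "bounded_linear T" "\<And>c x. T (c *\<^sub>C x) = c *\<^sub>C T x" "has_cderivative F D (at w)"
  shows "has_cderivative (\<lambda>z. T (F z)) (T D) (at w)"
  using bounded_linear.has_derivative[OF assms(1) assms(3)[unfolded has_cderivative_def]]
  by (simp add: has_cderivative_def assms(2))

lemma has_cderivative_isCont: "has_cderivative F D (at w) \<Longrightarrow> isCont F w"
  unfolding has_cderivative_def by (rule has_derivative_continuous)

lemma vholomorphic_onI:
  assumes "\<And>z. z \<in> S \<Longrightarrow> \<exists>D. has_cderivative F D (at z)"
  shows "vholomorphic_on F S"
  using assms unfolding vholomorphic_on_def has_cderivative_def by (meson has_derivative_at_withinI)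

lemma vholomorphic_onD:
  assumes "vholomorphic_on F S" "open S" "z \<in> S"
  obtains D where "has_cderivative F D (at z)"
  using assms unfolding vholomorphic_on_def has_cderivative_def by (metis at_within_open)

lemma has_cderivative_transform:
  assumes "has_cderivative F D (at z)" "open S" "z \<in> S" "\<And>w. w \<in> S \<Longrightarrow> F w = G w"
  shows "has_cderivative G D (at z)"
  using assms unfolding has_cderivative_def by (metis has_derivative_transform_within_open)

section \<open>Self-adjoint relations in Pontryagin spaces\<close>

lemma op_graph_iff: "(x, y) \<in> op_graph T \<longleftrightarrow> y = blinfun_apply T x"
  by (auto simp: op_graph_def)

text \<open>With \<open>b = y + z *\<^sub>C a\<close> the right-hand side says that each
  \<open>y\<close> has exactly one \<open>a\<close>, namely \<open>R y\<close>; later arguments use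
  the graph equation in this pointwise form.\<close>

lemma resolvent_graph_iff:
  fixes A :: "('a::complex_banach \<times> 'a) set"
  shows "(rel_shift A z)\<inverse> = op_graph R \<longleftrightarrow> (\<forall>a b. (a, b) \<in> A \<longleftrightarrow> blinfun_apply R (b - z *\<^sub>C a) = a)"
proof -
  have shift: "(a, y) \<in> rel_shift A z \<longleftrightarrow> (a, y + z *\<^sub>C a) \<in> A" for a y
    by (auto simp: rel_shift_def intro!: exI[of _ "y + z *\<^sub>C a"])
  show ?thesis
  proof
    assume eq: "(rel_shift A z)\<inverse> = op_graph R"
    show "\<forall>a b. (a, b) \<in> A \<longleftrightarrow> blinfun_apply R (b - z *\<^sub>C a) = a"
    proof (intro allI)
      fix a b
      have "(a, b) \<in> A \<longleftrightarrow> (b - z *\<^sub>C a, a) \<in> (rel_shift A z)\<inverse>"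
        by (simp add: shift)
      then show "(a, b) \<in> A \<longleftrightarrow> blinfun_apply R (b - z *\<^sub>C a) = a"
        by (auto simp: eq op_graph_iff)
    qed
  next
    assume "\<forall>a b. (a, b) \<in> A \<longleftrightarrow> blinfun_apply R (b - z *\<^sub>C a) = a"
    then show "(rel_shift A z)\<inverse> = op_graph R"
      by (auto simp: shift op_graph_iff)
  qed
qed

lemma resolvent_setI:
  fixes A :: "('a::complex_banach \<times> 'a) set"
  assumes "clinear_op T" "\<And>a b. (a, b) \<in> A \<longleftrightarrow> blinfun_apply T (b - z *\<^sub>C a) = a"
  shows "z \<in> resolvent_set A" "resolvent A z = T"
proof -
  have graph: "(rel_shift A z)\<inverse> = op_graph T"
    using assms(2) unfolding resolvent_graph_iff by blast
  then show "z \<in> resolvent_set A"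
    using assms(1) by (auto simp: resolvent_set_def)
  show "resolvent A z = T"
    unfolding resolvent_def
  proof (rule the_equality[of _ T])
    fix R assume "(rel_shift A z)\<inverse> = op_graph R"
    then show "R = T"
      unfolding graph by (intro blinfun_eqI) (metis op_graph_iff)
  qed (rule graph)
qed

lemma
  assumes "z \<in> resolvent_set A"
  shows clinear_resolvent: "clinear_op (resolvent A z)"
    and resolvent_iff: "(a, b) \<in> A \<longleftrightarrow> blinfun_apply (resolvent A z) (b - z *\<^sub>C a) = a"
proof -
  obtain R where R: "clinear_op R" "(rel_shift A z)\<inverse> = op_graph R"
    using assms by (auto simp: resolvent_set_def)
  have iff: "(a, b) \<in> A \<longleftrightarrow> blinfun_apply R (b - z *\<^sub>C a) = a" for a b
    using R(2) unfolding resolvent_graph_iff by blast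
  have eq: "resolvent A z = R"
    by (rule resolvent_setI(2)[OF R(1) iff])
  show "clinear_op (resolvent A z)" "(a, b) \<in> A \<longleftrightarrow> blinfun_apply (resolvent A z) (b - z *\<^sub>C a) = a"
    unfolding eq by (rule R(1), rule iff)
qed

lemma resolvent_mem:
  assumes "z \<in> resolvent_set A"
  shows "(resolvent A z y, y + z *\<^sub>C resolvent A z y) \<in> A"
  by (simp add: resolvent_iff[OF assms])

lemma resolvent_identity:
  fixes A :: "('a::complex_banach \<times> 'a) set"
  assumes "z \<in> resolvent_set A" "w \<in> resolvent_set A"
  shows "resolvent A z x = resolvent A w x + (z - w) *\<^sub>C resolvent A z (resolvent A w x)"
proof -
  have "resolvent A z (x + w *\<^sub>C resolvent A w x - z *\<^sub>C resolvent A w x) = resolvent A w x"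
    using resolvent_mem[OF assms(2)] by (simp only: resolvent_iff[OF assms(1)])
  then have eq: "resolvent A w x = resolvent A z x + w *\<^sub>C resolvent A z (resolvent A w x) - z *\<^sub>C resolvent A z (resolvent A w x)"
    by (simp only: blinfun.add_right blinfun.diff_right clinear_opD[OF clinear_resolvent[OF assms(1)]])
  have "b = a + (d - c)" if "a = b + c - d" for a b c d :: 'a
    using that by simp
  from this[OF eq] show ?thesis
    by (simp only: complex_vector.scale_left_diff_distrib)
qed

text \<open>\<open>T\<close> inverts I + (w - z) R with R the resolvent at \<open>w\<close>, and the
  product R T is the resolvent at \<open>z\<close>.\<close>

lemma resolvent_shift:
  fixes A :: "('a::complex_banach \<times> 'a) set"
  assumes w: "w \<in> resolvent_set A" and T: "clinear_op T"
    "\<And>x. blinfun_apply T (x + (w - z) *\<^sub>C resolvent A w x) = x"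
    "\<And>x. blinfun_apply T x + (w - z) *\<^sub>C resolvent A w (blinfun_apply T x) = x"
  shows "z \<in> resolvent_set A"
proof (rule resolvent_setI(1))
  show "clinear_op (resolvent A w o\<^sub>L T)"
    by (intro clinear_op_compose clinear_resolvent w T)
  fix a b :: 'a
  define y where "y = b - w *\<^sub>C a"
  have eq: "b - z *\<^sub>C a = y + (w - z) *\<^sub>C a"
    by (simp add: y_def complex_vector.scale_left_diff_distrib)
  show "(a, b) \<in> A \<longleftrightarrow> blinfun_apply (resolvent A w o\<^sub>L T) (b - z *\<^sub>C a) = a"
  proof
    assume "(a, b) \<in> A"
    then have a: "resolvent A w y = a"
      by (simp add: y_def resolvent_iff[OF w])
    then show "blinfun_apply (resolvent A w o\<^sub>L T) (b - z *\<^sub>C a) = a"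
      using T(2)[of y] by (simp add: eq)
  next
    assume a: "blinfun_apply (resolvent A w o\<^sub>L T) (b - z *\<^sub>C a) = a"
    then have "T (b - z *\<^sub>C a) = y"
      using T(3)[of "b - z *\<^sub>C a"] by (simp add: eq)
    then show "(a, b) \<in> A"
      using a by (simp add: resolvent_iff[OF w] y_def)
  qed
qed

lemma resolvent_ball:
  assumes w: "w \<in> resolvent_set A" and z: "cmod (z - w) * norm (resolvent A w) < 1"
  shows "z \<in> resolvent_set A"
proof -
  have "norm ((w - z) *\<^sub>C resolvent A w) < 1"
    using z by (simp add: norm_scaleC norm_minus_commute)
  then obtain T where "clinear_op T" "\<And>x. blinfun_apply T (x + ((w - z) *\<^sub>C resolvent A w) x) = x"
    "\<And>x. blinfun_apply T x + ((w - z) *\<^sub>C resolvent A w) (blinfun_apply T x) = x"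
    using Neumann_inverse[OF clinear_op_scaleC[OF clinear_resolvent[OF w]]] by blast
  then show ?thesis
    by (intro resolvent_shift[OF w, of T]) (simp_all add: blinfun_scaleC)
qed

lemma open_resolvent_set: "open (resolvent_set A)"
  unfolding open_dist
proof (intro ballI)
  fix w assume w: "w \<in> resolvent_set A"
  have "z \<in> resolvent_set A" if "dist z w < 1 / (norm (resolvent A w) + 1)" for z
  proof (rule resolvent_ball[OF w])
    have "0 < norm (resolvent A w) + 1"
      by (simp add: add_nonneg_pos)
    then have "cmod (z - w) * (norm (resolvent A w) + 1) < 1"
      using that by (simp only: dist_norm pos_less_divide_eq)
    moreover have "cmod (z - w) * (norm (resolvent A w) + 1) = cmod (z - w) * norm (resolvent A w) + cmod (z - w)"
      by (simp add: distrib_left)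
    ultimately show "cmod (z - w) * norm (resolvent A w) < 1"
      using norm_ge_zero[of "z - w"] by linarith
  qed
  moreover have "0 < 1 / (norm (resolvent A w) + 1)"
    by (simp add: add_nonneg_pos)
  ultimately show "\<exists>e>0. \<forall>z. dist z w < e \<longrightarrow> z \<in> resolvent_set A"
    by blast
qed

lemma has_cderivative_resolvent:
  assumes w: "w \<in> resolvent_set A"
  shows "has_cderivative (resolvent A) (resolvent A w o\<^sub>L resolvent A w) (at w)"
proof (rule has_cderivative_quadratic)
  define r where "r = norm (resolvent A w)"
  have "\<forall>\<^sub>F z in at w. z \<in> resolvent_set A"
    using open_resolvent_set w by (rule eventually_at_in_open')
  \<comment> \<open>Within this radius \<open>cmod (z - w) * r\<close> is at most 1 / 2, so the
    resolvent identity can be solved for the bound \<open>2 * r\<close> on the resolvent at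
    \<open>z\<close>; the remainder of second order then has the constant
    \<open>2 * r ^ 3\<close>.\<close>
  moreover have "\<forall>\<^sub>F z in at w. dist z w < 1 / (2 * (r + 1))"
    unfolding eventually_at by (rule exI[of _ "1 / (2 * (r + 1))"]) (simp add: r_def add_nonneg_pos)
  ultimately show "\<forall>\<^sub>F z in at w. norm (resolvent A z - resolvent A w - (z - w) *\<^sub>C (resolvent A w o\<^sub>L resolvent A w))
      \<le> 2 * r ^ 3 * (cmod (z - w))\<^sup>2"
  proof eventually_elim
    case (elim z)
    let ?R = "resolvent A w" and ?S = "resolvent A z"
    have id: "?S = ?R + (z - w) *\<^sub>C (?S o\<^sub>L ?R)"
      by (intro blinfun_eqI)
        (simp add: blinfun.add_left blinfun_scaleC resolvent_identity[OF elim(1) w, symmetric])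
    have "cmod (z - w) * r \<le> 1 / 2"
    proof -
      have "0 < 2 * (r + 1)"
        by (simp add: r_def add_nonneg_pos)
      then have "cmod (z - w) * (2 * (r + 1)) < 1"
        using elim(2) by (simp only: dist_norm pos_less_divide_eq)
      moreover have "cmod (z - w) * (2 * (r + 1)) = 2 * (cmod (z - w) * r) + 2 * cmod (z - w)"
        by (simp add: algebra_simps)
      ultimately show ?thesis
        using norm_ge_zero[of "z - w"] by linarith
    qed
    have "norm ?S \<le> r + cmod (z - w) * (norm ?S * r)"
      unfolding r_def
      by (subst (1) id) (intro order_trans[OF norm_triangle_ineq] add_left_mono,
        simp add: norm_scaleC norm_blinfun_compose mult_left_mono)
    also have "\<dots> = r + (cmod (z - w) * r) * norm ?S"
      by simp
    also have "\<dots> \<le> r + 1 / 2 * norm ?S"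
      using \<open>cmod (z - w) * r \<le> 1 / 2\<close> by (intro add_left_mono mult_right_mono) auto
    finally have S: "norm ?S \<le> 2 * r"
      by simp
    have diff: "?S - ?R - (z - w) *\<^sub>C (?R o\<^sub>L ?R) = (z - w) *\<^sub>C ((?S - ?R) o\<^sub>L ?R)"
      by (subst (1) id) (simp add: bounded_bilinear.diff_left[OF bounded_bilinear_blinfun_compose]
          complex_vector.scale_right_diff_distrib)
    have "?S - ?R = (z - w) *\<^sub>C (?S o\<^sub>L ?R)"
      using id by (simp add: diff_eq_eq add.commute)
    then have "norm (?S - ?R - (z - w) *\<^sub>C (?R o\<^sub>L ?R)) =
        cmod (z - w) * norm (((z - w) *\<^sub>C (?S o\<^sub>L ?R)) o\<^sub>L ?R)"
      unfolding diff norm_scaleC by (rule arg_cong)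
    also have "\<dots> \<le> cmod (z - w) * ((cmod (z - w) * (2 * r * r)) * r)"
    proof (intro mult_left_mono order_trans[OF norm_blinfun_compose])
      have "norm ((z - w) *\<^sub>C (?S o\<^sub>L ?R)) \<le> cmod (z - w) * (2 * r * r)"
        unfolding norm_scaleC using S
        by (intro mult_left_mono order_trans[OF norm_blinfun_compose]) (auto simp: r_def intro: mult_right_mono)
      then show "norm ((z - w) *\<^sub>C (?S o\<^sub>L ?R)) * norm ?R \<le> (cmod (z - w) * (2 * r * r)) * r"
        unfolding r_def[symmetric] by (rule mult_right_mono) (simp add: r_def)
    qed simp
    finally show ?case
      by (simp add: power2_eq_square power3_eq_cube mult_ac)
  qed
qed

lemma nontrivial_solution:
  fixes M :: "'l \<Rightarrow> 'e \<Rightarrow> complex"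
  assumes "finite E" "finite F" "card E < card F"
  shows "\<exists>c. (\<exists>l\<in>F. c l \<noteq> 0) \<and> (\<forall>e\<in>E. (\<Sum>l\<in>F. c l * M l e) = 0)"
  using assms
proof (induction E arbitrary: F M)
  case empty
  then have "F \<noteq> {}"
    by auto
  then show ?case
    by (intro exI[of _ "\<lambda>_. 1"]) auto
next
  case (insert e E)
  show ?case
  proof (cases "\<forall>l\<in>F. M l e = 0")
    case True
    have "card E < card F"
      using insert.prems insert.hyps by simp
    then obtain c where "\<exists>l\<in>F. c l \<noteq> 0" "\<forall>e\<in>E. (\<Sum>l\<in>F. c l * M l e) = 0"
      using insert.IH insert.prems(1) by blast
    then show ?thesis
      using True by (intro exI[of _ c]) auto
  next
    case False
    then obtain k where k: "k \<in> F" "M k e \<noteq> 0"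
      by blast
    \<comment> \<open>Gaussian elimination of the unknown \<open>k\<close> by the equation
      \<open>e\<close>: the system \<open>N\<close> in the other unknowns has a nontrivial solution
      by induction, and the equation \<open>e\<close> then determines \<open>d k\<close>.\<close>
    define N where "N l e' = M l e' - M l e / M k e * M k e'" for l e'
    have F: "finite (F - {k})" "card E < card (F - {k})"
      using insert.prems insert.hyps k(1) by simp_all
    obtain c where c: "\<exists>l\<in>F - {k}. c l \<noteq> 0" "\<forall>e\<in>E. (\<Sum>l\<in>F - {k}. c l * N l e) = 0"
      using insert.IH[OF F, of N] by blast
    define d where "d = c(k := - (\<Sum>l\<in>F - {k}. c l * (M l e / M k e)))"
    have dk: "d k = - (\<Sum>l\<in>F - {k}. c l * (M l e / M k e))"
      by (simp add: d_def)
    have sum: "(\<Sum>l\<in>F. d l * M l e') = (\<Sum>l\<in>F - {k}. c l * N l e')" for e'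
    proof -
      have "(\<Sum>l\<in>F - {k}. d l * M l e') = (\<Sum>l\<in>F - {k}. c l * M l e')"
        by (rule sum.cong) (auto simp: d_def)
      then have "(\<Sum>l\<in>F. d l * M l e') = d k * M k e' + (\<Sum>l\<in>F - {k}. c l * M l e')"
        using insert.prems(1) k(1) by (simp add: sum.remove[of F k])
      then show ?thesis
        using dk by (simp add: N_def sum_subtractf sum_distrib_left right_diff_distrib mult_ac)
    qed
    have "N l e = 0" for l
      using k(2) by (simp add: N_def)
    then have "(\<Sum>l\<in>F. d l * M l e) = 0"
      by (simp add: sum)
    then show ?thesis
      using c sum by (intro exI[of _ d]) (auto simp: d_def)
  qed
qed

section \<open>Nonreal spectrum of a self-adjoint relation\<close>

locale self_adjoint = pontryagin ip for ip :: "'a::complex_banach \<Rightarrow> 'a \<Rightarrow> complex" +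
  fixes A :: "('a \<times> 'a) set"
  assumes self_adjoint: "self_adjoint_rel ip A"
begin

lemma mem_iff: "(u, u') \<in> A \<longleftrightarrow> (\<forall>a b. (a, b) \<in> A \<longrightarrow> ip b u = ip a u')"
  using self_adjoint unfolding self_adjoint_rel_def rel_adjoint_def by blast

lemma symmetric: "(a, b) \<in> A \<Longrightarrow> (a', b') \<in> A \<Longrightarrow> ip b a' = ip a b'"
  using mem_iff by blast

lemma Im_form_zero:
  assumes "(a, b) \<in> A"
  shows "Im (ip b a) = 0"
  using symmetric[OF assms assms] commute[of a b] by (simp add: complex_eq_iff)

text \<open>Membership in \<open>A\<close> is tested against all elements of \<open>A\<close>, and
  these are parametrised by the resolvent at \<open>z\<close>. Moving that resolvent across
  \<open>ip\<close> turns the test into the graph condition for its adjoint at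
  \<open>cnj z\<close>.\<close>

lemma
  assumes z: "z \<in> resolvent_set A"
  shows cnj_resolvent_set: "cnj z \<in> resolvent_set A"
    and resolvent_adjoint: "ip (resolvent A z x) y = ip x (resolvent A (cnj z) y)"
proof -
  define S where "S = form_adjoint ip ip (resolvent A z)"
  have S: "ip (resolvent A z x) y = ip x (S y)" "clinear_op S" for x y
    unfolding S_def by (rule form_adjoint[OF pontryagin_axioms pontryagin_axioms clinear_resolvent[OF z]])+
  have iff: "(u, u') \<in> A \<longleftrightarrow> S (u' - cnj z *\<^sub>C u) = u" for u u'
  proof -
    have "(u, u') \<in> A \<longleftrightarrow> (\<forall>y. ip (y + z *\<^sub>C resolvent A z y) u = ip (resolvent A z y) u')"
      unfolding mem_iff[of u] using resolvent_mem[OF z] resolvent_iff[OF z]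
      by (metis diff_add_cancel)
    also have "\<dots> \<longleftrightarrow> (\<forall>y. ip y u = ip y (S (u' - cnj z *\<^sub>C u)))"
      by (simp add: S(1)[symmetric] form_simps eq_diff_eq)
    also have "\<dots> \<longleftrightarrow> S (u' - cnj z *\<^sub>C u) = u"
      using ext_right by metis
    finally show ?thesis .
  qed
  show "cnj z \<in> resolvent_set A"
    by (rule resolvent_setI[OF S(2) iff])
  have "resolvent A (cnj z) = S"
    by (rule resolvent_setI[OF S(2) iff])
  then show "ip (resolvent A z x) y = ip x (resolvent A (cnj z) y)"
    by (simp add: S(1))
qed

text \<open>Because \<open>ip b a\<close> is real on \<open>A\<close>, the resolvents at
  \<open>z\<close> and \<open>cnj z\<close> meet the dissipative and the accretive condition with
  equality, and \<open>dissipative_resolvent\<close> can be used at the centre \<open>l = c\<close>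
  itself.\<close>

lemma resolvent_set_of_no_eigenvalue:
  assumes z: "z \<in> resolvent_set A" and c: "0 < Im c"
    and no: "\<And>x. (x, c *\<^sub>C x) \<in> A \<Longrightarrow> x = 0" "\<And>x. (x, cnj c *\<^sub>C x) \<in> A \<Longrightarrow> x = 0"
  shows "c \<in> resolvent_set A"
proof -
  have z': "cnj z \<in> resolvent_set A"
    by (rule cnj_resolvent_set[OF z])
  have inj: "y = 0" if w: "w \<in> resolvent_set A" and d: "\<And>x. (x, d *\<^sub>C x) \<in> A \<Longrightarrow> x = 0"
    and y: "y + (w - d) *\<^sub>C resolvent A w y = 0" for w d y
  proof -
    have "y + w *\<^sub>C resolvent A w y = d *\<^sub>C resolvent A w y"
      using y by (simp add: complex_vector.scale_left_diff_distrib add_diff_eq)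
    then have "resolvent A w y = 0"
      using resolvent_mem[OF w, of y] by (intro d) simp
    then show ?thesis
      using y by simp
  qed
  have "Im (ip (y + w *\<^sub>C resolvent A w y) (resolvent A w y)) = 0" if "w \<in> resolvent_set A" for w y
    by (rule Im_form_zero[OF resolvent_mem[OF that]])
  note Im0 = this[OF z] this[OF z']
  have inj0: "y = 0" if "y + (z - c) *\<^sub>C resolvent A z y = 0" for y
    by (rule inj[OF z no(1)]) (use that in simp_all)
  have inj': "y = 0" if "y + cnj (z - c) *\<^sub>C resolvent A (cnj z) y = 0" for y
    by (rule inj[OF z' no(2)]) (use that in simp_all)
  have "\<exists>T. clinear_op T \<and> (\<forall>y. blinfun_apply T (y + (z - c) *\<^sub>C resolvent A z y) = y) \<and>
      (\<forall>y. blinfun_apply T y + (z - c) *\<^sub>C resolvent A z (blinfun_apply T y) = y)"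
  proof (rule dissipative_resolvent[OF resolvent_adjoint[OF z] clinear_resolvent[OF z]
      clinear_resolvent[OF z'] eq_refl[OF Im0(1)] eq_refl[OF Im0(2)[symmetric]], of c])
    fix \<epsilon> k :: real
    assume "0 < \<epsilon>" and "\<And>l. cmod (l - c) < \<epsilon> \<Longrightarrow> 0 < Im l \<Longrightarrow> \<exists>T. clinear_op T \<and>
      (\<forall>y. blinfun_apply T (y + (z - l) *\<^sub>C resolvent A z y) = y) \<and>
      (\<forall>y. blinfun_apply T y + (z - l) *\<^sub>C resolvent A z (blinfun_apply T y) = y) \<and>
      (\<forall>y. k * min 1 (Im l) * norm (resolvent A z (blinfun_apply T y)) \<le> norm y)"
    from this(2)[of c] this(1) c show "\<exists>T. clinear_op T \<and> (\<forall>y. blinfun_apply T (y + (z - c) *\<^sub>C resolvent A z y) = y) \<and>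
      (\<forall>y. blinfun_apply T y + (z - c) *\<^sub>C resolvent A z (blinfun_apply T y) = y)"
      by auto
  qed (fact inj0, fact inj')
  then obtain T where "clinear_op T" "\<And>y. blinfun_apply T (y + (z - c) *\<^sub>C resolvent A z y) = y"
    "\<And>y. blinfun_apply T y + (z - c) *\<^sub>C resolvent A z (blinfun_apply T y) = y"
    by blast
  then show ?thesis
    by (rule resolvent_shift[OF z])
qed

text \<open>The usual elimination of one eigenvector, carried out for the operator
  \<open>resolvent A z\<close> with the eigenvalues \<open>inverse (l - z)\<close>, since
  \<open>A\<close> is only a relation.\<close>

lemma eigenvectors_independent:
  assumes z: "z \<in> resolvent_set A"
  shows "finite F \<Longrightarrow> (\<And>l. l \<in> F \<Longrightarrow> (x l, l *\<^sub>C x l) \<in> A) \<Longrightarrow> (\<And>l. l \<in> F \<Longrightarrow> x l \<noteq> 0) \<Longrightarrow>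
    (\<Sum>l\<in>F. c l *\<^sub>C x l) = 0 \<Longrightarrow> \<forall>l\<in>F. c l = 0"
proof (induction F arbitrary: c rule: finite_induct)
  case empty
  show ?case
    by simp
next
  case (insert k F)
  let ?R = "resolvent A z"
  have mu: "l \<noteq> z \<and> ?R (x l) = inverse (l - z) *\<^sub>C x l" if "l \<in> insert k F" for l
  proof -
    have "?R (l *\<^sub>C x l - z *\<^sub>C x l) = x l"
      using insert.prems(1)[OF that] by (simp add: resolvent_iff[OF z])
    then have eq: "(l - z) *\<^sub>C ?R (x l) = x l"
      by (simp add: blinfun.diff_right clinear_opD[OF clinear_resolvent[OF z]] complex_vector.scale_left_diff_distrib)
    then have "l \<noteq> z"
      using insert.prems(2)[OF that] by auto
    then show ?thesis
      by (subst (2) eq[symmetric]) (simp add: scaleC_scaleC)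
  qed
  have sum0: "c k *\<^sub>C x k + (\<Sum>l\<in>F. c l *\<^sub>C x l) = 0"
    using insert.prems(3) insert.hyps by simp
  have "?R (c k *\<^sub>C x k + (\<Sum>l\<in>F. c l *\<^sub>C x l)) =
      c k *\<^sub>C inverse (k - z) *\<^sub>C x k + (\<Sum>l\<in>F. c l *\<^sub>C inverse (l - z) *\<^sub>C x l)"
    using mu by (simp add: blinfun.add_right blinfun.sum_right clinear_opD[OF clinear_resolvent[OF z]])
  then have "c k *\<^sub>C inverse (k - z) *\<^sub>C x k + (\<Sum>l\<in>F. c l *\<^sub>C inverse (l - z) *\<^sub>C x l) = 0"
    by (simp add: sum0)
  moreover have "inverse (k - z) *\<^sub>C (c k *\<^sub>C x k + (\<Sum>l\<in>F. c l *\<^sub>C x l)) = 0"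
    by (simp add: sum0)
  ultimately have "(\<Sum>l\<in>F. c l *\<^sub>C inverse (l - z) *\<^sub>C x l) - inverse (k - z) *\<^sub>C (\<Sum>l\<in>F. c l *\<^sub>C x l) = 0"
    by (simp add: scaleC_add_right scaleC_scaleC mult.commute add_eq_0_iff)
  moreover have "(\<Sum>l\<in>F. (c l * (inverse (l - z) - inverse (k - z))) *\<^sub>C x l) =
      (\<Sum>l\<in>F. c l *\<^sub>C inverse (l - z) *\<^sub>C x l) - inverse (k - z) *\<^sub>C (\<Sum>l\<in>F. c l *\<^sub>C x l)"
    by (simp add: complex_vector.scale_sum_right sum_subtractf complex_vector.scale_left_diff_distrib
        right_diff_distrib mult.commute)
  ultimately have "(\<Sum>l\<in>F. (c l * (inverse (l - z) - inverse (k - z))) *\<^sub>C x l) = 0"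
    by (simp only:)
  then have *: "\<forall>l\<in>F. c l * (inverse (l - z) - inverse (k - z)) = 0"
    using insert.prems by (intro insert.IH) auto
  have F: "\<forall>l\<in>F. c l = 0"
  proof
    fix l assume l: "l \<in> F"
    have "inverse (l - z) \<noteq> inverse (k - z)"
      using l insert.hyps(2) mu by auto
    then show "c l = 0"
      using * l by auto
  qed
  then have "c k = 0"
    using sum0 insert.prems(2)[of k] by simp
  then show ?case
    using F by simp
qed

text \<open>Eigenvectors for eigenvalues in one of the open half-planes span a neutral subspace, whose
  dimension is at most the index of negativity.\<close>

lemma finite_eigenvalues:
  assumes z: "z \<in> resolvent_set A" and s: "s \<noteq> 0"
  shows "finite {l. 0 < s * Im l \<and> (\<exists>x. x \<noteq> 0 \<and> (x, l *\<^sub>C x) \<in> A)}" (is "finite ?L")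
proof (rule ccontr)
  assume inf: "infinite ?L"
  obtain E a where E: "finite E" and a: "0 < a"
    and G: "\<And>x. a * (norm x)\<^sup>2 \<le> Re (ip x x) + 2 * (\<Sum>e\<in>E. (cmod (ip x e))\<^sup>2)"
    using Garding by blast
  obtain F where F: "F \<subseteq> ?L" "finite F" "card F = Suc (card E)"
    using infinite_arbitrarily_large[OF inf] by blast
  have "\<exists>x. x \<noteq> 0 \<and> (x, l *\<^sub>C x) \<in> A" if "l \<in> F" for l
    using F(1) that by blast
  then obtain x where x: "\<And>l. l \<in> F \<Longrightarrow> x l \<noteq> 0" "\<And>l. l \<in> F \<Longrightarrow> (x l, l *\<^sub>C x l) \<in> A"
    by metis
  \<comment> \<open>There are more vectors than functionals in \<open>Garding\<close>, so a
    nontrivial combination is annihilated by all of them; being neutral, it must vanish.\<close>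
  obtain c where c: "\<exists>l\<in>F. c l \<noteq> 0" "\<forall>e\<in>E. (\<Sum>l\<in>F. c l * ip (x l) e) = 0"
    using nontrivial_solution[OF E F(2), of "\<lambda>l e. ip (x l) e"] F(3) by auto
  have orth: "ip (x l) (x m) = 0" if "l \<in> F" "m \<in> F" for l m
  proof -
    have "(l - cnj m) * ip (x l) (x m) = 0"
      using symmetric[OF x(2)[OF that(1)] x(2)[OF that(2)]] by (simp add: form_simps left_diff_distrib)
    moreover have "0 < s * Im (l - cnj m)"
      using F(1) that by (auto simp: distrib_left intro!: add_pos_pos)
    then have "l - cnj m \<noteq> 0"
      by (metis less_irrefl mult_zero_right zero_complex.sel(2))
    ultimately show ?thesis
      by simp
  qed
  define y where "y = (\<Sum>l\<in>F. c l *\<^sub>C x l)"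
  have "ip y y = 0"
    by (simp add: y_def sum_left sum_right form_simps orth)
  moreover have "ip y e = 0" if "e \<in> E" for e
    using c(2) that by (simp add: y_def sum_left scale_left)
  ultimately have "a * (norm y)\<^sup>2 \<le> 0"
    using G[of y] by simp
  then have "y = 0"
    using a by (simp add: mult_le_0_iff)
  then have "\<forall>l\<in>F. c l = 0"
    unfolding y_def by (intro eigenvectors_independent[OF z F(2), of x c] x)
  then show False
    using c(1) by blast
qed

text \<open>Each open half-plane contains finitely many eigenvalues, so some disc about \<omega> has
  an upper half free of eigenvalues and of conjugates of eigenvalues.\<close>

lemma resolvent_set_near_real:
  assumes z: "z \<in> resolvent_set A"
  obtains r where "0 < r" "\<And>l. 0 < Im l \<Longrightarrow> cmod (l - of_real \<omega>) < r \<Longrightarrow> l \<in> resolvent_set A"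
proof -
  define L where "L s = {l. 0 < s * Im l \<and> (\<exists>x. x \<noteq> 0 \<and> (x, l *\<^sub>C x) \<in> A)}" for s
  have "finite (L 1 \<union> cnj ` L (-1))"
    unfolding L_def by (intro finite_UnI finite_imageI finite_eigenvalues[OF z]) simp_all
  then obtain r where r: "0 < r"
    "\<And>l. l \<in> L 1 \<union> cnj ` L (-1) \<Longrightarrow> l \<noteq> of_real \<omega> \<Longrightarrow> r \<le> dist (of_real \<omega>) l"
    using finite_set_avoid by metis
  have "l \<in> resolvent_set A" if l: "0 < Im l" "cmod (l - of_real \<omega>) < r" for l
  proof -
    have "l \<noteq> of_real \<omega>"
      using l(1) by auto
    then have notin: "l \<notin> L 1" "l \<notin> cnj ` L (-1)"
      using r(2)[of l] l(2) by (auto simp: dist_norm norm_minus_commute)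
    have "x = 0" if "(x, l *\<^sub>C x) \<in> A" for x
      using notin(1) that l(1) by (auto simp: L_def)
    moreover have "x = 0" if "(x, cnj l *\<^sub>C x) \<in> A" for x
    proof -
      have "cnj l \<notin> L (-1)"
        using notin(2) by (metis complex_cnj_cnj imageI)
      then show ?thesis
        using that l(1) by (auto simp: L_def)
    qed
    ultimately show ?thesis
      by (rule resolvent_set_of_no_eigenvalue[OF z l(1)])
  qed
  then show ?thesis
    by (rule that[OF r(1)])
qed

end

section \<open>Poles\<close>

lemma vpole_eventually_holomorphic:
  assumes "vpole F z"
  shows "\<forall>\<^sub>F w in at z. vholomorphic_at F w"
proof -
  obtain n H where H: "vholomorphic_at H z" and ev: "\<forall>\<^sub>F w in at z. F w = inverse ((w - z) ^ n) *\<^sub>C H w"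
    using assms unfolding vpole_def by blast
  obtain U where U: "open U" "z \<in> U" "vholomorphic_on H U"
    using H unfolding vholomorphic_at_def by blast
  obtain V where V: "open V" "z \<in> V" "\<And>w. w \<in> V \<Longrightarrow> w \<noteq> z \<Longrightarrow> F w = inverse ((w - z) ^ n) *\<^sub>C H w"
    using ev unfolding eventually_at_topological by blast
  define S where "S = (U \<inter> V) - {z}"
  have S: "open S"
    unfolding S_def using U V by (intro open_Diff open_Int) auto
  have "vholomorphic_on F S"
  proof (rule vholomorphic_onI)
    fix w assume w: "w \<in> S"
    then obtain D where D: "has_cderivative H D (at w)"
      using vholomorphic_onD[OF U(3,1)] by (auto simp: S_def)
    have "w - z \<noteq> 0"
      using w by (auto simp: S_def)
    then have c: "((\<lambda>w. inverse ((w - z) ^ n)) has_field_derivative deriv (\<lambda>w. inverse ((w - z) ^ n)) w) (at w)"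
      by (intro DERIV_deriv_iff_field_differentiable[THEN iffD2] derivative_intros) auto
    have "has_cderivative F (inverse ((w - z) ^ n) *\<^sub>C D + deriv (\<lambda>w. inverse ((w - z) ^ n)) w *\<^sub>C H w) (at w)"
      by (rule has_cderivative_transform[OF has_cderivative_scaleC[OF c D] S w]) (auto simp: S_def V(3))
    then show "\<exists>D. has_cderivative F D (at w)"
      by (rule exI)
  qed
  then have "vholomorphic_at F w" if "w \<in> U \<inter> V" "w \<noteq> z" for w
    unfolding vholomorphic_at_def using S that by (intro exI[of _ S]) (auto simp: S_def)
  then show ?thesis
    unfolding eventually_at_topological using U V by (intro exI[of _ "U \<inter> V"]) auto
qed

text \<open>After multiplication by \<open>(w - z) ^ n\<close> with \<open>n > 0\<close>, the
  nonzero value \<open>H z\<close> would be the limit of a function that tends to 0.\<close>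

lemma vpole_not_continuous:
  assumes "vpole F z" "isCont G z"
  shows "\<not> (\<forall>\<^sub>F w in at z. F w = G w)"
proof
  assume FG: "\<forall>\<^sub>F w in at z. F w = G w"
  obtain n H where n: "0 < n" and H: "vholomorphic_at H z" "H z \<noteq> 0"
    and ev: "\<forall>\<^sub>F w in at z. F w = inverse ((w - z) ^ n) *\<^sub>C H w"
    using assms(1) unfolding vpole_def by blast
  obtain D where "has_cderivative H D (at z)"
    using H(1) vholomorphic_onD unfolding vholomorphic_at_def by metis
  then have Hc: "(H \<longlongrightarrow> H z) (at z)"
    using has_cderivative_isCont isContD by blast
  have "((\<lambda>w. (w - z) ^ n *\<^sub>C G w) \<longlongrightarrow> (z - z) ^ n *\<^sub>C G z) (at z)"
    by (intro tendsto_scaleC tendsto_intros isContD assms(2))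
  moreover have "\<forall>\<^sub>F w in at z. (w - z) ^ n *\<^sub>C G w = H w"
    using FG ev eventually_neq_at_within[of z]
    by eventually_elim (metis (no_types) complex_vector.scale_scale eq_iff_diff_eq_0 power_not_zero right_inverse scaleC_one)
  ultimately have "(H \<longlongrightarrow> (z - z) ^ n *\<^sub>C G z) (at z)"
    using tendsto_cong by fast
  then have "H z = (z - z) ^ n *\<^sub>C G z"
    using Hc tendsto_unique trivial_limit_at by blast
  then show False
    using H(2) n by simp
qed

section \<open>Minimal realisations\<close>

locale realisation =
  fixes Q :: "complex \<Rightarrow> ('g::complex_hilbert \<Rightarrow>\<^sub>L 'g)"
    and ip :: "'p::complex_banach \<Rightarrow> 'p \<Rightarrow> complex"
    and A :: "('p \<times> 'p) set"
    and \<gamma> :: "'g \<Rightarrow>\<^sub>L 'p"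
    and z0 :: complex
  assumes Q: "Q \<in> generalised_nevanlinna"
    and realisation: "minimal_realisation Q ip A \<gamma> z0"

sublocale realisation \<subseteq> self_adjoint ip A
  using realisation
  by (auto simp: minimal_realisation_def self_adjoint_def self_adjoint_axioms_def pontryagin_def)

sublocale realisation \<subseteq> G: pontryagin "cinner :: 'g \<Rightarrow> 'g \<Rightarrow> complex"
  by (rule pontryagin_cinner)

context realisation
begin

abbreviation R :: "complex \<Rightarrow> 'p \<Rightarrow>\<^sub>L 'p" where "R \<equiv> resolvent A"
abbreviation \<rho> :: "complex set" where "\<rho> \<equiv> resolvent_set A"
abbreviation gp :: "'p \<Rightarrow>\<^sub>L 'g" where "gp \<equiv> form_adjoint cinner ip \<gamma>"
abbreviation Q0 :: "'g \<Rightarrow>\<^sub>L 'g" where "Q0 \<equiv> cadjoint (Q z0)"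

definition gam :: "complex \<Rightarrow> 'g \<Rightarrow> 'p" where
  "gam z x = \<gamma> x + (z - z0) *\<^sub>C R z (\<gamma> x)"

text \<open>The right-hand side of the realisation formula as a function on the whole resolvent set.
  Equality with \<open>Q\<close> is assumed only on \<open>hdom Q\<close>; at real points of the
  resolvent set \<open>W\<close> is the holomorphic continuation of \<open>Q\<close>.\<close>

definition W :: "complex \<Rightarrow> 'g \<Rightarrow>\<^sub>L 'g" where
  "W z = Q0 + (z - cnj z0) *\<^sub>C (gp o\<^sub>L (id_blinfun + (z - z0) *\<^sub>C R z) o\<^sub>L \<gamma>)"

lemma clinear_\<gamma>: "clinear_op \<gamma>"
  using realisation by (simp add: minimal_realisation_def)

lemma z0: "z0 \<in> \<rho>" "0 < Im z0" "z0 \<in> hdom Q"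
  using realisation by (auto simp: minimal_realisation_def upper_half_plane_def)

lemma z0_not_real: "z0 \<notin> \<real>"
  using z0(2) by (auto simp: complex_is_Real_iff)

lemma of_real_neq_z0: "complex_of_real \<omega> - cnj z0 \<noteq> 0" "complex_of_real \<omega> - z0 \<noteq> 0"
  using z0(2) by (auto simp: complex_eq_iff)

lemma adj: "ip (\<gamma> x) y = cinner x (gp y)" "ip y (\<gamma> x) = cinner (gp y) x"
proof -
  show *: "ip (\<gamma> x) y = cinner x (gp y)"
    by (rule form_adjoint[OF G.pontryagin_axioms pontryagin_axioms clinear_\<gamma>])
  show "ip y (\<gamma> x) = cinner (gp y) x"
    using * commute[of "\<gamma> x" y] cinner_commute[of x "gp y"] by (metis complex_cnj_cnj commute)
qed

lemma clinear_gp: "clinear_op gp"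
  by (rule form_adjoint[OF G.pontryagin_axioms pontryagin_axioms clinear_\<gamma>])

lemma holomorphic_z0: "vholomorphic_at Q z0"
  using z0(3) z0_not_real by (simp add: hdom_def)

lemma clinear_Q: "clinear_op (Q z0)"
  using Q holomorphic_z0 z0_not_real by (auto simp: generalised_nevanlinna_def nevanlinna_class_def)

lemma Q0_adj: "cinner (Q z0 x) y = cinner x (Q0 y)"
  unfolding cadjoint_def by (rule form_adjoint[OF G.pontryagin_axioms G.pontryagin_axioms clinear_Q])

lemma W_apply: "W z x = Q0 x + (z - cnj z0) *\<^sub>C gp (gam z x)"
  by (simp add: W_def gam_def blinfun.add_left blinfun_scaleC)

lemma hext_eq_W: "z \<in> hdom Q \<Longrightarrow> z \<in> \<rho> \<Longrightarrow> hext Q z = W z"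
  using realisation unfolding minimal_realisation_def W_def by blast

lemma Q_z0: "Q z0 x = Q0 x + (z0 - cnj z0) *\<^sub>C gp (\<gamma> x)"
  using hext_eq_W[OF z0(3,1)] z0_not_real W_apply[of z0 x] by (simp add: hext_def gam_def)

lemma has_cderivative_W:
  assumes "z \<in> \<rho>"
  shows "\<exists>D. has_cderivative W D (at z)"
proof -
  define T where "T B = gp o\<^sub>L B o\<^sub>L \<gamma>" for B
  have T: "bounded_linear T"
    unfolding T_def
    by (intro bounded_linear_compose[OF
        bounded_bilinear.bounded_linear_left[OF bounded_bilinear_blinfun_compose, of \<gamma>]
        bounded_bilinear.bounded_linear_right[OF bounded_bilinear_blinfun_compose, of gp]])
  have TC: "T (c *\<^sub>C B) = c *\<^sub>C T B" for c B
    by (intro blinfun_eqI) (simp add: T_def blinfun_scaleC clinear_opD[OF clinear_gp])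
  have "((\<lambda>z. z - z0) has_field_derivative 1) (at z)" "((\<lambda>z. z - cnj z0) has_field_derivative 1) (at z)"
    by (auto intro!: derivative_eq_intros)
  note d = this
  have "\<exists>D. has_cderivative (\<lambda>z. Q0 + (z - cnj z0) *\<^sub>C T (id_blinfun + (z - z0) *\<^sub>C R z)) D (at z)"
    by (rule exI, rule has_cderivative_add[OF has_cderivative_const has_cderivative_scaleC[OF d(2)
        has_cderivative_linear[OF T TC has_cderivative_add[OF has_cderivative_const
        has_cderivative_scaleC[OF d(1) has_cderivative_resolvent[OF assms]]]]]])
  moreover have "W = (\<lambda>z. Q0 + (z - cnj z0) *\<^sub>C T (id_blinfun + (z - z0) *\<^sub>C R z))"
    by (rule ext) (simp add: W_def T_def)
  ultimately show ?thesis
    by metis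
qed

text \<open>A nonreal point is a point of holomorphy or a pole. Around a pole in
  \<open>\<rho>\<close> the function \<open>Q\<close> would be holomorphic and hence equal to
  \<open>W\<close>, which is continuous at the pole. At a real point \<open>W\<close> itself is the
  continuation.\<close>

lemma resolvent_set_subset_hdom: "\<rho> \<subseteq> hdom Q"
proof
  fix z assume z: "z \<in> \<rho>"
  have mero: "vmeromorphic_on Q (- \<real>)"
    using Q by (auto simp: generalised_nevanlinna_def nevanlinna_class_def)
  have nonreal: "w \<in> hdom Q \<and> Q w = W w" if w: "w \<in> \<rho>" "w \<notin> \<real>" for w
  proof -
    have "\<not> vpole Q w"
    proof
      assume pole: "vpole Q w"
      have "\<forall>\<^sub>F v in at w. v \<in> - \<real>"
        using w(2) closed_complex_Reals by (intro eventually_at_in_open') auto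
      moreover have "\<forall>\<^sub>F v in at w. v \<in> \<rho>"
        using open_resolvent_set w(1) by (rule eventually_at_in_open')
      ultimately have "\<forall>\<^sub>F v in at w. Q v = W v"
        using vpole_eventually_holomorphic[OF pole]
      proof eventually_elim
        case (elim v)
        then have "v \<in> hdom Q"
          by (simp add: hdom_def)
        from hext_eq_W[OF this elim(2)] elim(1) show ?case
          by (simp add: hext_def)
      qed
      moreover have "isCont W w"
        using has_cderivative_W[OF w(1)] has_cderivative_isCont by blast
      ultimately show False
        using vpole_not_continuous[OF pole] by blast
    qed
    then have "vholomorphic_at Q w"
      using mero w(2) unfolding vmeromorphic_on_def by blast
    then have "w \<in> hdom Q"
      using w(2) by (simp add: hdom_def)
    with hext_eq_W[OF this w(1)] w(2) show ?thesis
      by (simp add: hext_def)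
  qed
  show "z \<in> hdom Q"
  proof (cases "z \<in> \<real>")
    case True
    obtain r where r: "0 < r" "ball z r \<subseteq> \<rho>"
      using open_resolvent_set z open_contains_ball by blast
    have "vholomorphic_on W (ball z r)"
      using r(2) has_cderivative_W by (intro vholomorphic_onI) blast
    moreover have "\<forall>w\<in>ball z r - \<real>. W w = Q w"
    proof
      fix w assume "w \<in> ball z r - \<real>"
      then have "w \<in> \<rho>" "w \<notin> \<real>"
        using r(2) by auto
      then show "W w = Q w"
        using nonreal by simp
    qed
    ultimately show ?thesis
      using True r(1) unfolding hdom_def by blast
  qed (use nonreal[OF z] in blast)
qed

lemma hext_W: "z \<in> \<rho> \<Longrightarrow> hext Q z = W z"
  using hext_eq_W resolvent_set_subset_hdom by blast

lemma Q_W: "z \<in> \<rho> \<Longrightarrow> z \<notin> \<real> \<Longrightarrow> Q z = W z"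
  using hext_W[of z] by (simp add: hext_def)

text \<open>This makes \<open>gam z x\<close> a defect element: adding
  \<open>(\<gamma> x, z0 *\<^sub>C \<gamma> x)\<close> to this element of \<open>A\<close> gives
  \<open>(gam z x, z *\<^sub>C gam z x)\<close>.\<close>

lemma gam_mem:
  assumes "z \<in> \<rho>"
  shows "(gam z x - \<gamma> x, z *\<^sub>C gam z x - z0 *\<^sub>C \<gamma> x) \<in> A"
proof -
  have "(z - z0) *\<^sub>C \<gamma> x + z *\<^sub>C (gam z x - \<gamma> x) = z *\<^sub>C gam z x - z0 *\<^sub>C \<gamma> x"
    by (simp add: complex_vector.scale_left_diff_distrib complex_vector.scale_right_diff_distrib)
  moreover have "R z ((z - z0) *\<^sub>C \<gamma> x) = gam z x - \<gamma> x"
    by (simp add: gam_def clinear_opD[OF clinear_resolvent[OF assms]])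
  ultimately show ?thesis
    using resolvent_mem[OF assms, of "(z - z0) *\<^sub>C \<gamma> x"] by simp
qed

lemma shifted_mem_iff:
  assumes "z \<in> \<rho>"
  shows "(v - u, l *\<^sub>C v - z0 *\<^sub>C u) \<in> A \<longleftrightarrow> R z ((l - z) *\<^sub>C v + (z - z0) *\<^sub>C u) = v - u"
proof -
  have "l *\<^sub>C v - z0 *\<^sub>C u - z *\<^sub>C (v - u) = (l - z) *\<^sub>C v + (z - z0) *\<^sub>C u"
    by (simp add: complex_vector.scale_left_diff_distrib complex_vector.scale_right_diff_distrib)
  then show ?thesis
    by (simp add: resolvent_iff[OF assms])
qed

lemma gam_eqI:
  assumes "z \<in> \<rho>" "(v - \<gamma> x, z *\<^sub>C v - z0 *\<^sub>C \<gamma> x) \<in> A"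
  shows "v = gam z x"
  using assms(2) unfolding shifted_mem_iff[OF assms(1)]
  by (simp add: gam_def clinear_opD[OF clinear_resolvent[OF assms(1)]] eq_diff_eq add.commute)

text \<open>Symmetry of \<open>A\<close> for the two elements from \<open>gam_mem\<close>; the
  remaining terms in \<open>\<gamma> x\<close> and \<open>\<gamma> y\<close> are accounted for by
  the difference of \<open>Q z0\<close> and its adjoint. Free of division, the identity includes the
  case \<open>z = cnj w\<close>.\<close>

lemma kernel_identity:
  assumes z: "z \<in> \<rho>" and w: "w \<in> \<rho>"
  shows "(z - cnj w) * ip (gam z x) (gam w y) = cinner (W z x) y - cinner x (W w y)"
proof -
  have 1: "ip (z *\<^sub>C gam z x - z0 *\<^sub>C \<gamma> x) (gam w y - \<gamma> y) = ip (gam z x - \<gamma> x) (w *\<^sub>C gam w y - z0 *\<^sub>C \<gamma> y)"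
    by (rule symmetric[OF gam_mem[OF z] gam_mem[OF w]])
  have "cinner x (Q0 y) = cinner (Q z0 x) y"
    by (simp add: Q0_adj)
  also have "\<dots> = cinner (Q0 x) y + (z0 - cnj z0) * ip (\<gamma> x) (\<gamma> y)"
    by (simp add: Q_z0 G.form_simps adj)
  finally have 2: "cinner x (Q0 y) = cinner (Q0 x) y + (z0 - cnj z0) * ip (\<gamma> x) (\<gamma> y)" .
  have 3: "cinner (W z x) y = cinner (Q0 x) y + (z - cnj z0) * ip (gam z x) (\<gamma> y)"
    by (simp add: W_apply G.form_simps adj)
  have 4: "cinner x (W w y) = cinner x (Q0 y) + (cnj w - z0) * ip (\<gamma> x) (gam w y)"
    by (simp add: W_apply G.form_simps adj)
  show ?thesis
    using 1 unfolding 3 4 2 by (simp add: form_simps algebra_simps)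
qed

text \<open>One point \<open>c\<close> may be left out because \<open>gam z x\<close> is continuous
  in \<open>z\<close>. The applications divide by a quantity that vanishes at
  \<open>z = \<omega>\<close>, and \<omega> may belong to \<open>\<rho>\<close>.\<close>

lemma minimal_annihilator:
  assumes "\<And>z x. z \<in> \<rho> \<Longrightarrow> z \<noteq> c \<Longrightarrow> ip (gam z x) u = 0"
  shows "u = 0"
proof (rule nondegenerate)
  have all: "ip (gam z x) u = 0" if z: "z \<in> \<rho>" for z x
  proof (cases "z = c")
    case True
    have "isCont R z"
      using has_cderivative_resolvent[OF z] by (rule has_cderivative_isCont)
    then have "((\<lambda>w. \<gamma> x + (w - z0) *\<^sub>C R w (\<gamma> x)) \<longlongrightarrow> \<gamma> x + (z - z0) *\<^sub>C R z (\<gamma> x)) (at z)"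
      by (intro tendsto_intros tendsto_scaleC blinfun.tendsto isContD)
    then have "((\<lambda>w. ip (gam w x) u) \<longlongrightarrow> ip (gam z x) u) (at z)"
      unfolding gam_def by (rule bounded_linear.tendsto[OF bounded_linear_left])
    moreover have "\<forall>\<^sub>F w in at z. ip (gam w x) u = 0"
      using eventually_at_in_open'[OF open_resolvent_set z] eventually_neq_at_within[of z]
      by eventually_elim (use assms True in auto)
    ultimately have "((\<lambda>w. 0) \<longlongrightarrow> ip (gam z x) u) (at z)"
      using tendsto_cong by fast
    then show ?thesis
      by (simp add: tendsto_const_iff)
  qed (use assms z in blast)
  define S where "S = {y. ip y u = 0}"
  have "closed S"
  proof -
    have "continuous_on UNIV (\<lambda>y. ip y u)"
      by (rule linear_continuous_on[OF bounded_linear_left])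
    then show ?thesis
      unfolding S_def by (intro closed_Collect_eq) auto
  qed
  moreover have "csubspace S"
    by (rule complex_vector.subspaceI) (auto simp: S_def form_simps)
  moreover have "{blinfun_apply (id_blinfun + (z - z0) *\<^sub>C R z) (\<gamma> x) | z x. z \<in> \<rho>} \<subseteq> S"
    using all by (auto simp: S_def gam_def blinfun.add_left blinfun_scaleC)
  ultimately have "closure (cspan {blinfun_apply (id_blinfun + (z - z0) *\<^sub>C R z) (\<gamma> x) | z x. z \<in> \<rho>}) \<subseteq> S"
    by (intro closure_minimal complex_vector.span_minimal)
  then have "S = UNIV"
    using realisation unfolding minimal_realisation_def by auto
  then show "ip y u = 0" for y
    by (auto simp: S_def)
qed

text \<open>Symmetry of \<open>A\<close> gives orthogonality to \<open>gam z x\<close> up to the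
  factor \<open>z - \<omega>\<close>, so \<open>u\<close> is orthogonal to a dense span. The
  condition \<open>gp u = 0\<close> matters: \<open>A\<close> itself may have real
  eigenvalues.\<close>

lemma no_eigenvector:
  assumes u: "(u, complex_of_real \<omega> *\<^sub>C u) \<in> A" "gp u = 0"
  shows "u = 0"
proof (rule minimal_annihilator[of "complex_of_real \<omega>"])
  fix z x assume z: "z \<in> \<rho>" "z \<noteq> complex_of_real \<omega>"
  have "ip (\<gamma> x) u = 0"
    by (simp add: adj u(2))
  then have "(z - of_real \<omega>) * ip (gam z x) u = 0"
    using symmetric[OF gam_mem[OF z(1), of x] u(1)] by (simp add: form_simps left_diff_distrib)
  then show "ip (gam z x) u = 0"
    using z(2) by simp
qed

section \<open>Elements of the Pontryagin space that represent a pair\<close>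

lemma mem_diff: "(a, b) \<in> A \<Longrightarrow> (a', b') \<in> A \<Longrightarrow> (a - a', b - b') \<in> A"
  by (subst mem_iff) (simp add: diff_right symmetric[of _ _ a b] symmetric[of _ _ a' b'])

lemma mem_scale: "(a, b) \<in> A \<Longrightarrow> (c *\<^sub>C a, c *\<^sub>C b) \<in> A"
  by (subst mem_iff) (simp add: scale_right symmetric[of _ _ a b])

text \<open>Eliminating the resolvent at \<open>z0\<close> gives a condition of the shape of
  \<open>gam_mem\<close> with \<omega> in place of \<open>z\<close>: \<open>v\<close> takes the part
  of \<open>gam\<close> at \<omega>, which has no meaning when \<omega> lies outside
  \<open>\<rho>\<close>.\<close>

lemma represents_pair_iff:
  "represents_pair Q ip A \<gamma> z0 \<omega> f0 g0 v \<longleftrightarrow>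
    (v - \<gamma> f0, complex_of_real \<omega> *\<^sub>C v - z0 *\<^sub>C \<gamma> f0) \<in> A \<and>
    g0 = Q0 f0 + (complex_of_real \<omega> - cnj z0) *\<^sub>C gp v"
proof -
  have "(v - \<gamma> f0, complex_of_real \<omega> *\<^sub>C v - z0 *\<^sub>C \<gamma> f0) \<in> A \<longleftrightarrow>
      (complex_of_real \<omega> - z0) *\<^sub>C R z0 v = v - \<gamma> f0"
    unfolding shifted_mem_iff[OF z0(1)] by (simp add: clinear_opD[OF clinear_resolvent[OF z0(1)]])
  also have "\<dots> \<longleftrightarrow> \<gamma> f0 = v + (z0 - complex_of_real \<omega>) *\<^sub>C R z0 v"
    by (auto simp: complex_vector.scale_left_diff_distrib algebra_simps)
  finally show ?thesis
    by (simp add: represents_pair_def blinfun.add_left blinfun_scaleC)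
qed

lemma generalised_value_iff:
  "(f0, g0) \<in> generalised_value Q ip A \<gamma> z0 \<omega> \<longleftrightarrow> (\<exists>v. represents_pair Q ip A \<gamma> z0 \<omega> f0 g0 v)"
proof -
  let ?w = "complex_of_real \<omega>"
  have "(f0, g0) \<in> generalised_value Q ip A \<gamma> z0 \<omega> \<longleftrightarrow>
      (\<exists>u. (u, \<gamma> f0 + ?w *\<^sub>C u) \<in> A \<and> g0 = Q0 f0 + (?w - cnj z0) *\<^sub>C gp (\<gamma> f0 + (?w - z0) *\<^sub>C u))"
  proof -
    have "(u, x) \<in> rel_shift A ?w \<longleftrightarrow> (u, x + ?w *\<^sub>C u) \<in> A" for u x
      by (auto simp: rel_shift_def intro!: exI[of _ "x + ?w *\<^sub>C u"])
    then show ?thesis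
      unfolding generalised_value_def rel_add_def rel_scale_def op_graph_def relcomp_unfold
      by fastforce
  qed
  also have "\<dots> \<longleftrightarrow> (\<exists>v. represents_pair Q ip A \<gamma> z0 \<omega> f0 g0 v)"
  proof
    assume "\<exists>u. (u, \<gamma> f0 + ?w *\<^sub>C u) \<in> A \<and> g0 = Q0 f0 + (?w - cnj z0) *\<^sub>C gp (\<gamma> f0 + (?w - z0) *\<^sub>C u)"
    then obtain u where u: "(u, \<gamma> f0 + ?w *\<^sub>C u) \<in> A"
      "g0 = Q0 f0 + (?w - cnj z0) *\<^sub>C gp (\<gamma> f0 + (?w - z0) *\<^sub>C u)"
      by blast
    \<comment> \<open>\<open>u\<close> is a value at \<open>\<gamma> f0\<close> of the inverse of
      \<open>A\<close> minus \<omega>, and \<open>v\<close> is the corresponding value of the middle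
      factor of the product. The way back divides by \<open>?w - z0\<close>, which is nonzero
      because \<open>z0\<close> is not real.\<close>
    define v where "v = \<gamma> f0 + (?w - z0) *\<^sub>C u"
    have eq: "v - \<gamma> f0 = (?w - z0) *\<^sub>C u" "?w *\<^sub>C v - z0 *\<^sub>C \<gamma> f0 = (?w - z0) *\<^sub>C (\<gamma> f0 + ?w *\<^sub>C u)"
      by (simp_all add: v_def complex_vector.scale_left_diff_distrib complex_vector.scale_right_diff_distrib
          scaleC_add_right algebra_simps)
    have "represents_pair Q ip A \<gamma> z0 \<omega> f0 g0 v"
      unfolding represents_pair_iff eq using mem_scale[OF u(1)] u(2) by (simp add: v_def)
    then show "\<exists>v. represents_pair Q ip A \<gamma> z0 \<omega> f0 g0 v"
      by blast
  next
    assume "\<exists>v. represents_pair Q ip A \<gamma> z0 \<omega> f0 g0 v"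
    then obtain v where v: "(v - \<gamma> f0, ?w *\<^sub>C v - z0 *\<^sub>C \<gamma> f0) \<in> A"
      "g0 = Q0 f0 + (?w - cnj z0) *\<^sub>C gp v"
      unfolding represents_pair_iff by blast
    define u where "u = inverse (?w - z0) *\<^sub>C (v - \<gamma> f0)"
    have vu: "v = \<gamma> f0 + (?w - z0) *\<^sub>C u"
      using of_real_neq_z0(2) by (simp add: u_def)
    have "?w *\<^sub>C v - z0 *\<^sub>C \<gamma> f0 = (?w - z0) *\<^sub>C (\<gamma> f0 + ?w *\<^sub>C u)"
      by (simp add: vu complex_vector.scale_left_diff_distrib complex_vector.scale_right_diff_distrib
          scaleC_add_right algebra_simps)
    then have "inverse (?w - z0) *\<^sub>C (?w *\<^sub>C v - z0 *\<^sub>C \<gamma> f0) = \<gamma> f0 + ?w *\<^sub>C u"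
      using of_real_neq_z0(2) by simp
    with mem_scale[OF v(1), of "inverse (?w - z0)"] have "(u, \<gamma> f0 + ?w *\<^sub>C u) \<in> A"
      by (simp only: u_def)
    then show "\<exists>u. (u, \<gamma> f0 + ?w *\<^sub>C u) \<in> A \<and> g0 = Q0 f0 + (?w - cnj z0) *\<^sub>C gp (\<gamma> f0 + (?w - z0) *\<^sub>C u)"
      using v(2) vu by blast
  qed
  finally show ?thesis .
qed

text \<open>The difference of two representing elements satisfies both conditions of
  \<open>no_eigenvector\<close>.\<close>

lemma represents_pair_unique:
  assumes "represents_pair Q ip A \<gamma> z0 \<omega> f0 g0 v" "represents_pair Q ip A \<gamma> z0 \<omega> f0 g0 v'"
  shows "v = v'"
proof -
  let ?w = "complex_of_real \<omega>"
  have v: "(v - \<gamma> f0, ?w *\<^sub>C v - z0 *\<^sub>C \<gamma> f0) \<in> A" "g0 = Q0 f0 + (?w - cnj z0) *\<^sub>C gp v"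
    and v': "(v' - \<gamma> f0, ?w *\<^sub>C v' - z0 *\<^sub>C \<gamma> f0) \<in> A" "g0 = Q0 f0 + (?w - cnj z0) *\<^sub>C gp v'"
    using assms unfolding represents_pair_iff by blast+
  have "(v - v', ?w *\<^sub>C (v - v')) \<in> A"
    using mem_diff[OF v(1) v'(1)] by (simp add: complex_vector.scale_right_diff_distrib)
  moreover have "(?w - cnj z0) *\<^sub>C gp v = (?w - cnj z0) *\<^sub>C gp v'"
    using v(2) v'(2) by (metis add_left_cancel)
  then have "gp v = gp v'"
    by (rule complex_vector.scale_left_imp_eq[OF of_real_neq_z0(1)])
  then have "gp (v - v') = 0"
    by (simp add: blinfun.diff_right)
  ultimately show ?thesis
    using no_eigenvector[of "v - v'" \<omega>] by simp
qed

text \<open>If \<open>\<gamma> x = 0\<close>, then every \<open>gam z x\<close> vanishes and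
  \<open>W z x\<close> is the constant \<open>Q0 x\<close>, so every kernel with second argument
  \<open>z0\<close> annihilates \<open>x\<close>; at \<open>cnj z0\<close> this concerns the
  derivative of the constant.\<close>

lemma strict_injective:
  assumes "strict_nevanlinna Q A" "\<gamma> x = 0"
  shows "x = 0"
proof -
  have gam0: "gam z x = 0" for z
    by (simp add: gam_def assms(2))
  have "nev_kernel (hext Q) z z0 x = 0" if z: "z \<in> \<rho>" for z
  proof (cases "z = cnj z0")
    case True
    obtain D where D: "has_cderivative W D (at z)"
      using has_cderivative_W[OF z] by blast
    have "has_cderivative (hext Q) D (at z)"
      using has_cderivative_transform[OF D open_resolvent_set z] hext_W by simp
    then have "cderiv (hext Q) z = D"
      by (rule cderiv_eqI)
    moreover have "D x = 0"
    proof -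
      have "has_cderivative (\<lambda>z. W z x) (D x) (at z)"
        by (rule has_cderivative_linear[OF blinfun.bounded_linear_left _ D]) (simp add: blinfun_scaleC)
      then have "has_cderivative (\<lambda>z. Q0 x) (D x) (at z)"
        by (simp add: W_apply gam0)
      from cderiv_eqI[OF this] cderiv_eqI[OF has_cderivative_const] show ?thesis
        by metis
    qed
    ultimately show ?thesis
      using True by (simp add: nev_kernel_def)
  next
    case False
    have "hext Q z0 = Q z0"
      using z0_not_real by (simp add: hext_def)
    then show ?thesis
      using False by (simp add: nev_kernel_def blinfun_scaleC blinfun.diff_left hext_W[OF z] W_apply gam0)
  qed
  then have "x \<in> (\<Inter>z\<in>\<rho>. {x. nev_kernel (hext Q) z z0 x = 0})"
    by simp
  then show ?thesis
    using assms(1) z0(1) unfolding strict_nevanlinna_def by blast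
qed

lemma represents_pair_strict:
  assumes "strict_nevanlinna Q A" and "represents_pair Q ip A \<gamma> z0 \<omega> f0 g0 v"
    "represents_pair Q ip A \<gamma> z0 \<omega> f0' g0' v"
  shows "f0 = f0' \<and> g0 = g0'"
proof -
  have "\<gamma> (f0 - f0') = 0"
    using assms(2,3) by (simp add: represents_pair_def blinfun.diff_right)
  then have "f0 = f0'"
    using strict_injective[OF assms(1)] by fastforce
  then show ?thesis
    using assms(2,3) by (simp add: represents_pair_def)
qed

end

section \<open>Weak limits\<close>

context pontryagin
begin

text \<open>Convergence against a dense set alone does not bound a sequence. Here the finitely many
  functionals of \<open>Garding\<close> are approximated by elements of \<open>S\<close> at a cost
  of \<open>\<delta> * norm (x n)\<close>, which the inequality absorbs.\<close>

lemma eventually_norm_bounded: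
  assumes conv: "\<And>s. s \<in> S \<Longrightarrow> convergent (\<lambda>n. ip (x n) s)" and dense: "closure S = UNIV"
    and form: "\<forall>\<^sub>F n in sequentially. Re (ip (x n) (x n)) \<le> K"
  obtains M where "0 < M" "\<And>n. norm (x n) \<le> M"
proof -
  obtain E a where E: "finite E" and a: "0 < a"
    and G: "\<And>x. a * (norm x)\<^sup>2 \<le> Re (ip x x) + 2 * (\<Sum>e\<in>E. (cmod (ip x e))\<^sup>2)"
    using Garding by blast
  obtain C where C: "0 < C" "\<And>x y. cmod (ip x y) \<le> C * norm x * norm y"
    using bounded by blast
  \<comment> \<open>Squaring a sum costs a factor 2 and \<open>Garding\<close> another one, so the
    part to be absorbed is \<open>4 * card E * \<delta>\<^sup>2\<close>, at most
    \<open>a / 2\<close>.\<close>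
  define \<delta> where "\<delta> = sqrt (a / (8 * (real (card E) + 1)))"
  have \<delta>: "0 < \<delta>" "\<delta>\<^sup>2 = a / (8 * (real (card E) + 1))"
    using a by (simp_all add: \<delta>_def add_nonneg_pos)
  have "\<exists>L. \<forall>n. cmod (ip (x n) e) \<le> \<delta> * norm (x n) + L" for e
  proof -
    have "e \<in> closure S" "0 < \<delta> / C"
      using dense \<delta> C(1) by auto
    then obtain s where s: "s \<in> S" "dist s e < \<delta> / C"
      unfolding closure_approachable by blast
    obtain L where L: "\<And>n. cmod (ip (x n) s) \<le> L"
      using convergent_imp_Bseq[OF conv[OF s(1)]] unfolding Bseq_def by blast
    have "cmod (ip (x n) e) \<le> \<delta> * norm (x n) + L" for n
    proof -
      have "C * norm (e - s) \<le> \<delta>"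
        using s(2) C(1) by (simp add: dist_norm norm_minus_commute field_simps)
      then have "cmod (ip (x n) (e - s)) \<le> \<delta> * norm (x n)"
        using C(2)[of "x n" "e - s"] mult_right_mono[of "C * norm (e - s)" \<delta> "norm (x n)"]
        by (simp add: mult_ac)
      moreover have "ip (x n) e = ip (x n) (e - s) + ip (x n) s"
        by (simp add: diff_right)
      ultimately show ?thesis
        using norm_triangle_ineq[of "ip (x n) (e - s)" "ip (x n) s"] L[of n] by simp
    qed
    then show ?thesis
      by blast
  qed
  then obtain L where L: "\<And>e n. cmod (ip (x n) e) \<le> \<delta> * norm (x n) + L e"
    by metis
  have sq: "(cmod (ip (x n) e))\<^sup>2 \<le> 2 * \<delta>\<^sup>2 * (norm (x n))\<^sup>2 + 2 * (L e)\<^sup>2" for n e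
  proof -
    have "(cmod (ip (x n) e))\<^sup>2 \<le> (\<delta> * norm (x n) + L e)\<^sup>2"
      by (intro power_mono L) simp
    also have "\<dots> \<le> 2 * (\<delta> * norm (x n))\<^sup>2 + 2 * (L e)\<^sup>2"
      using sum_squares_bound[of "\<delta> * norm (x n)" "L e"] by (simp add: power2_sum)
    finally show ?thesis
      by (simp add: power_mult_distrib)
  qed
  define B where "B = \<bar>K\<bar> + 4 * (\<Sum>e\<in>E. (L e)\<^sup>2)"
  have "\<forall>\<^sub>F n in sequentially. norm (x n) \<le> sqrt (2 * B / a)"
    using form
  proof eventually_elim
    case (elim n)
    have "(\<Sum>e\<in>E. (cmod (ip (x n) e))\<^sup>2) \<le> (\<Sum>e\<in>E. 2 * \<delta>\<^sup>2 * (norm (x n))\<^sup>2 + 2 * (L e)\<^sup>2)"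
      by (intro sum_mono sq)
    also have "\<dots> = real (card E) * \<delta>\<^sup>2 * (2 * (norm (x n))\<^sup>2) + 2 * (\<Sum>e\<in>E. (L e)\<^sup>2)"
      by (simp add: sum.distrib sum_distrib_left)
    also have "\<dots> \<le> a / 8 * (2 * (norm (x n))\<^sup>2) + 2 * (\<Sum>e\<in>E. (L e)\<^sup>2)"
      unfolding \<delta>(2) using a
      by (intro add_right_mono mult_right_mono) (auto simp: divide_simps add_nonneg_pos)
    finally have "a / 2 * (norm (x n))\<^sup>2 \<le> B"
      using G[of "x n"] elim by (simp add: B_def)
    then have "(norm (x n))\<^sup>2 \<le> 2 * B / a"
      using a by (simp add: field_simps)
    then show ?case
      by (rule real_le_rsqrt)
  qed
  then have "Bseq x"
    by (rule BfunI)
  then show ?thesis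
    using that unfolding Bseq_def by blast
qed

text \<open>Boundedness in norm extends the convergence from \<open>S\<close> to all vectors; the
  conjugated limits then form a bounded linear functional, which \<open>Riesz\<close> represents by
  \<open>v\<close>.\<close>

lemma weak_limit:
  assumes conv: "\<And>s. s \<in> S \<Longrightarrow> convergent (\<lambda>n. ip (x n) s)" and dense: "closure S = UNIV"
    and form: "\<forall>\<^sub>F n in sequentially. Re (ip (x n) (x n)) \<le> K"
  obtains v where "\<And>e. (\<lambda>n. ip (x n) e) \<longlonglongrightarrow> ip v e" "\<And>e. (\<lambda>n. ip e (x n)) \<longlonglongrightarrow> ip e v"
proof -
  obtain M where M: "0 < M" "\<And>n. norm (x n) \<le> M"
    using eventually_norm_bounded[OF conv dense form] by blast
  obtain C where C: "0 < C" "\<And>x y. cmod (ip x y) \<le> C * norm x * norm y"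
    using bounded by blast
  have "Cauchy (\<lambda>n. ip (x n) e)" for e
  proof (rule metric_CauchyI)
    fix r :: real assume r: "0 < r"
    have "e \<in> closure S" "0 < r / (3 * C * M)"
      using dense r C(1) M(1) by auto
    then obtain s where s: "s \<in> S" "dist s e < r / (3 * C * M)"
      unfolding closure_approachable by blast
    have near: "cmod (ip (x n) (e - s)) < r / 3" for n
    proof -
      have "cmod (ip (x n) (e - s)) \<le> C * M * norm (e - s)"
        using C(1) M by (intro order_trans[OF C(2)] mult_right_mono mult_left_mono) auto
      also have "\<dots> < r / 3"
        using s(2) C(1) M(1) by (simp add: dist_norm norm_minus_commute field_simps)
      finally show ?thesis .
    qed
    obtain N where N: "\<And>m n. N \<le> m \<Longrightarrow> N \<le> n \<Longrightarrow> dist (ip (x m) s) (ip (x n) s) < r / 3"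
      using metric_CauchyD[OF convergent_Cauchy[OF conv[OF s(1)]], of "r / 3"] r by auto
    have "dist (ip (x m) e) (ip (x n) e) < r" if "N \<le> m" "N \<le> n" for m n
    proof -
      have "ip (x m) e - ip (x n) e = ip (x m) (e - s) - ip (x n) (e - s) + (ip (x m) s - ip (x n) s)"
        by (simp add: diff_right)
      then have "cmod (ip (x m) e - ip (x n) e) \<le>
          cmod (ip (x m) (e - s)) + cmod (ip (x n) (e - s)) + cmod (ip (x m) s - ip (x n) s)"
        using norm_triangle_ineq norm_triangle_ineq4 by (smt (verit, best))
      then show ?thesis
        using near[of m] near[of n] N[OF that] by (simp add: dist_norm)
    qed
    then show "\<exists>N. \<forall>m\<ge>N. \<forall>n\<ge>N. dist (ip (x m) e) (ip (x n) e) < r"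
      by blast
  qed
  then have "\<exists>l. (\<lambda>n. ip (x n) e) \<longlonglongrightarrow> l" for e
    using Cauchy_convergent_iff convergent_def by blast
  then obtain L where L: "\<And>e. (\<lambda>n. ip (x n) e) \<longlonglongrightarrow> L e"
    by metis
  have le: "cmod (L e) \<le> C * M * norm e" for e
  proof (rule Lim_bounded[OF tendsto_norm[OF L]])
    show "\<forall>n\<ge>0. cmod (ip (x n) e) \<le> C * M * norm e"
      using C(1) M by (intro allI impI order_trans[OF C(2)] mult_right_mono mult_left_mono) auto
  qed
  have L': "(\<lambda>n. ip e (x n)) \<longlonglongrightarrow> cnj (L e)" for e
    using tendsto_cnj[OF L[of e]] by (simp add: commute[of "x _" e, symmetric] commute[of e "x _", symmetric])
  have add: "cnj (L (e + e')) = cnj (L e) + cnj (L e')" for e e'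
    using L'[of "e + e'"] tendsto_add[OF L'[of e] L'[of e']] by (simp add: add_left LIMSEQ_unique)
  have scale: "cnj (L (c *\<^sub>C e)) = c * cnj (L e)" for c e
    using L'[of "c *\<^sub>C e"] tendsto_mult[OF tendsto_const L'[of e]] by (simp add: scale_left LIMSEQ_unique)
  obtain D where D: "0 \<le> D"
    "\<And>\<phi> K. (\<And>x y. \<phi> (x + y) = \<phi> x + \<phi> y) \<Longrightarrow> (\<And>c x. \<phi> (c *\<^sub>C x) = c * \<phi> x) \<Longrightarrow> 0 \<le> K \<Longrightarrow>
      (\<And>x. cmod (\<phi> x) \<le> K * norm x) \<Longrightarrow> \<exists>v. (\<forall>x. \<phi> x = ip x v) \<and> norm v \<le> D * K"
    using Riesz by blast
  have "\<exists>v. (\<forall>e. cnj (L e) = ip e v) \<and> norm v \<le> D * (C * M)"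
    by (rule D(2)) (use add scale le C(1) M(1) in simp_all)
  then obtain v where v: "\<And>e. cnj (L e) = ip e v"
    by blast
  have "L e = ip v e" for e
    using arg_cong[OF v[of e], of cnj] commute[of v e] by simp
  then show ?thesis
    using that[of v] L L' v by simp
qed

end

section \<open>From a directional function to a representing element\<close>

context realisation
begin

text \<open>Translates the boundedness condition on a directional function into a bound for
  \<open>ip\<close> on the vectors \<open>gam z (f z)\<close>, and back.\<close>

lemma kernel_diag:
  assumes z: "z \<in> \<rho>" "0 < Im z"
  shows "cinner (nev_kernel Q z z x) x = ip (gam z x) (gam z x)"
proof -
  have nonreal: "z \<notin> \<real>"
    using z(2) by (auto simp: complex_is_Real_iff)
  then have "vholomorphic_at Q z"
    using resolvent_set_subset_hdom z(1) by (auto simp: hdom_def)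
  then have cl: "clinear_op (Q z)"
    using Q nonreal by (auto simp: generalised_nevanlinna_def nevanlinna_class_def)
  have "cinner (Q z x) x = cinner x (cadjoint (Q z) x)"
    unfolding cadjoint_def by (rule form_adjoint[OF G.pontryagin_axioms G.pontryagin_axioms cl])
  then have adjQ: "cinner (cadjoint (Q z) x) x = cinner x (Q z x)"
    by (metis cinner_commute)
  have ne: "z - cnj z \<noteq> 0" "z \<noteq> cnj z"
    using z(2) by (auto simp: complex_eq_iff)
  have "cinner (nev_kernel Q z z x) x = inverse (z - cnj z) * (cinner (Q z x) x - cinner x (Q z x))"
    using ne(2) by (simp add: nev_kernel_def blinfun_scaleC blinfun.diff_left G.form_simps adjQ)
  also have "\<dots> = ip (gam z x) (gam z x)"
    using kernel_identity[OF z(1) z(1), of x x] ne(1) by (simp add: Q_W[OF z(1) nonreal, symmetric] field_simps)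
  finally show ?thesis .
qed

lemma gam_dense:
  "closure (cspan {gam z x | z x. z \<in> \<rho> \<and> z \<noteq> c}) = UNIV"
proof (rule dense_of_annihilator)
  show "csubspace (cspan {gam z x | z x. z \<in> \<rho> \<and> z \<noteq> c})"
    by (rule complex_vector.subspace_span)
  fix u assume "\<And>s. s \<in> cspan {gam z x | z x. z \<in> \<rho> \<and> z \<noteq> c} \<Longrightarrow> ip s u = 0"
  then show "u = 0"
    by (intro minimal_annihilator[of c] ) (blast intro: complex_vector.span_base)
qed

lemma directional_pair_imp_represents:
  assumes U: "open U" "complex_of_real \<omega> \<in> U"
    and f0: "nt_tendsto (directional_dom Q U) f f0 \<omega>"
    and g0: "nt_tendsto (directional_dom Q U) (\<lambda>z. Q z (f z)) g0 \<omega>"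
    and bdd: "nt_bounded (directional_dom Q U) (\<lambda>z. cinner (nev_kernel Q z z (f z)) (f z)) \<omega>"
  shows "\<exists>v. represents_pair Q ip A \<gamma> z0 \<omega> f0 g0 v"
proof -
  let ?w = "complex_of_real \<omega>"
  obtain r1 where r1: "0 < r1" "ball ?w r1 \<subseteq> U"
    using U open_contains_ball by blast
  obtain r2 where r2: "0 < r2" "\<And>l. 0 < Im l \<Longrightarrow> cmod (l - ?w) < r2 \<Longrightarrow> l \<in> \<rho>"
    using resolvent_set_near_real[OF z0(1)] by blast
  \<comment> \<open>The offset 2 keeps even \<open>t 0\<close> strictly below both radii. The points
    \<open>p n\<close> approach \<omega> vertically and so lie in every sector; the opening
    \<open>pi / 4\<close> is an arbitrary choice.\<close>
  define t where "t n = min r1 r2 / real (n + 2)" for n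
  have t: "0 < t n" "t n < r1" "t n < r2" for n
  proof -
    show "0 < t n"
      using r1(1) r2(1) by (simp add: t_def)
    have "t n < min r1 r2"
      using r1(1) r2(1) divide_strict_left_mono[of 1 "real (n + 2)" "min r1 r2"] by (simp add: t_def)
    then show "t n < r1" "t n < r2"
      by auto
  qed
  have t0: "t \<longlonglongrightarrow> 0"
    unfolding t_def using LIMSEQ_ignore_initial_segment[OF lim_const_over_n[of "min r1 r2"], of 2] by simp
  define p where "p n = ?w + rcis (t n) (pi / 2)" for n
  have dp: "cmod (p n - ?w) = t n" for n
    using t(1)[of n] by (simp add: p_def)
  have Imp: "0 < Im (p n)" for n
    using t(1)[of n] by (simp add: p_def)
  have p\<rho>: "p n \<in> \<rho>" for n
    using r2(2)[OF Imp] dp t(3) by simp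
  have p_nonreal: "p n \<notin> \<real>" for n
    using Imp[of n] by (auto simp: complex_is_Real_iff)
  have pD: "p n \<in> nt_sector \<omega> (pi / 4) \<inter> directional_dom Q U" for n
  proof
    show "p n \<in> nt_sector \<omega> (pi / 4)"
      unfolding nt_sector_def p_def using t(1)[of n] pi_gt_zero
      by (intro CollectI exI[of _ "t n"] exI[of _ "pi / 2"]) auto
    have "p n \<in> U"
      using r1(2) dp[of n] t(2)[of n] by (auto simp: dist_norm norm_minus_commute)
    then show "p n \<in> directional_dom Q U"
      using resolvent_set_subset_hdom p\<rho>[of n] Imp[of n] by (auto simp: directional_dom_def upper_half_plane_def)
  qed
  have p_lim: "p \<longlonglongrightarrow> ?w"
    using t0 by (intro tendstoI) (auto simp: dist_norm dp dest!: tendstoD elim: eventually_mono)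
  have ne: "p n \<noteq> ?w" for n
    using dp[of n] t(1)[of n] by auto
  have p_filter: "filterlim p (at ?w within nt_sector \<omega> (pi / 4) \<inter> directional_dom Q U) sequentially"
    unfolding filterlim_at by (rule conjI[OF always_eventually p_lim]) (simp only: pD ne simp_thms)
  have quarter: "pi / 4 \<in> {0<..<pi / 2}"
    using pi_gt_zero by auto
  have f_lim: "(\<lambda>n. f (p n)) \<longlonglongrightarrow> f0"
    using f0[unfolded nt_tendsto_def, rule_format, OF quarter] p_filter by (rule filterlim_compose)
  have "(\<lambda>n. Q (p n) (f (p n))) \<longlonglongrightarrow> g0"
    using g0[unfolded nt_tendsto_def, rule_format, OF quarter] p_filter by (rule filterlim_compose)
  then have W_lim: "(\<lambda>n. W (p n) (f (p n))) \<longlonglongrightarrow> g0"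
    by (simp add: Q_W p\<rho> p_nonreal)
  define x where "x n = gam (p n) (f (p n))" for n
  obtain K where "\<forall>\<^sub>F z in at ?w within nt_sector \<omega> (pi / 4) \<inter> directional_dom Q U.
      norm (cinner (nev_kernel Q z z (f z)) (f z)) \<le> K"
    using bdd[unfolded nt_bounded_def, rule_format, OF quarter] unfolding Bfun_def by blast
  from eventually_compose_filterlim[OF this p_filter]
  have form: "\<forall>\<^sub>F n in sequentially. Re (ip (x n) (x n)) \<le> K"
  proof eventually_elim
    case (elim n)
    then have "cmod (ip (x n) (x n)) \<le> K"
      by (simp add: x_def kernel_diag[OF p\<rho> Imp])
    then show ?case
      using complex_Re_le_cmod order_trans by blast
  qed
  define S where "S = cspan {gam z h | z h. z \<in> \<rho> \<and> z \<noteq> ?w}"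
  have conv: "convergent (\<lambda>n. ip (x n) s)" if "s \<in> S" for s
  proof -
    have "csubspace {s. convergent (\<lambda>n. ip (x n) s)}"
      by (rule complex_vector.subspaceI)
        (auto simp: form_simps convergent_const intro: convergent_add convergent_mult)
    moreover have "{gam z h | z h. z \<in> \<rho> \<and> z \<noteq> ?w} \<subseteq> {s. convergent (\<lambda>n. ip (x n) s)}"
    proof clarsimp
      fix z h assume z: "z \<in> \<rho>" "z \<noteq> ?w"
      \<comment> \<open>The exclusion of \<omega> from the spanning set keeps the limit of the
        denominators away from 0.\<close>
      have ne: "?w - cnj z \<noteq> 0"
        using z(2) by (metis complex_cnj_cnj complex_cnj_complex_of_real eq_iff_diff_eq_0)
      have lim: "(\<lambda>n. p n - cnj z) \<longlonglongrightarrow> ?w - cnj z"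
        by (intro tendsto_intros p_lim)
      have "(\<lambda>n. (cinner (W (p n) (f (p n))) h - cinner (f (p n)) (W z h)) / (p n - cnj z)) \<longlonglongrightarrow>
          (cinner g0 h - cinner f0 (W z h)) / (?w - cnj z)"
        using ne by (intro tendsto_intros bounded_linear.tendsto[OF G.bounded_linear_left] W_lim f_lim lim)
      moreover have "\<forall>\<^sub>F n in sequentially.
          (cinner (W (p n) (f (p n))) h - cinner (f (p n)) (W z h)) / (p n - cnj z) = ip (x n) (gam z h)"
        using tendsto_imp_eventually_ne[OF lim ne]
      proof eventually_elim
        case (elim n)
        then show ?case
          by (simp add: kernel_identity[OF p\<rho> z(1), symmetric] x_def)
      qed
      ultimately have "(\<lambda>n. ip (x n) (gam z h)) \<longlonglongrightarrow> (cinner g0 h - cinner f0 (W z h)) / (?w - cnj z)"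
        using tendsto_cong by fast
      then show "convergent (\<lambda>n. ip (x n) (gam z h))"
        unfolding convergent_def by blast
    qed
    ultimately have "S \<subseteq> {s. convergent (\<lambda>n. ip (x n) s)}"
      unfolding S_def by (intro complex_vector.span_minimal)
    then show ?thesis
      using that by blast
  qed
  have dense: "closure S = UNIV"
    unfolding S_def by (rule gam_dense)
  obtain v where v: "\<And>e. (\<lambda>n. ip (x n) e) \<longlonglongrightarrow> ip v e" "\<And>e. (\<lambda>n. ip e (x n)) \<longlonglongrightarrow> ip e v"
    using weak_limit[OF conv dense form] by blast
  have \<gamma>_lim: "(\<lambda>n. ip b (\<gamma> (f (p n)))) \<longlonglongrightarrow> ip b (\<gamma> f0)" for b
  proof -
    have "(\<lambda>n. cnj (ip (\<gamma> (f (p n))) b)) \<longlonglongrightarrow> cnj (ip (\<gamma> f0) b)"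
      by (intro tendsto_cnj bounded_linear.tendsto[OF bounded_linear_left] blinfun.tendsto tendsto_const f_lim)
    then show ?thesis
      by (simp add: commute[of b, symmetric])
  qed
  \<comment> \<open>Self-adjointness describes membership in \<open>A\<close> by pairings with
    elements of \<open>A\<close>, so it passes to weak limits.\<close>
  have "(v - \<gamma> f0, ?w *\<^sub>C v - z0 *\<^sub>C \<gamma> f0) \<in> A"
    unfolding mem_iff[of "v - \<gamma> f0"]
  proof (intro allI impI)
    fix a b assume ab: "(a, b) \<in> A"
    have "ip b (x n) - ip b (\<gamma> (f (p n))) = cnj (p n) * ip a (x n) - cnj z0 * ip a (\<gamma> (f (p n)))" for n
      using symmetric[OF ab gam_mem[OF p\<rho>[of n], of "f (p n)"]] by (simp add: x_def form_simps)
    moreover have "(\<lambda>n. ip b (x n) - ip b (\<gamma> (f (p n)))) \<longlonglongrightarrow> ip b v - ip b (\<gamma> f0)"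
      by (intro tendsto_diff v \<gamma>_lim)
    moreover have "(\<lambda>n. cnj (p n) * ip a (x n) - cnj z0 * ip a (\<gamma> (f (p n)))) \<longlonglongrightarrow>
        cnj ?w * ip a v - cnj z0 * ip a (\<gamma> f0)"
      by (intro tendsto_intros v \<gamma>_lim p_lim)
    ultimately have "ip b v - ip b (\<gamma> f0) = cnj ?w * ip a v - cnj z0 * ip a (\<gamma> f0)"
      using LIMSEQ_unique by simp
    then show "ip b (v - \<gamma> f0) = ip a (?w *\<^sub>C v - z0 *\<^sub>C \<gamma> f0)"
      by (simp add: form_simps)
  qed
  moreover have "g0 = Q0 f0 + (?w - cnj z0) *\<^sub>C gp v"
  proof (rule G.ext_left)
    fix h
    have "(\<lambda>n. cinner (Q0 (f (p n))) h + (p n - cnj z0) * ip (x n) (\<gamma> h)) \<longlonglongrightarrow>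
        cinner (Q0 f0) h + (?w - cnj z0) * ip v (\<gamma> h)"
      by (intro tendsto_intros bounded_linear.tendsto[OF G.bounded_linear_left] blinfun.tendsto f_lim p_lim v)
    moreover have "cinner (W (p n) (f (p n))) h = cinner (Q0 (f (p n))) h + (p n - cnj z0) * ip (x n) (\<gamma> h)" for n
      by (simp add: W_apply G.form_simps adj x_def)
    moreover have "(\<lambda>n. cinner (W (p n) (f (p n))) h) \<longlonglongrightarrow> cinner g0 h"
      by (rule bounded_linear.tendsto[OF G.bounded_linear_left W_lim])
    ultimately have "cinner g0 h = cinner (Q0 f0) h + (?w - cnj z0) * ip v (\<gamma> h)"
      using LIMSEQ_unique by simp
    then show "cinner g0 h = cinner (Q0 f0 + (?w - cnj z0) *\<^sub>C gp v) h"
      by (simp add: G.form_simps adj)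
  qed
  ultimately show ?thesis
    unfolding represents_pair_iff by blast
qed

end

section \<open>Construction of directional functions\<close>

lemma tendsto_small_perturbation:
  fixes f :: "'x \<Rightarrow> 'a::real_normed_vector"
  assumes "\<And>r. 0 < r \<Longrightarrow> \<exists>g. (g \<longlongrightarrow> 0) F \<and> (\<forall>\<^sub>F x in F. norm (f x - g x) \<le> r)"
  shows "(f \<longlongrightarrow> 0) F"
proof (rule tendstoI)
  fix e :: real assume e: "0 < e"
  obtain g where g: "(g \<longlongrightarrow> 0) F" "\<forall>\<^sub>F x in F. norm (f x - g x) \<le> e / 2"
    using assms[of "e / 2"] e by auto
  have "\<forall>\<^sub>F x in F. dist (g x) 0 < e / 2"
    by (rule tendstoD[OF g(1)]) (use e in simp)
  with g(2) show "\<forall>\<^sub>F x in F. dist (f x) 0 < e"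
  proof eventually_elim
    case (elim x)
    then show ?case
      using norm_triangle_ineq[of "f x - g x" "g x"] by simp
  qed
qed

text \<open>The mean ergodic argument: for \<open>w = u + (z - c) *\<^sub>C K u\<close> one has
  \<open>T l w = u + (l - c) *\<^sub>C T l (K u)\<close>, and such \<open>w\<close> are dense.\<close>

lemma mean_ergodic:
  fixes K :: "'a::complex_normed_vector \<Rightarrow>\<^sub>L 'a" and T :: "complex \<Rightarrow> 'a \<Rightarrow>\<^sub>L 'a"
  assumes K: "clinear_op K" and T: "\<And>l. clinear_op (T l)"
    and lim: "((\<lambda>l. l) \<longlongrightarrow> c) F"
    and inv: "\<forall>\<^sub>F l in F. \<forall>y. T l (y + (z - l) *\<^sub>C K y) = y"
    and bound: "\<forall>\<^sub>F l in F. \<forall>w. norm ((l - c) *\<^sub>C K (T l w)) \<le> B * norm w"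
    and dense: "closure (range (\<lambda>u. u + (z - c) *\<^sub>C K u)) = UNIV"
  shows "((\<lambda>l. (l - c) *\<^sub>C K (T l w)) \<longlongrightarrow> 0) F"
proof (rule tendsto_small_perturbation)
  fix r :: real assume r: "0 < r"
  have "w \<in> closure (range (\<lambda>u. u + (z - c) *\<^sub>C K u))" "0 < r / (\<bar>B\<bar> + 1)"
    using dense r by (auto simp: add_nonneg_pos)
  then obtain u where u: "dist (u + (z - c) *\<^sub>C K u) w < r / (\<bar>B\<bar> + 1)"
    unfolding closure_approachable by blast
  define w' where "w' = u + (z - c) *\<^sub>C K u"
  define g where "g l = (l - c) *\<^sub>C K (T l w')" for l
  have lim0: "((\<lambda>l. l - c) \<longlongrightarrow> 0) F"
    using lim by (simp add: LIM_zero_iff)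
  have "((\<lambda>l. cmod (l - c) * (norm (K u) + B * norm (K u))) \<longlongrightarrow> cmod 0 * (norm (K u) + B * norm (K u))) F"
    by (intro tendsto_intros lim0)
  then have null: "((\<lambda>l. cmod (l - c) * (norm (K u) + B * norm (K u))) \<longlongrightarrow> 0) F"
    by simp
  have "\<forall>\<^sub>F l in F. norm (g l) \<le> cmod (l - c) * (norm (K u) + B * norm (K u))"
    using inv bound
  proof eventually_elim
    case (elim l)
    have "w' = (u + (z - l) *\<^sub>C K u) + (l - c) *\<^sub>C K u"
      by (simp add: w'_def scaleC_add_left[symmetric] add.assoc)
    then have "T l w' = u + (l - c) *\<^sub>C T l (K u)"
      using elim(1) by (simp only: blinfun.add_right clinear_opD[OF T])
    then have "g l = (l - c) *\<^sub>C (K u + (l - c) *\<^sub>C K (T l (K u)))"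
      by (simp add: g_def blinfun.add_right clinear_opD[OF K])
    then have "norm (g l) = cmod (l - c) * norm (K u + (l - c) *\<^sub>C K (T l (K u)))"
      by (simp add: norm_scaleC)
    also have "\<dots> \<le> cmod (l - c) * (norm (K u) + B * norm (K u))"
      using elim(2) by (intro mult_left_mono order_trans[OF norm_triangle_ineq] add_left_mono) auto
    finally show ?case .
  qed
  then have "(g \<longlongrightarrow> 0) F"
    using null by (rule Lim_null_comparison)
  moreover have "\<forall>\<^sub>F l in F. norm ((l - c) *\<^sub>C K (T l w) - g l) \<le> r"
    using bound
  proof eventually_elim
    case (elim l)
    have "(l - c) *\<^sub>C K (T l w) - g l = (l - c) *\<^sub>C K (T l (w - w'))"
      by (simp add: g_def blinfun.diff_right complex_vector.scale_right_diff_distrib)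
    then have "norm ((l - c) *\<^sub>C K (T l w) - g l) \<le> B * norm (w - w')"
      using elim by simp
    also have "\<dots> \<le> (\<bar>B\<bar> + 1) * norm (w - w')"
      by (intro mult_right_mono) auto
    also have "\<dots> \<le> (\<bar>B\<bar> + 1) * (r / (\<bar>B\<bar> + 1))"
      using u by (intro mult_left_mono) (auto simp: w'_def dist_norm norm_minus_commute)
    also have "\<dots> = r"
      by (simp add: add_nonneg_pos)
    finally show ?case .
  qed
  ultimately show "\<exists>g. (g \<longlongrightarrow> 0) F \<and> (\<forall>\<^sub>F x in F. norm ((x - c) *\<^sub>C K (T x w) - g x) \<le> r)"
    by blast
qed

text \<open>On the sector \<open>sin \<phi>\<close> is at least \<open>sin \<theta>\<close>, so a
  resolvent bound of order 1 / Im z becomes one of order 1 / |z - \<omega>|.\<close>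

lemma nt_sector_Im:
  assumes "z \<in> nt_sector \<omega> \<theta>" "0 < \<theta>" "\<theta> < pi / 2"
  shows "cmod (z - of_real \<omega>) * sin \<theta> \<le> Im z"
proof -
  obtain r \<phi> where z: "z = of_real \<omega> + rcis r \<phi>" "0 < r" "\<bar>\<phi> - pi / 2\<bar> \<le> pi / 2 - \<theta>"
    using assms(1) unfolding nt_sector_def by blast
  have "cos (pi / 2 - \<theta>) \<le> cos \<bar>\<phi> - pi / 2\<bar>"
    using z(3) assms(2,3) by (intro cos_monotone_0_pi_le) auto
  then have "sin \<theta> \<le> sin \<phi>"
    by (simp add: cos_diff)
  then show ?thesis
    using z(1,2) by simp
qed

section \<open>Boundary values and the dissipative extension\<close>

context realisation
begin

lemma mem_add: "(a, b) \<in> A \<Longrightarrow> (a', b') \<in> A \<Longrightarrow> (a + a', b + b') \<in> A"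
  by (subst mem_iff) (simp add: add_right symmetric[of _ _ a b] symmetric[of _ _ a' b'])

text \<open>Since \<open>A\<close> is symmetric, the imaginary part comes from the boundary alone:
  \<open>g\<close> and the first argument of \<open>cinner\<close> are the two boundary values of
  the element obtained by adding \<open>(\<gamma> g, z0 *\<^sub>C \<gamma> g)\<close> to
  \<open>(a, b)\<close>.\<close>

lemma Green_identity:
  assumes "(a, b) \<in> A"
  shows "Im (ip (b + z0 *\<^sub>C \<gamma> g) (a + \<gamma> g)) = Im (cinner (gp (b - cnj z0 *\<^sub>C a) + Q z0 g) g)"
proof -
  have "ip (b + z0 *\<^sub>C \<gamma> g) (a + \<gamma> g) =
      ip b a + ip b (\<gamma> g) + z0 * ip (\<gamma> g) a + z0 * ip (\<gamma> g) (\<gamma> g)"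
    by (simp add: form_simps algebra_simps)
  moreover have "Im (z0 * ip (\<gamma> g) a) = Im (- (cnj z0 * ip a (\<gamma> g)))"
    using commute[of "\<gamma> g" a] by simp
  ultimately have 1: "Im (ip (b + z0 *\<^sub>C \<gamma> g) (a + \<gamma> g)) =
      Im (ip (b - cnj z0 *\<^sub>C a) (\<gamma> g)) + Im (z0 * ip (\<gamma> g) (\<gamma> g))"
    using Im_form_zero[OF assms] by (simp add: form_simps)
  have Q: "cinner (Q z0 g) g = cinner (Q0 g) g + (z0 - cnj z0) * ip (\<gamma> g) (\<gamma> g)"
    by (simp add: Q_z0 G.form_simps adj)
  have "cinner (Q0 g) g = cnj (cinner (Q z0 g) g)"
    unfolding Q0_adj by (rule cinner_commute)
  then have "Im (cinner (Q z0 g) g) = Im (z0 * ip (\<gamma> g) (\<gamma> g))"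
    using arg_cong[OF Q, of Im] by simp
  then show ?thesis
    using 1 by (simp add: G.form_simps adj)
qed

text \<open>\<open>K\<close> is the resolvent at \<open>z0\<close> of the extension with boundary condition
  \<open>\<Gamma>\<^sub>1 + \<i> * \<tau> * \<Gamma>\<^sub>0 = 0\<close>, where \<open>\<Gamma>\<^sub>0 (a + \<gamma> g) = g\<close> and \<open>\<Gamma>\<^sub>1 (a + \<gamma> g) = gp (b - cnj z0 *\<^sub>C a) + Q z0 g\<close>
  for \<open>(a, b) \<in> A\<close>. It is dissipative and, unlike \<open>A\<close>, has no real eigenvalues.\<close>

lemma dissipative_extension:
  obtains K K' :: "'p \<Rightarrow>\<^sub>L 'p" and N :: "'p \<Rightarrow>\<^sub>L 'g" where
    "clinear_op K" "clinear_op K'" "clinear_op N" "\<And>y. K y = R z0 y + \<gamma> (N y)"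
    "\<And>x y. ip (K x) y = ip x (K' y)"
    "\<And>y. Im (ip (y + z0 *\<^sub>C K y) (K y)) \<le> 0"
    "\<And>y. 0 \<le> Im (ip (y + cnj z0 *\<^sub>C K' y) (K' y))"
    "\<And>\<omega> y. y + (z0 - complex_of_real \<omega>) *\<^sub>C K y = 0 \<Longrightarrow> y = 0"
    "\<And>\<omega> y. y + cnj (z0 - complex_of_real \<omega>) *\<^sub>C K' y = 0 \<Longrightarrow> y = 0"
proof -
  \<comment> \<open>Large enough for Q z0 + i \<tau> to be inverted by a Neumann series;
    \<open>M\<close> will be the inverse.\<close>
  define \<tau> where "\<tau> = norm (Q z0) + 1"
  have \<tau>: "0 < \<tau>"
    by (simp add: \<tau>_def add_nonneg_pos)
  define c where "c = inverse (\<i> * complex_of_real \<tau>)"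
  have c: "\<i> * complex_of_real \<tau> * c = 1"
    unfolding c_def by (rule right_inverse) (use \<tau> in simp)
  have norm_c: "cmod c = inverse \<tau>"
    using \<tau> by (simp add: c_def norm_inverse norm_mult)
  have "norm (c *\<^sub>C Q z0) < 1"
    using \<tau> by (simp add: norm_scaleC norm_c \<tau>_def field_simps)
  then obtain T where T: "clinear_op T" "\<And>x. blinfun_apply T (x + (c *\<^sub>C Q z0) x) = x"
    "\<And>x. blinfun_apply T x + (c *\<^sub>C Q z0) (blinfun_apply T x) = x"
    using Neumann_inverse[OF clinear_op_scaleC[OF clinear_Q]] by blast
  define M where "M = c *\<^sub>C T"
  have cM: "clinear_op M"
    unfolding M_def by (intro clinear_op_scaleC T)
  have M1: "Q z0 (M y) + (\<i> * \<tau>) *\<^sub>C M y = y" for y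
  proof -
    have "Q z0 (M y) + (\<i> * \<tau>) *\<^sub>C M y = T y + (c *\<^sub>C Q z0) (T y)"
      by (simp add: M_def blinfun_scaleC clinear_opD[OF clinear_Q] c add.commute)
    then show ?thesis
      by (simp only: T(3))
  qed
  have M2: "M (Q z0 x + (\<i> * \<tau>) *\<^sub>C x) = x" for x
  proof -
    have "c *\<^sub>C (Q z0 x + (\<i> * \<tau>) *\<^sub>C x) = x + (c *\<^sub>C Q z0) x"
      using c by (simp add: blinfun_scaleC scaleC_add_right mult.commute add.commute)
    then show ?thesis
      using T(2)[of x] by (simp add: M_def blinfun_scaleC clinear_opD[OF T(1), symmetric])
  qed
  define M' where "M' = cadjoint M"
  have M': "cinner (M x) y = cinner x (M' y)" "clinear_op M'" for x y
    unfolding M'_def cadjoint_def by (rule form_adjoint[OF G.pontryagin_axioms G.pontryagin_axioms cM])+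
  have M'1: "Q0 (M' y) - (\<i> * \<tau>) *\<^sub>C M' y = y" for y
  proof (rule G.ext_right)
    fix x
    have "cinner x (Q0 (M' y) - (\<i> * \<tau>) *\<^sub>C M' y) = cinner (Q z0 x + (\<i> * \<tau>) *\<^sub>C x) (M' y)"
      by (simp add: G.form_simps Q0_adj)
    also have "\<dots> = cinner x y"
      by (simp only: M'(1)[symmetric] M2)
    finally show "cinner x (Q0 (M' y) - (\<i> * \<tau>) *\<^sub>C M' y) = cinner x y" .
  qed
  have z0': "cnj z0 \<in> \<rho>"
    by (rule cnj_resolvent_set[OF z0(1)])
  \<comment> \<open>\<open>P y\<close> is \<open>gp (b - cnj z0 *\<^sub>C a)\<close> for the element
    of \<open>A\<close> with \<open>a = R z0 y\<close>, so \<open>N y\<close> will be the solution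
    \<open>g\<close> of the boundary condition
    \<open>P y + Q z0 g + (\<i> * \<tau>) *\<^sub>C g = 0\<close>.\<close>
  define P where "P = gp o\<^sub>L (id_blinfun + (z0 - cnj z0) *\<^sub>C R z0)"
  have P: "P y = gp (y + (z0 - cnj z0) *\<^sub>C R z0 y)" for y
    by (simp add: P_def blinfun.add_left blinfun_scaleC)
  define N where "N = - (M o\<^sub>L P)"
  have N: "N y = - M (P y)" for y
    by (simp add: N_def blinfun.minus_left)
  define K where "K = R z0 + (\<gamma> o\<^sub>L N)"
  have K: "K y = R z0 y + \<gamma> (N y)" for y
    by (simp add: K_def blinfun.add_left)
  \<comment> \<open>Obtained by taking the adjoint of the formula for \<open>K\<close>. The operator
    \<open>K'\<close> belongs to the boundary condition with the opposite sign of \<tau>, hence it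
    is accretive.\<close>
  define N' where "N' = - (M' o\<^sub>L gp)"
  have N': "N' y = - M' (gp y)" for y
    by (simp add: N'_def blinfun.minus_left)
  define K' where "K' = R (cnj z0) + ((id_blinfun + (cnj z0 - z0) *\<^sub>C R (cnj z0)) o\<^sub>L \<gamma> o\<^sub>L N')"
  have K': "K' y = R (cnj z0) (y + (cnj z0 - z0) *\<^sub>C \<gamma> (N' y)) + \<gamma> (N' y)" for y
    by (simp add: K'_def blinfun.add_left blinfun.add_right blinfun_scaleC clinear_opD[OF clinear_resolvent[OF z0']])
  note cR = clinear_resolvent[OF z0(1)] clinear_resolvent[OF z0']
  have cN: "clinear_op N"
    unfolding N_def P_def
    by (intro clinear_op_minus clinear_op_compose clinear_op_add clinear_op_id clinear_op_scaleC cM clinear_gp cR)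
  have cK: "clinear_op K"
    unfolding K_def by (intro clinear_op_add clinear_op_compose cR clinear_\<gamma> cN)
  have cK': "clinear_op K'"
    unfolding K'_def N'_def
    by (intro clinear_op_minus clinear_op_compose clinear_op_add clinear_op_id clinear_op_scaleC M' clinear_gp clinear_\<gamma> cR)
  have adjK: "ip (K x) y = ip x (K' y)" for x y
  proof -
    have "ip (\<gamma> (N x)) y = ip (x + (z0 - cnj z0) *\<^sub>C R z0 x) (\<gamma> (N' y))"
      by (simp add: adj N N' G.minus_left G.minus_right M'(1) P)
    also have "\<dots> = ip x (\<gamma> (N' y) + (cnj z0 - z0) *\<^sub>C R (cnj z0) (\<gamma> (N' y)))"
      by (simp add: form_simps resolvent_adjoint[OF z0(1)])
    finally show ?thesis
      by (simp add: K K' form_simps resolvent_adjoint[OF z0(1)] blinfun.add_right clinear_opD[OF cR(2)])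
  qed
  have flux: "Im (cinner ((\<i> * complex_of_real s) *\<^sub>C g) g) = s * (norm g)\<^sup>2" for s :: real and g :: 'g
    by (simp add: G.form_simps cinner_self)
  have Im_K: "Im (ip (y + z0 *\<^sub>C K y) (K y)) = - \<tau> * (norm (N y))\<^sup>2" for y
  proof -
    have "y + z0 *\<^sub>C K y = (y + z0 *\<^sub>C R z0 y) + z0 *\<^sub>C \<gamma> (N y)"
      by (simp add: K scaleC_add_right)
    moreover have "gp ((y + z0 *\<^sub>C R z0 y) - cnj z0 *\<^sub>C R z0 y) + Q z0 (N y) = (\<i> * complex_of_real (- \<tau>)) *\<^sub>C N y"
    proof -
      have "(y + z0 *\<^sub>C R z0 y) - cnj z0 *\<^sub>C R z0 y = y + (z0 - cnj z0) *\<^sub>C R z0 y"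
        by (simp add: complex_vector.scale_left_diff_distrib)
      then have "gp ((y + z0 *\<^sub>C R z0 y) - cnj z0 *\<^sub>C R z0 y) = P y"
        by (simp only: P)
      then show ?thesis
        using M1[of "P y"] by (simp add: N blinfun.minus_right diff_eq_eq add.commute)
    qed
    ultimately have "Im (ip (y + z0 *\<^sub>C K y) (K y)) = Im (cinner ((\<i> * complex_of_real (- \<tau>)) *\<^sub>C N y) (N y))"
      using Green_identity[OF resolvent_mem[OF z0(1), of y], of "N y"] by (simp only: K)
    then show ?thesis
      by (simp only: flux)
  qed
  have Im_K': "Im (ip (u + cnj z0 *\<^sub>C K' u) (K' u)) = \<tau> * (norm (N' u))\<^sup>2" for u
  proof -
    let ?y = "u + (cnj z0 - z0) *\<^sub>C \<gamma> (N' u)"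
    have "u + cnj z0 *\<^sub>C K' u = (?y + cnj z0 *\<^sub>C R (cnj z0) ?y) + z0 *\<^sub>C \<gamma> (N' u)"
      by (simp add: K' scaleC_add_right complex_vector.scale_left_diff_distrib)
    moreover have "gp ((?y + cnj z0 *\<^sub>C R (cnj z0) ?y) - cnj z0 *\<^sub>C R (cnj z0) ?y) + Q z0 (N' u) =
        (\<i> * complex_of_real \<tau>) *\<^sub>C N' u"
    proof -
      have "gp ?y + Q z0 (N' u) = gp u + Q0 (N' u)"
        by (simp add: Q_z0 blinfun.add_right blinfun.diff_right clinear_opD[OF clinear_gp]
            complex_vector.scale_left_diff_distrib)
      also have "\<dots> = (\<i> * complex_of_real \<tau>) *\<^sub>C N' u"
        using M'1[of "gp u"] by (simp add: N' blinfun.minus_right algebra_simps)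
      finally show ?thesis
        by simp
    qed
    ultimately have "Im (ip (u + cnj z0 *\<^sub>C K' u) (K' u)) = Im (cinner ((\<i> * complex_of_real \<tau>) *\<^sub>C N' u) (N' u))"
      using Green_identity[OF resolvent_mem[OF z0', of ?y], of "N' u"] by (simp only: K')
    then show ?thesis
      by (simp only: flux)
  qed
  \<comment> \<open>At a real eigenvalue the flux is zero, hence \<open>N y = 0\<close>; the
    boundary condition makes the other boundary value vanish too, and \<open>no_eigenvector\<close>
    applies.\<close>
  have inj: "y = 0" if y: "y + (z0 - complex_of_real \<omega>) *\<^sub>C K y = 0" for \<omega> y
  proof -
    have eig: "y + z0 *\<^sub>C K y = complex_of_real \<omega> *\<^sub>C K y"
      using y by (simp add: complex_vector.scale_left_diff_distrib add_diff_eq)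
    have "Im (ip (complex_of_real \<omega> *\<^sub>C K y) (K y)) = 0"
      by (simp add: scale_left)
    then have N0: "N y = 0"
      using Im_K[of y] \<tau> unfolding eig by simp
    then have Ky: "K y = R z0 y"
      by (simp add: K)
    have mem: "(K y, complex_of_real \<omega> *\<^sub>C K y) \<in> A"
      using resolvent_mem[OF z0(1), of y] unfolding eig[unfolded Ky] Ky .
    have "P y = 0"
      using M1[of "P y"] N0 by (simp add: N)
    moreover have "y + (z0 - cnj z0) *\<^sub>C R z0 y = (complex_of_real \<omega> - cnj z0) *\<^sub>C K y"
      using eig by (simp add: Ky complex_vector.scale_left_diff_distrib add_diff_eq)
    ultimately have "gp (K y) = 0"
      using of_real_neq_z0(1)[of \<omega>] by (simp add: P clinear_opD[OF clinear_gp])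
    then have "K y = 0"
      by (rule no_eigenvector[OF mem])
    then show ?thesis
      using y by simp
  qed
  have inj': "u = 0" if u: "u + cnj (z0 - complex_of_real \<omega>) *\<^sub>C K' u = 0" for \<omega> u
  proof -
    have eig: "u + cnj z0 *\<^sub>C K' u = complex_of_real \<omega> *\<^sub>C K' u"
      using u by (simp add: complex_vector.scale_left_diff_distrib add_diff_eq)
    have "Im (ip (complex_of_real \<omega> *\<^sub>C K' u) (K' u)) = 0"
      by (simp add: scale_left)
    then have N0: "N' u = 0"
      using Im_K'[of u] \<tau> unfolding eig by simp
    then have Ku: "K' u = R (cnj z0) u"
      by (simp add: K')
    have mem: "(K' u, complex_of_real \<omega> *\<^sub>C K' u) \<in> A"
      using resolvent_mem[OF z0', of u] unfolding eig[unfolded Ku] Ku .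
    have "gp u = 0"
      using M'1[of "gp u"] N0 by (simp add: N')
    moreover have "u = (complex_of_real \<omega> - cnj z0) *\<^sub>C K' u"
      using eig by (simp only: complex_vector.scale_left_diff_distrib eq_diff_eq)
    ultimately have "(complex_of_real \<omega> - cnj z0) *\<^sub>C gp (K' u) = 0"
      by (metis clinear_opD[OF clinear_gp])
    then have "gp (K' u) = 0"
      using of_real_neq_z0(1)[of \<omega>] by simp
    then have "K' u = 0"
      by (rule no_eigenvector[OF mem])
    then show ?thesis
      using u by simp
  qed
  show ?thesis
    by (rule that[OF cK cK' cN K adjK _ _ inj inj']) (use \<tau> in \<open>simp_all add: Im_K Im_K'\<close>)
qed

section \<open>From a representing element to a directional function\<close>

lemma represents_imp_directional_function:
  assumes rep: "represents_pair Q ip A \<gamma> z0 \<omega> f0 g0 v"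
  shows "\<exists>U f. directional_function Q \<omega> U f \<and>
    nt_tendsto (directional_dom Q U) f f0 \<omega> \<and>
    nt_tendsto (directional_dom Q U) (\<lambda>z. Q z (f z)) g0 \<omega>"
proof -
  let ?w = "complex_of_real \<omega>"
  have v: "(v - \<gamma> f0, ?w *\<^sub>C v - z0 *\<^sub>C \<gamma> f0) \<in> A" "g0 = Q0 f0 + (?w - cnj z0) *\<^sub>C gp v"
    using rep unfolding represents_pair_iff by blast+
  obtain K K' :: "'p \<Rightarrow>\<^sub>L 'p" and N :: "'p \<Rightarrow>\<^sub>L 'g" where cl: "clinear_op K" "clinear_op K'" "clinear_op N"
    and K: "\<And>y. K y = R z0 y + \<gamma> (N y)" and adjK: "\<And>x y. ip (K x) y = ip x (K' y)"
    and diss: "\<And>y. Im (ip (y + z0 *\<^sub>C K y) (K y)) \<le> 0"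
    and accr: "\<And>y. 0 \<le> Im (ip (y + cnj z0 *\<^sub>C K' y) (K' y))"
    and inj: "\<And>\<omega> y. y + (z0 - complex_of_real \<omega>) *\<^sub>C K y = 0 \<Longrightarrow> y = 0"
    and inj': "\<And>\<omega> y. y + cnj (z0 - complex_of_real \<omega>) *\<^sub>C K' y = 0 \<Longrightarrow> y = 0"
    using that by (rule dissipative_extension)
  have adjK': "ip (K' x) y = ip x (K y)" for x y
    using adjK[of y x] commute[of x "K y"] commute[of "K' x" y] by simp
  have dense: "closure (range (\<lambda>u. u + cnj (cnj (z0 - ?w)) *\<^sub>C K u)) = UNIV"
    by (rule range_resolvent_dense[OF adjK' cl(1) inj'])
  have "\<exists>\<epsilon> k. 0 < \<epsilon> \<and> 0 < k \<and> (\<forall>l. cmod (l - ?w) < \<epsilon> \<longrightarrow> 0 < Im l \<longrightarrow> (\<exists>T. clinear_op T \<and>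
      (\<forall>y. blinfun_apply T (y + (z0 - l) *\<^sub>C K y) = y) \<and>
      (\<forall>y. blinfun_apply T y + (z0 - l) *\<^sub>C K (blinfun_apply T y) = y) \<and>
      (\<forall>y. k * min 1 (Im l) * norm (K (blinfun_apply T y)) \<le> norm y)))" (is "\<exists>\<epsilon> k. ?ex \<epsilon> k")
  proof (rule dissipative_resolvent[OF adjK cl(1,2) diss accr, of ?w])
    fix \<epsilon> k
    assume "0 < \<epsilon>" "0 < k" and "\<And>l. cmod (l - ?w) < \<epsilon> \<Longrightarrow> 0 < Im l \<Longrightarrow> \<exists>T. clinear_op T \<and>
      (\<forall>y. blinfun_apply T (y + (z0 - l) *\<^sub>C K y) = y) \<and>
      (\<forall>y. blinfun_apply T y + (z0 - l) *\<^sub>C K (blinfun_apply T y) = y) \<and>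
      (\<forall>y. k * min 1 (Im l) * norm (K (blinfun_apply T y)) \<le> norm y)"
    then have "?ex \<epsilon> k"
      by (intro conjI allI impI)
    then show "\<exists>\<epsilon> k. ?ex \<epsilon> k"
      by (intro exI)
  qed (fact inj, fact inj')
  then obtain \<epsilon> k where \<epsilon>: "0 < \<epsilon>" and k: "0 < k" and "\<forall>l. cmod (l - ?w) < \<epsilon> \<longrightarrow> 0 < Im l \<longrightarrow> (\<exists>T. clinear_op T \<and>
      (\<forall>y. blinfun_apply T (y + (z0 - l) *\<^sub>C K y) = y) \<and>
      (\<forall>y. blinfun_apply T y + (z0 - l) *\<^sub>C K (blinfun_apply T y) = y) \<and>
      (\<forall>y. k * min 1 (Im l) * norm (K (blinfun_apply T y)) \<le> norm y))"
    by (elim exE conjE) (rule that)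
  note ex = this(3)[rule_format]
  obtain r0 where r0: "0 < r0" "\<And>l. 0 < Im l \<Longrightarrow> cmod (l - ?w) < r0 \<Longrightarrow> l \<in> \<rho>"
    using resolvent_set_near_real[OF z0(1)] by blast
  \<comment> \<open>The bound 1 turns \<open>min 1 (Im l)\<close> into \<open>Im l\<close>,
    \<epsilon> provides the resolvent of the extension, and \<open>r0\<close> places the half-disc
    in the resolvent set of \<open>A\<close>.\<close>
  define r where "r = min 1 (min \<epsilon> r0)"
  have r: "0 < r" "r \<le> 1" "r \<le> \<epsilon>" "r \<le> r0"
    using \<epsilon> r0(1) by (auto simp: r_def)
  define U where "U = ball ?w r"
  define D where "D = directional_dom Q U"
  have DI: "l \<in> D \<longleftrightarrow> 0 < Im l \<and> cmod (l - ?w) < r" for l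
    using r0(2)[of l] r(4) resolvent_set_subset_hdom
    by (auto simp: D_def U_def directional_dom_def upper_half_plane_def dist_norm norm_minus_commute)
  have D\<rho>: "l \<in> \<rho>" and D_nonreal: "l \<notin> \<real>" and D_Im: "0 < Im l" "Im l \<le> 1" if "l \<in> D" for l
  proof -
    show "l \<in> \<rho>"
      using that r0(2)[of l] r(4) by (simp add: DI)
    show "0 < Im l" "l \<notin> \<real>"
      using that by (auto simp: DI complex_is_Real_iff)
    show "Im l \<le> 1"
      using that r(2) abs_Im_le_cmod[of "l - ?w"] by (simp add: DI)
  qed
  have "open D"
  proof -
    have "D = {l. 0 < Im l} \<inter> ball ?w r"
      by (auto simp: DI dist_norm norm_minus_commute)
    then show ?thesis
      by (simp add: open_Int open_halfspace_Im_gt)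
  qed
  \<comment> \<open>Outside \<open>D\<close> any complex linear operator will do; linearity is
    demanded for every \<open>l\<close> because \<open>mean_ergodic\<close> asks for it.\<close>
  define resolves where "resolves l T \<longleftrightarrow> clinear_op T \<and> (l \<in> D \<longrightarrow>
      (\<forall>y. blinfun_apply T (y + (z0 - l) *\<^sub>C K y) = y) \<and>
      (\<forall>y. blinfun_apply T y + (z0 - l) *\<^sub>C K (blinfun_apply T y) = y) \<and>
      (\<forall>y. k * Im l * norm (K (blinfun_apply T y)) \<le> norm y))" for l T
  have "\<exists>T. resolves l T" for l
  proof (cases "l \<in> D")
    case True
    then have "cmod (l - ?w) < \<epsilon>" "0 < Im l" "min 1 (Im l) = Im l"
      using r(3) D_Im[OF True] by (auto simp: DI)
    with ex[of l] show ?thesis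
      unfolding resolves_def by auto
  next
    case False
    then show ?thesis
      using clinear_op_id unfolding resolves_def by blast
  qed
  then obtain T where T: "\<And>l. resolves l (T l)"
    by metis
  have cT: "clinear_op (T l)" for l
    using T[of l] by (simp add: resolves_def)
  have T1: "T l (y + (z0 - l) *\<^sub>C K y) = y" and T2: "T l y + (z0 - l) *\<^sub>C K (T l y) = y"
    and T3: "k * Im l * norm (K (T l y)) \<le> norm y" if "l \<in> D" for l y
    using T[of l] that unfolding resolves_def by blast+
  \<comment> \<open>\<open>N\<close> reads off the first boundary value on the domain of the
    extension, and \<open>v\<close> has the first boundary value \<open>f0\<close>; thus
    \<open>f l\<close> is the first boundary value of
    \<open>v + (l - ?w) *\<^sub>C K (T l v)\<close>.\<close>
  define f where "f l = f0 + (l - ?w) *\<^sub>C N (T l v)" for l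
  have gam_f: "gam l (f l) = v + (l - ?w) *\<^sub>C K (T l v)" if l: "l \<in> D" for l
  proof (rule gam_eqI[OF D\<rho>[OF l], symmetric])
    define y where "y = T l v"
    have y: "y + (z0 - l) *\<^sub>C K y = v"
      using T2[OF l, of v] by (simp add: y_def)
    have "v + (l - ?w) *\<^sub>C K y - \<gamma> (f l) = (v - \<gamma> f0) + (l - ?w) *\<^sub>C R z0 y"
      by (simp add: f_def y_def[symmetric] K blinfun.add_right clinear_opD[OF clinear_\<gamma>] scaleC_add_right)
    moreover have "l *\<^sub>C (v + (l - ?w) *\<^sub>C K y) - z0 *\<^sub>C \<gamma> (f l) =
        (?w *\<^sub>C v - z0 *\<^sub>C \<gamma> f0) + (l - ?w) *\<^sub>C (y + z0 *\<^sub>C R z0 y)"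
    proof -
      have "y + z0 *\<^sub>C R z0 y = v + l *\<^sub>C K y - z0 *\<^sub>C \<gamma> (N y)"
        by (simp add: y[symmetric] K scaleC_add_right complex_vector.scale_left_diff_distrib)
      moreover define s where "s = l - ?w"
      have "l *\<^sub>C v = ?w *\<^sub>C v + s *\<^sub>C v"
        by (simp add: s_def scaleC_add_left[symmetric])
      moreover have "\<gamma> (f l) = \<gamma> f0 + s *\<^sub>C \<gamma> (N y)"
        by (simp add: f_def s_def y_def[symmetric] blinfun.add_right clinear_opD[OF clinear_\<gamma>])
      ultimately show ?thesis
        unfolding s_def[symmetric]
        by (simp add: scaleC_add_right complex_vector.scale_right_diff_distrib mult.commute)
    qed
    ultimately show "(v + (l - ?w) *\<^sub>C K (T l v) - \<gamma> (f l), l *\<^sub>C (v + (l - ?w) *\<^sub>C K (T l v)) - z0 *\<^sub>C \<gamma> (f l)) \<in> A"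
      using mem_add[OF v(1) mem_scale[OF resolvent_mem[OF z0(1), of y], of "l - ?w"]]
      by (simp only: y_def)
  qed
  have holo: "vholomorphic_on f D"
  proof (rule vholomorphic_onI)
    fix m assume m: "m \<in> D"
    define p where "p = K (T m v)"
    define q where "q = K (T m p)"
    \<comment> \<open>Bounds \<open>norm (T l q)\<close> for \<open>l\<close> near \<open>m\<close>.
      In the summand 2, one unit is the slack in the convergence of
      \<open>cmod (z0 - l) / (k * Im l)\<close> and the other stands for \<open>q\<close>
      itself.\<close>
    define C where "C = norm q * (cmod (z0 - m) / (k * Im m) + 2)"
    have "has_cderivative (\<lambda>l. T l v) (T m p) (at m)"
    proof (rule has_cderivative_quadratic)
      have "k * Im m \<noteq> 0"
        using k D_Im(1)[OF m] by simp
      then have "((\<lambda>l. cmod (z0 - l) / (k * Im l)) \<longlongrightarrow> cmod (z0 - m) / (k * Im m)) (at m)"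
        by (intro tendsto_intros)
      then have "\<forall>\<^sub>F l in at m. cmod (z0 - l) / (k * Im l) < cmod (z0 - m) / (k * Im m) + 1"
        by (rule order_tendstoD) simp
      moreover have "\<forall>\<^sub>F l in at m. l \<in> D"
        using \<open>open D\<close> m by (rule eventually_at_in_open')
      ultimately show "\<forall>\<^sub>F l in at m. norm (T l v - T m v - (l - m) *\<^sub>C T m p) \<le> C * (cmod (l - m))\<^sup>2"
      proof eventually_elim
        case (elim l)
        \<comment> \<open>The resolvent identity in terms of \<open>T\<close>; applied twice, it
          leaves a remainder of second order.\<close>
        have step: "T l x = T m x + (l - m) *\<^sub>C T l (K (T m x))" for x
        proof -
          have "x = (T m x + (z0 - l) *\<^sub>C K (T m x)) + (l - m) *\<^sub>C K (T m x)"
            using T2[OF m, of x] by (simp add: scaleC_add_left[symmetric] add.assoc)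
          then have "T l x = T l ((T m x + (z0 - l) *\<^sub>C K (T m x)) + (l - m) *\<^sub>C K (T m x))"
            by (rule arg_cong)
          also have "\<dots> = T m x + (l - m) *\<^sub>C T l (K (T m x))"
            by (subst blinfun.add_right) (simp only: clinear_opD[OF cT] T1[OF elim(2)])
          finally show ?thesis .
        qed
        have "T l v = T m v + (l - m) *\<^sub>C T l p" "T l p = T m p + (l - m) *\<^sub>C T l q"
          unfolding p_def q_def by (rule step)+
        then have "T l v = T m v + (l - m) *\<^sub>C (T m p + (l - m) *\<^sub>C T l q)"
          by (simp only:)
        then have "T l v - T m v - (l - m) *\<^sub>C T m p = ((l - m) * (l - m)) *\<^sub>C T l q"
          by (simp add: scaleC_add_right)
        then have eq: "norm (T l v - T m v - (l - m) *\<^sub>C T m p) = (cmod (l - m))\<^sup>2 * norm (T l q)"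
          by (simp add: norm_scaleC norm_mult power2_eq_square)
        have pos: "0 < k * Im l"
          using k D_Im(1)[OF elim(2)] by simp
        have "norm (K (T l q)) \<le> norm q / (k * Im l)"
          using T3[OF elim(2), of q] pos by (simp add: pos_le_divide_eq mult.commute)
        then have "cmod (z0 - l) * norm (K (T l q)) \<le> norm q * (cmod (z0 - l) / (k * Im l))"
          using mult_left_mono[of "norm (K (T l q))" "norm q / (k * Im l)" "cmod (z0 - l)"] by (simp add: mult.commute)
        also have "\<dots> \<le> norm q * (cmod (z0 - m) / (k * Im m) + 1)"
          using elim(1) by (intro mult_left_mono) auto
        finally have "cmod (z0 - l) * norm (K (T l q)) \<le> norm q * (cmod (z0 - m) / (k * Im m) + 1)" .
        moreover have "norm (T l q) \<le> norm q + cmod (z0 - l) * norm (K (T l q))"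
        proof -
          have "T l q = q - (z0 - l) *\<^sub>C K (T l q)"
            using T2[OF elim(2), of q] by (simp only: eq_diff_eq)
          then show ?thesis
            using norm_triangle_ineq4[of q "(z0 - l) *\<^sub>C K (T l q)"] by (simp add: norm_scaleC)
        qed
        ultimately have "norm (T l q) \<le> C"
          by (simp add: C_def distrib_left)
        then show ?case
          unfolding eq by (simp add: mult.commute mult_right_mono)
      qed
    qed
    note dT = has_cderivative_linear[OF blinfun.bounded_linear_right[of N] clinear_opD[OF cl(3)] this]
    have "((\<lambda>l. l - ?w) has_field_derivative 1) (at m)"
      by (auto intro!: derivative_eq_intros)
    from has_cderivative_add[OF has_cderivative_const[of f0] has_cderivative_scaleC[OF this dT]]
    show "\<exists>D. has_cderivative f D (at m)"
      unfolding f_def by blast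
  qed
  have lims: "(f \<longlongrightarrow> f0) F \<and> ((\<lambda>z. Q z (f z)) \<longlongrightarrow> g0) F \<and> ((\<lambda>z. gam z (f z)) \<longlongrightarrow> v) F \<and> (\<forall>\<^sub>F z in F. z \<in> D)"
    if F: "F = at ?w within nt_sector \<omega> \<theta> \<inter> D" and \<theta>: "\<theta> \<in> {0<..<pi / 2}" for F \<theta>
  proof -
    have evD: "\<forall>\<^sub>F z in F. z \<in> nt_sector \<omega> \<theta> \<and> z \<in> D"
      unfolding F eventually_at_filter by simp
    have lim: "((\<lambda>l. l) \<longlongrightarrow> ?w) F"
      unfolding F by (rule tendsto_ident_at)
    have s: "0 < sin \<theta>"
      using \<theta> by (intro sin_gt_zero) auto
    have sector_bound: "norm ((l - ?w) *\<^sub>C K (T l w)) \<le> inverse (k * sin \<theta>) * norm w"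
      if l: "l \<in> nt_sector \<omega> \<theta>" "l \<in> D" for l w
    proof -
      have "cmod (l - ?w) * sin \<theta> \<le> Im l"
        using l \<theta> by (intro nt_sector_Im) auto
      then have "k * norm (K (T l w)) * (cmod (l - ?w) * sin \<theta>) \<le> k * norm (K (T l w)) * Im l"
        using k by (intro mult_left_mono) auto
      also have "\<dots> \<le> norm w"
        using T3[OF l(2), of w] by (simp add: mult_ac)
      finally show ?thesis
        unfolding norm_scaleC using k s by (simp add: field_simps)
    qed
    have null: "((\<lambda>l. (l - ?w) *\<^sub>C K (T l v)) \<longlongrightarrow> 0) F"
    proof (rule mean_ergodic[OF cl(1) cT lim])
      show "\<forall>\<^sub>F l in F. \<forall>y. T l (y + (z0 - l) *\<^sub>C K y) = y"
        using evD by eventually_elim (simp add: T1)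
      show "\<forall>\<^sub>F l in F. \<forall>w. norm ((l - ?w) *\<^sub>C K (T l w)) \<le> inverse (k * sin \<theta>) * norm w"
        by (rule eventually_mono[OF evD]) (use sector_bound in blast)
      show "closure (range (\<lambda>u. u + (z0 - ?w) *\<^sub>C K u)) = UNIV"
        using dense by simp
    qed
    have "((\<lambda>z. v + (z - ?w) *\<^sub>C K (T z v)) \<longlongrightarrow> v + 0) F"
      by (intro tendsto_add tendsto_const null)
    moreover have "\<forall>\<^sub>F z in F. v + (z - ?w) *\<^sub>C K (T z v) = gam z (f z)"
      using evD by eventually_elim (simp add: gam_f)
    ultimately have gam_lim: "((\<lambda>z. gam z (f z)) \<longlongrightarrow> v) F"
      using tendsto_cong by fastforce
    have f_lim: "(f \<longlongrightarrow> f0) F"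
    proof -
      \<comment> \<open>The ergodic limit concerns \<open>K (T l v)\<close> only, so
        \<open>T l v\<close> is expressed by \<open>v\<close> and \<open>K (T l v)\<close> before
        the limit is taken.\<close>
      have "((\<lambda>l. f0 + N ((l - ?w) *\<^sub>C v - (z0 - l) *\<^sub>C (l - ?w) *\<^sub>C K (T l v))) \<longlongrightarrow>
          f0 + N ((?w - ?w) *\<^sub>C v - (z0 - ?w) *\<^sub>C 0)) F"
        by (intro tendsto_intros tendsto_scaleC blinfun.tendsto lim null)
      moreover have "\<forall>\<^sub>F l in F. f0 + N ((l - ?w) *\<^sub>C v - (z0 - l) *\<^sub>C (l - ?w) *\<^sub>C K (T l v)) = f l"
        using evD
      proof eventually_elim
        case (elim l)
        have "T l v = v - (z0 - l) *\<^sub>C K (T l v)"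
          using T2[of l v] elim by (simp only: eq_diff_eq)
        then have "(l - ?w) *\<^sub>C T l v = (l - ?w) *\<^sub>C v - (z0 - l) *\<^sub>C (l - ?w) *\<^sub>C K (T l v)"
          by (metis complex_vector.scale_right_diff_distrib complex_vector.scale_left_commute)
        then show ?case
          by (simp only: f_def clinear_opD[OF cl(3), symmetric])
      qed
      ultimately show ?thesis
        using tendsto_cong by fastforce
    qed
    have "((\<lambda>z. Q0 (f z) + (z - cnj z0) *\<^sub>C gp (gam z (f z))) \<longlongrightarrow> Q0 f0 + (?w - cnj z0) *\<^sub>C gp v) F"
      by (intro tendsto_intros tendsto_scaleC blinfun.tendsto lim f_lim gam_lim)
    moreover have "\<forall>\<^sub>F z in F. Q0 (f z) + (z - cnj z0) *\<^sub>C gp (gam z (f z)) = Q z (f z)"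
      using evD by eventually_elim (simp add: Q_W D\<rho> D_nonreal W_apply)
    ultimately have "((\<lambda>z. Q z (f z)) \<longlongrightarrow> g0) F"
      unfolding v(2) using tendsto_cong by fast
    then show ?thesis
      using f_lim gam_lim evD by (auto elim: eventually_mono)
  qed
  obtain C where C: "0 < C" "\<And>x y. cmod (ip x y) \<le> C * norm x * norm y"
    using bounded by blast
  have bdd: "nt_bounded D (\<lambda>z. cinner (nev_kernel Q z z (f z)) (f z)) \<omega>"
    unfolding nt_bounded_def
  proof
    fix \<theta> :: real assume \<theta>: "\<theta> \<in> {0<..<pi / 2}"
    let ?F = "at ?w within nt_sector \<omega> \<theta> \<inter> D"
    \<comment> \<open>The vectors \<open>gam z (f z)\<close> converge even in norm, so the kernel
      form stays bounded.\<close>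
    have "\<forall>\<^sub>F z in ?F. norm (gam z (f z)) < norm v + 1"
      using tendsto_norm lims[OF refl \<theta>] by (intro order_tendstoD) auto
    moreover have "\<forall>\<^sub>F z in ?F. z \<in> D"
      using lims[OF refl \<theta>] by blast
    ultimately have "\<forall>\<^sub>F z in ?F. norm (cinner (nev_kernel Q z z (f z)) (f z)) \<le> C * (norm v + 1) * (norm v + 1)"
    proof eventually_elim
      case (elim z)
      have "cmod (ip (gam z (f z)) (gam z (f z))) \<le> C * (norm v + 1) * (norm v + 1)"
        using elim(1) C(1) by (intro order_trans[OF C(2)] mult_mono mult_left_mono) auto
      then show ?case
        by (simp add: kernel_diag D\<rho> D_Im elim(2))
    qed
    then show "Bfun (\<lambda>z. cinner (nev_kernel Q z z (f z)) (f z)) ?F"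
      by (rule BfunI)
  qed
  have "nt_tendsto D f f0 \<omega>" "nt_tendsto D (\<lambda>z. Q z (f z)) g0 \<omega>"
    unfolding nt_tendsto_def using lims[OF refl] by blast+
  moreover have "open U" "?w \<in> U"
    using r(1) by (simp_all add: U_def)
  ultimately show ?thesis
    using holo bdd unfolding directional_function_def D_def by blast
qed

end

theorem theorem3p18:
  fixes Q :: "complex \<Rightarrow> ('g::complex_hilbert \<Rightarrow>\<^sub>L 'g)"
    and ip :: "'p::complex_banach \<Rightarrow> 'p \<Rightarrow> complex"
    and A :: "('p \<times> 'p) set"
    and \<gamma> :: "'g \<Rightarrow>\<^sub>L 'p"
    and z0 :: complex
    and \<omega> :: real
  assumes "Q \<in> generalised_nevanlinna"
    and "minimal_realisation Q ip A \<gamma> z0"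
  shows "(\<forall>f0 g0.
      ((\<exists>U f. directional_function Q \<omega> U f \<and>
          nt_tendsto (directional_dom Q U) f f0 \<omega> \<and>
          nt_tendsto (directional_dom Q U) (\<lambda>z. blinfun_apply (Q z) (f z)) g0 \<omega>)
        \<longleftrightarrow> directional_pair Q \<omega> (f0, g0)) \<and>
      (directional_pair Q \<omega> (f0, g0) \<longleftrightarrow> (f0, g0) \<in> generalised_value Q ip A \<gamma> z0 \<omega>) \<and>
      ((f0, g0) \<in> generalised_value Q ip A \<gamma> z0 \<omega> \<longleftrightarrow>
        (\<exists>v. represents_pair Q ip A \<gamma> z0 \<omega> f0 g0 v))) \<and>
    (\<forall>f0 g0 v v'. represents_pair Q ip A \<gamma> z0 \<omega> f0 g0 v \<and>
        represents_pair Q ip A \<gamma> z0 \<omega> f0 g0 v' \<longrightarrow> v = v') \<and>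
    (strict_nevanlinna Q A \<longrightarrow>
        (\<forall>f0 g0 f0' g0' v. represents_pair Q ip A \<gamma> z0 \<omega> f0 g0 v \<and>
          represents_pair Q ip A \<gamma> z0 \<omega> f0' g0' v \<longrightarrow> f0 = f0' \<and> g0 = g0'))"
proof -
  interpret realisation Q ip A \<gamma> z0
    using assms by unfold_locales
  have pair: "directional_pair Q \<omega> (f0, g0) \<longleftrightarrow>
      (\<exists>U f. directional_function Q \<omega> U f \<and> nt_tendsto (directional_dom Q U) f f0 \<omega> \<and>
        nt_tendsto (directional_dom Q U) (\<lambda>z. Q z (f z)) g0 \<omega>)" for f0 g0
    by (simp add: directional_pair_def)
  have value_iff: "directional_pair Q \<omega> (f0, g0) \<longleftrightarrow> (f0, g0) \<in> generalised_value Q ip A \<gamma> z0 \<omega>" for f0 g0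
    unfolding pair generalised_value_iff
  proof
    assume "\<exists>U f. directional_function Q \<omega> U f \<and> nt_tendsto (directional_dom Q U) f f0 \<omega> \<and>
        nt_tendsto (directional_dom Q U) (\<lambda>z. Q z (f z)) g0 \<omega>"
    then obtain U f where f: "directional_function Q \<omega> U f" "nt_tendsto (directional_dom Q U) f f0 \<omega>"
        "nt_tendsto (directional_dom Q U) (\<lambda>z. Q z (f z)) g0 \<omega>"
      by (elim exE conjE)
    show "\<exists>v. represents_pair Q ip A \<gamma> z0 \<omega> f0 g0 v"
      by (rule directional_pair_imp_represents[OF _ _ f(2,3)])
        (use f(1) in \<open>simp_all only: directional_function_def\<close>)
  next
    assume "\<exists>v. represents_pair Q ip A \<gamma> z0 \<omega> f0 g0 v"
    then show "\<exists>U f. directional_function Q \<omega> U f \<and> nt_tendsto (directional_dom Q U) f f0 \<omega> \<and>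
        nt_tendsto (directional_dom Q U) (\<lambda>z. Q z (f z)) g0 \<omega>"
      by (elim exE) (rule represents_imp_directional_function)
  qed
  show ?thesis
    by (intro conjI allI impI pair[symmetric] value_iff generalised_value_iff)
      (elim conjE, erule (1) represents_pair_unique,
       (elim conjE, drule (2) represents_pair_strict, simp)+)
qed

end
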